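(* Let $N_j=(X_j,d_j,T_j)$ be precompact integral current spaces of dimension $m$ converging to a precompact integral current space $N=(X,d,T)$ in the intrinsic flat volume sense, $N_j\xrightarrow{\mathcal{VF}}N$. Let $(Z,d_Z)$ be a complete metric space and $\varphi_j:X_j\to Z$, $\varphi:X\to Z$ isometric embeddings with $\varphi_{j\#}T_j\to\varphi_\#T$ in $d_Z^F$. Let $u:X\to\mathbb R$ be Lipschitz, let $U:Z\to\mathbb R$ be its extension $U(z)=\inf_{y\in\varphi(X)}\{u(\varphi^{-1}(y))+\mathrm{Lip}(u)d_Z(z,y)\}$, and let $u_j=U\circ\varphi_j:X_j\to\mathbb R$. For $\delta\in\mathbb R$ and $\delta_1<\delta_2$ put $$E^\delta=\{u\le\delta\},\quad A^{\delta_1,\delta_2}=\{\delta_1\le u\le\delta_2\}\subseteq X,\qquad E_j^\delta=\{u_j\le\delta\},\quad A_j^{\delta_1,\delta_2}=\{\delta_1\le u_j\le\delta_2\}\subseteq X_j.$$ Upon passing to a subsequence: (a) for almost all $\delta\in\mathbb R$, $\mathbb M(T_j\llcorner E_j^\delta)\to\mathbb M(T\llcorner E^\delta)$ as $j\to\infty$, and (b) for almost all $\delta_1<\delta_2$, $\mathbb M(T_j\llcorner A_j^{\delta_1,\delta_2})\to\mathbb M(T\llcorner A^{\delta_1,\delta_2})$ as $j\to\infty$.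
   Context: Currents are in the sense of Ambrosio–Kirchheim. On a complete metric space $Y$, an $m$-current is a real multilinear functional $T(f,\pi_1,\dots,\pi_m)$ ($f$ bounded Lipschitz, $\pi_i$ Lipschitz) that is continuous under pointwise convergence of the $\pi_i$ with uniformly bounded Lipschitz constants, vanishes if some $\pi_i$ is constant on a neighborhood of $\{f\ne0\}$, and satisfies $|T(f,\pi)|\le\int|f|d\mu$ for some finite Borel measure $\mu$ whenever all $\mathrm{Lip}(\pi_i)\le1$. The minimal $\mu$ is $\|T\|$; $\mathbb M(T)=\|T\|(Y)$; $T$ extends to bounded Borel $f$. $\mathrm{set}(T)=\{p:\liminf_{r\to0}\|T\|(B(p,r))/r^m>0\}$. $\partial T(f,\pi_1,\dots,\pi_{m-1})=T(1,f,\pi_1,\dots,\pi_{m-1})$, $(T\llcorner A)(f,\pi)=T(f\chi_A,\pi)$ for Borel $A$, $\varphi_\#T(f,\pi_i)=T(f\circ\varphi,\pi_i\circ\varphi)$. $T$ is integer rectifiable if $T=\sum T_i$, $\mathbb M(T)=\sum\mathbb M(T_i)$, $T_i(f,\pi)=\int_{K_i}\theta_i(f\circ\varphi_i)d(\pi_1\circ\varphi_i)\wedge\dots\wedge d(\pi_m\circ\varphi_i)$ with $K_i\subset\mathbb R^m$ compact, $\theta_i\in L^1(\mathbb R^m,\mathbb Z)$ supported in $K_i$, $\varphi_i:K_i\to Y$ bi-Lipschitz onto its image; integral if also $\partial T$ has finite mass. An integral current space of dimension $m$ is $(X,d,T)$ with $(X,d)$ a (not necessarily complete) metric space and $T$ an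 integral $m$-current on the completion $(\bar X,\bar d)$ with $\mathrm{set}(T)=X$; the zero space ($X=\emptyset,T=0$) is allowed. It is precompact if $(X,d)$ is; $\mathbb M(N)=\mathbb M(T)$. Isometric embeddings (distance-preserving maps) extend to completions, with the same notation. $d_Z^F(T_1,T_2)=\inf\{\mathbb M(A)+\mathbb M(B):T_2-T_1=A+\partial B\}$ over integral currents $A,B$ on $Z$ of dimensions $m,m+1$. $d_{\mathcal F}(N_1,N_2)=\inf d_Z^F(\varphi_{1\#}T_1,\varphi_{2\#}T_2)$ over complete metric spaces $Z$ and isometric embeddings $\varphi_i:X_i\to Z$. $N_j\xrightarrow{\mathcal{VF}}N$ means $d_{\mathcal F}(N_j,N)+|\mathbb M(N_j)-\mathbb M(N)|\to0$. *)

theory Defs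
  imports "HOL-Analysis.Analysis"
begin

section \<open>Lipschitz functions on a metric space\<close>

text \<open>
  A metric space is an element of the library type \<^typ>\<open>'a metric\<close>; its carrier may be a proper
  subset of the type and may be empty.  Real functions on it are total functions whose values off
  the carrier are irrelevant.
\<close>

definition lipschitz_bound :: "'a metric \<Rightarrow> real \<Rightarrow> ('a \<Rightarrow> real) \<Rightarrow> bool" where
  "lipschitz_bound Y L f \<longleftrightarrow>
     0 \<le> L \<and> (\<forall>x\<in>mspace Y. \<forall>y\<in>mspace Y. \<bar>f x - f y\<bar> \<le> L * mdist Y x y)"

definition Lip :: "'a metric \<Rightarrow> ('a \<Rightarrow> real) \<Rightarrow> real" where
  "Lip Y f = Inf {L. lipschitz_bound Y L f}"

abbreviation lipschitz_fun :: "'a metric \<Rightarrow> ('a \<Rightarrow> real) \<Rightarrow> bool" where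
  "lipschitz_fun Y f \<equiv> Lipschitz_continuous_map Y euclidean_metric f"

definition bounded_lipschitz :: "'a metric \<Rightarrow> ('a \<Rightarrow> real) \<Rightarrow> bool" where
  "bounded_lipschitz Y f \<longleftrightarrow> lipschitz_fun Y f \<and> bounded (f ` mspace Y)"

section \<open>Metric currents\<close>

text \<open>
  The value \<open>T f [\<pi>\<^sub>1, \<dots>, \<pi>\<^sub>m]\<close> of a current is meaningful only on \<^emph>\<open>forms\<close>, that is, for bounded
  Lipschitz \<open>f\<close> and a list of \<open>m\<close> Lipschitz functions.  The equality of two currents is therefore
  always stated on forms.
\<close>

type_synonym 'a functional = "('a \<Rightarrow> real) \<Rightarrow> ('a \<Rightarrow> real) list \<Rightarrow> real"

definition form :: "nat \<Rightarrow> 'a metric \<Rightarrow> ('a \<Rightarrow> real) \<Rightarrow> ('a \<Rightarrow> real) list \<Rightarrow> bool" where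
  "form m Y f ps \<longleftrightarrow>
     bounded_lipschitz Y f \<and> length ps = m \<and> (\<forall>p\<in>set ps. lipschitz_fun Y p)"

definition metric_borel :: "'a metric \<Rightarrow> 'a measure" where
  "metric_borel Y = sigma (mspace Y) {U. openin (mtopology_of Y) U}"

definition finite_borel_measure :: "'a metric \<Rightarrow> 'a measure \<Rightarrow> bool" where
  "finite_borel_measure Y \<mu> \<longleftrightarrow> finite_measure \<mu> \<and> sets \<mu> = sets (metric_borel Y)"

definition controls :: "nat \<Rightarrow> 'a metric \<Rightarrow> 'a functional \<Rightarrow> 'a measure \<Rightarrow> bool" where
  "controls m Y T \<mu> \<longleftrightarrow>
     finite_borel_measure Y \<mu> \<and>
     (\<forall>f ps. form m Y f ps \<longrightarrow> (\<forall>p\<in>set ps. lipschitz_bound Y 1 p) \<longrightarrow>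
        \<bar>T f ps\<bar> \<le> (LINT x|\<mu>. \<bar>f x\<bar>))"

definition finite_mass :: "nat \<Rightarrow> 'a metric \<Rightarrow> 'a functional \<Rightarrow> bool" where
  "finite_mass m Y T \<longleftrightarrow> (\<exists>\<mu>. controls m Y T \<mu>)"

definition multilinear :: "nat \<Rightarrow> 'a metric \<Rightarrow> 'a functional \<Rightarrow> bool" where
  "multilinear m Y T \<longleftrightarrow>
     (\<forall>f g ps a b. form m Y f ps \<longrightarrow> form m Y g ps \<longrightarrow>
        T (\<lambda>x. a * f x + b * g x) ps = a * T f ps + b * T g ps) \<and>
     (\<forall>f ps i p q a b. form m Y f ps \<longrightarrow> i < m \<longrightarrow> lipschitz_fun Y p \<longrightarrow> lipschitz_fun Y q \<longrightarrow>
        T f (ps[i := (\<lambda>x. a * p x + b * q x)]) = a * T f (ps[i := p]) + b * T f (ps[i := q]))"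

definition continuous_current :: "nat \<Rightarrow> 'a metric \<Rightarrow> 'a functional \<Rightarrow> bool" where
  "continuous_current m Y T \<longleftrightarrow>
     (\<forall>f ps qs L. form m Y f ps \<longrightarrow> (\<forall>n. length (qs n) = m) \<longrightarrow>
        (\<forall>n. \<forall>q\<in>set (qs n). lipschitz_bound Y L q) \<longrightarrow>
        (\<forall>i<m. \<forall>x\<in>mspace Y. (\<lambda>n. (qs n ! i) x) \<longlonglongrightarrow> (ps ! i) x) \<longrightarrow>
        (\<lambda>n. T f (qs n)) \<longlonglongrightarrow> T f ps)"

definition local_current :: "nat \<Rightarrow> 'a metric \<Rightarrow> 'a functional \<Rightarrow> bool" where
  "local_current m Y T \<longleftrightarrow>
     (\<forall>f ps. form m Y f ps \<longrightarrow>
        (\<exists>p\<in>set ps. \<exists>U c. openin (mtopology_of Y) U \<and> {x\<in>mspace Y. f x \<noteq> 0} \<subseteq> U \<and>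
                         (\<forall>x\<in>U. p x = c)) \<longrightarrow>
        T f ps = 0)"

definition metric_current :: "nat \<Rightarrow> 'a metric \<Rightarrow> 'a functional \<Rightarrow> bool" where
  "metric_current m Y T \<longleftrightarrow>
     multilinear m Y T \<and> continuous_current m Y T \<and> local_current m Y T \<and> finite_mass m Y T"

definition mass_measure :: "nat \<Rightarrow> 'a metric \<Rightarrow> 'a functional \<Rightarrow> 'a measure" where
  "mass_measure m Y T =
     (THE \<mu>. controls m Y T \<mu> \<and>
        (\<forall>\<nu>. controls m Y T \<nu> \<longrightarrow> (\<forall>B\<in>sets (metric_borel Y). emeasure \<mu> B \<le> emeasure \<nu> B)))"

definition mass :: "nat \<Rightarrow> 'a metric \<Rightarrow> 'a functional \<Rightarrow> real" where
  "mass m Y T = measure (mass_measure m Y T) (mspace Y)"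

definition current_set :: "nat \<Rightarrow> 'a metric \<Rightarrow> 'a functional \<Rightarrow> 'a set" where
  "current_set m Y T =
     {p\<in>mspace Y. Liminf (at_right 0)
        (\<lambda>r. ereal (measure (mass_measure m Y T) (mball_of Y p r) / r ^ m)) > 0}"

definition boundary :: "'a functional \<Rightarrow> 'a functional" where
  "boundary T = (\<lambda>f ps. T (\<lambda>_. 1) (f # ps))"

definition pushforward :: "('a \<Rightarrow> 'b) \<Rightarrow> 'a functional \<Rightarrow> 'b functional" where
  "pushforward \<phi> T = (\<lambda>f ps. T (f \<circ> \<phi>) (map (\<lambda>p. p \<circ> \<phi>) ps))"

text \<open>
  The extension of a current to bounded Borel \<open>f\<close> is the one by continuity in \<open>L\<^sup>1\<close> of its mass
  measure, in which the bounded Lipschitz functions are dense.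
\<close>

definition borel_extension :: "nat \<Rightarrow> 'a metric \<Rightarrow> 'a functional \<Rightarrow> 'a functional" where
  "borel_extension m Y T = (\<lambda>f ps. THE c. \<forall>g.
     (\<forall>n. bounded_lipschitz Y (g n)) \<longrightarrow>
     (\<lambda>n. \<integral>\<^sup>+x. ennreal \<bar>g n x - f x\<bar> \<partial>mass_measure m Y T) \<longlonglongrightarrow> 0 \<longrightarrow>
     (\<lambda>n. T (g n) ps) \<longlonglongrightarrow> c)"

definition restrict_current :: "nat \<Rightarrow> 'a metric \<Rightarrow> 'a functional \<Rightarrow> 'a set \<Rightarrow> 'a functional" where
  "restrict_current m Y T A = (\<lambda>f ps. borel_extension m Y T (\<lambda>x. f x * indicator A x) ps)"

section \<open>Integral currents\<close>

text \<open>
  The space \<open>\<real>\<^sup>m\<close>, for a dimension \<open>m\<close> that is a variable (the flat distance needs both \<open>m\<close> and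
  \<open>m + 1\<close>) and may be \<open>0\<close>, consists of the extensional functions on \<open>{..<m}\<close>.
\<close>

definition Rn_metric :: "nat \<Rightarrow> (nat \<Rightarrow> real) metric" where
  "Rn_metric m = metric ({..<m} \<rightarrow>\<^sub>E UNIV, \<lambda>x y. L2_set (\<lambda>i. x i - y i) {..<m})"

definition Rn_lebesgue :: "nat \<Rightarrow> (nat \<Rightarrow> real) measure" where
  "Rn_lebesgue m = (\<Pi>\<^sub>M i\<in>{..<m}. lborel)"

lemma Metric_space_Rn:
  fixes m :: nat
  shows "Metric_space ({..<m} \<rightarrow>\<^sub>E (UNIV :: real set)) (\<lambda>x y. L2_set (\<lambda>i. x i - y i) {..<m})"
proof
  fix x y z :: "nat \<Rightarrow> real"
  show "0 \<le> L2_set (\<lambda>i. x i - y i) {..<m}" by simp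
  show "L2_set (\<lambda>i. x i - y i) {..<m} = L2_set (\<lambda>i. y i - x i) {..<m}"
    by (simp add: L2_set_def power2_commute)
  assume "x \<in> {..<m} \<rightarrow>\<^sub>E UNIV" and y: "y \<in> {..<m} \<rightarrow>\<^sub>E UNIV"
  then show "L2_set (\<lambda>i. x i - y i) {..<m} = 0 \<longleftrightarrow> x = y"
    by (auto simp: L2_set_eq_0_iff intro: PiE_ext)
  have "L2_set (\<lambda>i. x i - z i) {..<m} = L2_set (\<lambda>i. (x i - y i) + (y i - z i)) {..<m}"
    by simp
  also have "\<dots> \<le> L2_set (\<lambda>i. x i - y i) {..<m} + L2_set (\<lambda>i. y i - z i) {..<m}"
    by (rule L2_set_triangle_ineq)
  finally show "L2_set (\<lambda>i. x i - z i) {..<m}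
      \<le> L2_set (\<lambda>i. x i - y i) {..<m} + L2_set (\<lambda>i. y i - z i) {..<m}" .
qed

lemma mspace_Rn_metric [simp]: "mspace (Rn_metric m) = {..<m} \<rightarrow>\<^sub>E UNIV"
  unfolding Rn_metric_def by (rule Metric_space.mspace_metric[OF Metric_space_Rn])

lemma mdist_Rn_metric [simp]: "mdist (Rn_metric m) x y = L2_set (\<lambda>i. x i - y i) {..<m}"
  unfolding Rn_metric_def by (simp add: Metric_space.mdist_metric[OF Metric_space_Rn])

definition partial_deriv :: "nat \<Rightarrow> ((nat \<Rightarrow> real) \<Rightarrow> real) \<Rightarrow> (nat \<Rightarrow> real) \<Rightarrow> real" where
  "partial_deriv j h x = deriv (\<lambda>t. h (x(j := t))) (x j)"

text \<open>The coefficient of \<open>dh\<^sub>1 \<and> \<dots> \<and> dh\<^sub>m\<close> with respect to \<open>dx\<^sub>1 \<and> \<dots> \<and> dx\<^sub>m\<close>.\<close>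

definition jacobian_det :: "nat \<Rightarrow> (nat \<Rightarrow> (nat \<Rightarrow> real) \<Rightarrow> real) \<Rightarrow> (nat \<Rightarrow> real) \<Rightarrow> real" where
  "jacobian_det m h x =
     (\<Sum>\<sigma> | \<sigma> permutes {..<m}. of_int (sign \<sigma>) * (\<Prod>i<m. partial_deriv (\<sigma> i) (h i) x))"

definition bilipschitz_chart ::
    "nat \<Rightarrow> 'a metric \<Rightarrow> (nat \<Rightarrow> real) set \<Rightarrow> ((nat \<Rightarrow> real) \<Rightarrow> 'a) \<Rightarrow> bool" where
  "bilipschitz_chart m Y K \<phi> \<longleftrightarrow>
     compactin (mtopology_of (Rn_metric m)) K \<and> \<phi> \<in> K \<rightarrow> mspace Y \<and>
     (\<exists>L>0. \<forall>x\<in>K. \<forall>y\<in>K.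
        mdist (Rn_metric m) x y / L \<le> mdist Y (\<phi> x) (\<phi> y) \<and>
        mdist Y (\<phi> x) (\<phi> y) \<le> L * mdist (Rn_metric m) x y)"

text \<open>
  The Lipschitz functions \<open>\<pi>\<^sub>i \<circ> \<phi>\<close> live on the compact set \<open>K\<close> only; their differentials are those
  of Lipschitz extensions \<open>h\<^sub>i\<close> to \<open>\<real>\<^sup>m\<close>.  Extensions exist, and two of them have the same partial
  derivatives almost everywhere on \<open>K\<close>, so the choice does not matter.
\<close>

definition chart_current ::
    "nat \<Rightarrow> 'a metric \<Rightarrow> (nat \<Rightarrow> real) set \<Rightarrow> ((nat \<Rightarrow> real) \<Rightarrow> int) \<Rightarrow> ((nat \<Rightarrow> real) \<Rightarrow> 'a)
      \<Rightarrow> 'a functional \<Rightarrow> bool" where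
  "chart_current m Y K \<theta> \<phi> S \<longleftrightarrow>
     bilipschitz_chart m Y K \<phi> \<and>
     integrable (Rn_lebesgue m) (\<lambda>x. real_of_int (\<theta> x)) \<and>
     (\<forall>x\<in>mspace (Rn_metric m) - K. \<theta> x = 0) \<and>
     metric_current m Y S \<and>
     (\<forall>f ps h. form m Y f ps \<longrightarrow>
        (\<forall>i<m. lipschitz_fun (Rn_metric m) (h i) \<and> (\<forall>x\<in>K. h i x = (ps ! i) (\<phi> x))) \<longrightarrow>
        S f ps = (LINT x:K|Rn_lebesgue m. real_of_int (\<theta> x) * f (\<phi> x) * jacobian_det m h x))"

text \<open>Finite decompositions are covered, since the chart of a summand may be empty.\<close>

definition integer_rectifiable :: "nat \<Rightarrow> 'a metric \<Rightarrow> 'a functional \<Rightarrow> bool" where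
  "integer_rectifiable m Y T \<longleftrightarrow>
     metric_current m Y T \<and>
     (\<exists>S :: nat \<Rightarrow> 'a functional.
        (\<forall>i. \<exists>K \<theta> \<phi>. chart_current m Y K \<theta> \<phi> (S i)) \<and>
        (\<forall>f ps. form m Y f ps \<longrightarrow> (\<lambda>i. S i f ps) sums T f ps) \<and>
        (\<lambda>i. mass m Y (S i)) sums mass m Y T)"

text \<open>A current of dimension \<open>0\<close> has no boundary.\<close>

definition integral_current :: "nat \<Rightarrow> 'a metric \<Rightarrow> 'a functional \<Rightarrow> bool" where
  "integral_current m Y T \<longleftrightarrow>
     integer_rectifiable m Y T \<and> (m > 0 \<longrightarrow> finite_mass (m - 1) Y (boundary T))"

definition flat_dist :: "nat \<Rightarrow> 'a metric \<Rightarrow> 'a functional \<Rightarrow> 'a functional \<Rightarrow> ennreal" where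
  "flat_dist m Z T1 T2 =
     Inf {ennreal (mass m Z A + mass (m + 1) Z B) | A B.
            integral_current m Z A \<and> integral_current (m + 1) Z B \<and>
            (\<forall>f ps. form m Z f ps \<longrightarrow> T2 f ps - T1 f ps = A f ps + boundary B f ps)}"

section \<open>Integral current spaces\<close>

definition is_completion :: "'a metric \<Rightarrow> 'a metric \<Rightarrow> bool" where
  "is_completion X Xc \<longleftrightarrow>
     mcomplete_of Xc \<and> mspace X \<subseteq> mspace Xc \<and>
     (\<forall>x\<in>mspace X. \<forall>y\<in>mspace X. mdist Xc x y = mdist X x y) \<and>
     mtopology_of Xc closure_of mspace X = mspace Xc"

text \<open>
  The completion, unique up to an isometry fixing the space, is part of the data.
\<close>

record 'a current_space =
  base :: "'a metric"
  completion :: "'a metric"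
  current :: "'a functional"

definition integral_current_space :: "nat \<Rightarrow> 'a current_space \<Rightarrow> bool" where
  "integral_current_space m N \<longleftrightarrow>
     is_completion (base N) (completion N) \<and>
     integral_current m (completion N) (current N) \<and>
     current_set m (completion N) (current N) = mspace (base N)"

definition precompact_metric :: "'a metric \<Rightarrow> bool" where
  "precompact_metric X \<longleftrightarrow> Metric_space.mtotally_bounded (mspace X) (mdist X) (mspace X)"

definition space_mass :: "nat \<Rightarrow> 'a current_space \<Rightarrow> real" where
  "space_mass m N = mass m (completion N) (current N)"

definition isometric_embedding :: "'a metric \<Rightarrow> 'b metric \<Rightarrow> ('a \<Rightarrow> 'b) \<Rightarrow> bool" where
  "isometric_embedding X Z \<phi> \<longleftrightarrow>
     \<phi> \<in> mspace X \<rightarrow> mspace Z \<and>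
     (\<forall>x\<in>mspace X. \<forall>y\<in>mspace X. mdist Z (\<phi> x) (\<phi> y) = mdist X x y)"

text \<open>The continuous extension of a map on \<open>X\<close> to the completion \<open>Xc\<close>.\<close>

definition extend_to_completion ::
    "'a metric \<Rightarrow> 'a metric \<Rightarrow> 'b metric \<Rightarrow> ('a \<Rightarrow> 'b) \<Rightarrow> 'a \<Rightarrow> 'b" where
  "extend_to_completion X Xc Z \<phi> x =
     (THE z. \<forall>\<sigma>. range \<sigma> \<subseteq> mspace X \<longrightarrow> limitin (mtopology_of Xc) \<sigma> x sequentially \<longrightarrow>
        limitin (mtopology_of Z) (\<phi> \<circ> \<sigma>) z sequentially)"

definition push_current :: "'a current_space \<Rightarrow> 'b metric \<Rightarrow> ('a \<Rightarrow> 'b) \<Rightarrow> 'b functional" where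
  "push_current N Z \<phi> =
     pushforward (extend_to_completion (base N) (completion N) Z \<phi>) (current N)"

text \<open>
  The infimum over all complete metric spaces \<open>Z\<close> is one over the metrics with carrier in a type
  \<open>'w\<close>, because types cannot be quantified over.  Integral currents are concentrated on separable
  sets, so separable \<open>Z\<close> suffice, and every type \<open>'w\<close> with at least continuum many elements gives
  the infimum over all complete metric spaces.
\<close>

definition intrinsic_flat_dist ::
    "'w itself \<Rightarrow> nat \<Rightarrow> 'a current_space \<Rightarrow> 'b current_space \<Rightarrow> ennreal" where
  "intrinsic_flat_dist (_ :: 'w itself) m N1 N2 =
     Inf {flat_dist m Z (push_current N1 Z \<phi>1) (push_current N2 Z \<phi>2) |
            (Z :: 'w metric) \<phi>1 \<phi>2.
            mcomplete_of Z \<and> isometric_embedding (base N1) Z \<phi>1 \<and>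
            isometric_embedding (base N2) Z \<phi>2}"

definition VF_converges ::
    "'w itself \<Rightarrow> nat \<Rightarrow> (nat \<Rightarrow> 'a current_space) \<Rightarrow> 'b current_space \<Rightarrow> bool" where
  "VF_converges W m Nj N \<longleftrightarrow>
     (\<lambda>j. intrinsic_flat_dist W m (Nj j) N + ennreal \<bar>space_mass m (Nj j) - space_mass m N\<bar>)
       \<longlonglongrightarrow> 0"

definition lipschitz_extension ::
    "'a metric \<Rightarrow> 'b metric \<Rightarrow> ('a \<Rightarrow> 'b) \<Rightarrow> ('a \<Rightarrow> real) \<Rightarrow> 'b \<Rightarrow> real" where
  "lipschitz_extension X Z \<phi> u z =
     (INF y\<in>\<phi> ` mspace X. u (inv_into (mspace X) \<phi> y) + Lip X u * mdist Z z y)"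

text \<open>The mass \<open>M(T\<lfloor>A)\<close> for the current \<open>T\<close> of \<open>N\<close> and a subset \<open>A\<close> of its completion.\<close>

definition mass_on :: "nat \<Rightarrow> 'a current_space \<Rightarrow> 'a set \<Rightarrow> real" where
  "mass_on m N A =
     mass m (completion N) (restrict_current m (completion N) (current N) A)"

definition sublevel :: "'a metric \<Rightarrow> ('a \<Rightarrow> real) \<Rightarrow> real \<Rightarrow> 'a set" where
  "sublevel X u \<delta> = {x\<in>mspace X. u x \<le> \<delta>}"

definition annulus :: "'a metric \<Rightarrow> ('a \<Rightarrow> real) \<Rightarrow> real \<Rightarrow> real \<Rightarrow> 'a set" where
  "annulus X u \<delta>1 \<delta>2 = {x\<in>mspace X. \<delta>1 \<le> u x \<and> u x \<le> \<delta>2}"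

end

theory Submission
  imports Defs
begin

text \<open>
  Let $\nu_j$ and $\nu$ be the mass measures of the currents \<open>T\<^sub>j\<close> and \<open>T\<close>, transported to \<open>Z\<close> by the
  embeddings. A flat decomposition with small masses bounds the difference of the currents on every
  form, so the currents converge on forms. Mass is lower semicontinuous on open sets under this
  convergence (\<open>mass_measure_lsc\<close>). Since the total masses converge, taking complements gives upper
  semicontinuity on closed sets (\<open>measure_tendsto_closed\<close>). So $\nu_j(C) \to \nu(C)$ whenever \<open>C\<close> is
  closed and contains an open set of the same $\nu$-measure. The preimages under \<open>U\<close> of the half-line
  bounded by $\delta$ and of the interval from $\delta_1$ to $\delta_2$ are of this kind unless one of
  the end points is an atom of the image of $\nu$ under \<open>U\<close>, and a finite measure has only countably
  many atoms. The whole sequence serves as the subsequence.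

  Lower semicontinuity rests on a description of the mass measure. For a fixed tuple \<open>ps\<close> of
  1-Lipschitz functions, the functional \<open>f \<mapsto> T f ps\<close> is bounded by the $L^1$ norm of a measure $\mu$
  that controls \<open>T\<close>. By the Radon-Nikodym theorem it is integration against a density $h$ with
  $|h| \le 1$ (\<open>ext_density\<close>). The mass measure is the supremum, in the lattice of measures, of all the
  measures $|h|\mu$ (\<open>ex_mass_densities\<close>); in particular it exists. For a single density the
  inequality on open sets is clear, and it passes to suprema because two disjoint Borel sets can be
  separated by disjoint open sets up to small measure (\<open>open_dominated_sup\<close>).

  Two facts relate these measures to the masses in the theorem. The mass of the restriction of \<open>T\<close>
  to a Borel set \<open>A\<close> is the mass measure of \<open>A\<close> (\<open>mass_restrict\<close>). Moreover, sublevel sets and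
  annuli are subsets of \<open>X\<close>, while the mass measure lives on the completion, so it has to be
  concentrated on \<open>X\<close>, the set of the current (\<open>rectifiable_concentrated\<close>). By additivity of mass this
  reduces to a single chart \<open>\<phi>\<close> with multiplicity \<open>\<theta>\<close>. There the mass is comparable to the image of
  the measure with density $|\theta|$: it is bounded from above because Jacobians of Lipschitz
  functions are bounded (\<open>mass_le_\<rho>\<close>), and from below by inserting the coordinates of the inverse
  chart (\<open>\<rho>_le_mass\<close>). Finally, almost every point of a Borel subset of Euclidean space has positive
  lower density, by a covering argument with dyadic cubes (\<open>lower_density_positive\<close>).
\<close>

section \<open>Lipschitz functions\<close>

lemma lipschitz_fun_iff: "lipschitz_fun Y f \<longleftrightarrow> (\<exists>L. lipschitz_bound Y L f)"
proof
  assume "lipschitz_fun Y f"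
  then show "\<exists>L. lipschitz_bound Y L f"
    unfolding Lipschitz_continuous_map_pos lipschitz_bound_def
    by (auto simp: dist_real_def intro: less_imp_le)
next
  assume "\<exists>L. lipschitz_bound Y L f"
  then show "lipschitz_fun Y f"
    unfolding Lipschitz_continuous_map_def lipschitz_bound_def
    by (auto simp: dist_real_def)
qed

lemma bounded_lipschitz_iff:
  "bounded_lipschitz Y f \<longleftrightarrow> (\<exists>L M. lipschitz_bound Y L f \<and> (\<forall>x\<in>mspace Y. \<bar>f x\<bar> \<le> M))"
  unfolding bounded_lipschitz_def lipschitz_fun_iff bounded_iff by auto

lemma lipschitz_funI: "lipschitz_bound Y L f \<Longrightarrow> lipschitz_fun Y f"
  unfolding lipschitz_fun_iff by (rule exI)

lemma lipschitz_funE: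
  assumes "lipschitz_fun Y f" obtains L where "lipschitz_bound Y L f"
  using assms unfolding lipschitz_fun_iff by (rule exE)

lemma bounded_lipschitzI:
  assumes "lipschitz_bound Y L f" "\<And>x. x \<in> mspace Y \<Longrightarrow> \<bar>f x\<bar> \<le> M"
  shows "bounded_lipschitz Y f"
  unfolding bounded_lipschitz_iff using assms by (intro exI[of _ L] exI[of _ M]) simp

lemma bounded_lipschitzE:
  assumes "bounded_lipschitz Y f"
  obtains L M where "lipschitz_bound Y L f" "\<forall>x\<in>mspace Y. \<bar>f x\<bar> \<le> M"
  using assms unfolding bounded_lipschitz_iff by (elim exE conjE)

lemma bounded_lipschitz_imp_lipschitz: "bounded_lipschitz Y f \<Longrightarrow> lipschitz_fun Y f"
  by (simp add: bounded_lipschitz_def)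

lemma bounded_lipschitz_bound:
  assumes "bounded_lipschitz Y f"
  obtains M where "0 < M" "\<And>x. x \<in> mspace Y \<Longrightarrow> \<bar>f x\<bar> \<le> M"
  using assms unfolding bounded_lipschitz_def bounded_pos by auto

lemma lipschitz_boundD:
  assumes "lipschitz_bound Y L f" "x \<in> mspace Y" "y \<in> mspace Y" shows "\<bar>f x - f y\<bar> \<le> L * mdist Y x y"
  by (rule bspec[OF bspec[OF conjunct2[OF iffD1[OF lipschitz_bound_def assms(1)]] assms(2)] assms(3)])

lemma lipschitz_bound_const: "lipschitz_bound Y 0 (\<lambda>_. c)"
  by (simp add: lipschitz_bound_def)

lemma lipschitz_bound_mono: "lipschitz_bound Y L f \<Longrightarrow> L \<le> L' \<Longrightarrow> lipschitz_bound Y L' f"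
  unfolding lipschitz_bound_def
  by (auto intro: order_trans[OF _ mult_right_mono[OF _ mdist_nonneg]])

lemma lipschitz_bound_scale:
  assumes "lipschitz_bound Y L f" shows "lipschitz_bound Y (\<bar>a\<bar> * L) (\<lambda>x. a * f x)"
  unfolding lipschitz_bound_def
proof (intro conjI ballI)
  show "0 \<le> \<bar>a\<bar> * L" using assms by (simp add: lipschitz_bound_def)
  fix x y assume "x \<in> mspace Y" "y \<in> mspace Y"
  then have "\<bar>f x - f y\<bar> \<le> L * mdist Y x y" using assms by (simp add: lipschitz_bound_def)
  then have "\<bar>a\<bar> * \<bar>f x - f y\<bar> \<le> \<bar>a\<bar> * (L * mdist Y x y)" by (rule mult_left_mono) simp
  then show "\<bar>a * f x - a * f y\<bar> \<le> \<bar>a\<bar> * L * mdist Y x y"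
    by (simp add: abs_mult[symmetric] right_diff_distrib[symmetric] mult.assoc)
qed

lemma lipschitz_bound_add:
  assumes "lipschitz_bound Y L f" "lipschitz_bound Y K g"
  shows "lipschitz_bound Y (L + K) (\<lambda>x. f x + g x)"
  unfolding lipschitz_bound_def
proof (intro conjI ballI)
  show "0 \<le> L + K" using assms by (simp add: lipschitz_bound_def)
  fix x y assume "x \<in> mspace Y" "y \<in> mspace Y"
  then have "\<bar>f x - f y\<bar> \<le> L * mdist Y x y" "\<bar>g x - g y\<bar> \<le> K * mdist Y x y"
    using assms by (auto simp: lipschitz_bound_def)
  then show "\<bar>f x + g x - (f y + g y)\<bar> \<le> (L + K) * mdist Y x y"
    by (simp add: distrib_right)
qed

lemma lipschitz_bound_nonexpansive:
  assumes "lipschitz_bound Y L f" "\<And>s t. \<bar>c s - c t\<bar> \<le> \<bar>s - t :: real\<bar>"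
  shows "lipschitz_bound Y L (\<lambda>x. c (f x))"
  unfolding lipschitz_bound_def
proof (intro conjI ballI)
  show "0 \<le> L" using assms(1) by (simp add: lipschitz_bound_def)
  fix x y assume "x \<in> mspace Y" "y \<in> mspace Y"
  then have "\<bar>f x - f y\<bar> \<le> L * mdist Y x y" using assms(1) by (simp add: lipschitz_bound_def)
  then show "\<bar>c (f x) - c (f y)\<bar> \<le> L * mdist Y x y" using assms(2)[of "f x" "f y"] by linarith
qed

lemma bounded_lipschitz_const: "bounded_lipschitz Y (\<lambda>_. c)"
  by (rule bounded_lipschitzI[OF lipschitz_bound_const order_refl])

lemma bounded_lipschitz_nonexpansive:
  assumes "bounded_lipschitz Y f" "\<And>s t. \<bar>c s - c t\<bar> \<le> \<bar>s - t :: real\<bar>"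
  shows "bounded_lipschitz Y (\<lambda>x. c (f x))"
proof -
  obtain L M where L: "lipschitz_bound Y L f" and M: "\<forall>x\<in>mspace Y. \<bar>f x\<bar> \<le> M"
    using assms(1) by (rule bounded_lipschitzE)
  have "\<forall>x\<in>mspace Y. \<bar>c (f x)\<bar> \<le> \<bar>c 0\<bar> + M"
  proof
    fix x assume "x \<in> mspace Y"
    then show "\<bar>c (f x)\<bar> \<le> \<bar>c 0\<bar> + M" using M assms(2)[of "f x" 0] by fastforce
  qed
  then show ?thesis by (intro bounded_lipschitzI[OF lipschitz_bound_nonexpansive[OF L assms(2)]]) (rule bspec)
qed

lemma bounded_lipschitz_lincomb:
  assumes "bounded_lipschitz Y f" "bounded_lipschitz Y g"
  shows "bounded_lipschitz Y (\<lambda>x. a * f x + b * g x)"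
proof -
  obtain L M where L: "lipschitz_bound Y L f" and M: "\<forall>x\<in>mspace Y. \<bar>f x\<bar> \<le> M"
    using assms(1) by (rule bounded_lipschitzE)
  obtain K N where K: "lipschitz_bound Y K g" and N: "\<forall>x\<in>mspace Y. \<bar>g x\<bar> \<le> N"
    using assms(2) by (rule bounded_lipschitzE)
  have "\<forall>x\<in>mspace Y. \<bar>a * f x + b * g x\<bar> \<le> \<bar>a\<bar> * M + \<bar>b\<bar> * N"
  proof
    fix x assume "x \<in> mspace Y"
    then have "\<bar>a * f x\<bar> \<le> \<bar>a\<bar> * M" "\<bar>b * g x\<bar> \<le> \<bar>b\<bar> * N"
      using M N by (auto simp: abs_mult mult_left_mono)
    then show "\<bar>a * f x + b * g x\<bar> \<le> \<bar>a\<bar> * M + \<bar>b\<bar> * N" by linarith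
  qed
  then show ?thesis
    by (intro bounded_lipschitzI[OF lipschitz_bound_add[OF lipschitz_bound_scale[OF L]
          lipschitz_bound_scale[OF K]]]) (rule bspec)
qed

lemma bounded_lipschitz_add:
  "bounded_lipschitz Y f \<Longrightarrow> bounded_lipschitz Y g \<Longrightarrow> bounded_lipschitz Y (\<lambda>x. f x + g x)"
  using bounded_lipschitz_lincomb[of Y f g 1 1] by simp

lemma bounded_lipschitz_diff:
  "bounded_lipschitz Y f \<Longrightarrow> bounded_lipschitz Y g \<Longrightarrow> bounded_lipschitz Y (\<lambda>x. f x - g x)"
  using bounded_lipschitz_lincomb[of Y f g 1 "-1"] by simp

lemma bounded_lipschitz_scale:
  "bounded_lipschitz Y f \<Longrightarrow> bounded_lipschitz Y (\<lambda>x. a * f x)"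
  using bounded_lipschitz_lincomb[of Y f f a 0] by simp

lemma bounded_lipschitz_mult:
  assumes "bounded_lipschitz Y f" "bounded_lipschitz Y g"
  shows "bounded_lipschitz Y (\<lambda>x. f x * g x)"
proof -
  obtain L M where L: "lipschitz_bound Y L f" and M: "\<forall>x\<in>mspace Y. \<bar>f x\<bar> \<le> M"
    using assms(1) by (rule bounded_lipschitzE)
  obtain K N where K: "lipschitz_bound Y K g" and N: "\<forall>x\<in>mspace Y. \<bar>g x\<bar> \<le> N"
    using assms(2) by (rule bounded_lipschitzE)
  have L0: "0 \<le> L" "0 \<le> K" using L K by (auto simp: lipschitz_bound_def)
  have "lipschitz_bound Y (\<bar>M\<bar> * K + \<bar>N\<bar> * L) (\<lambda>x. f x * g x)"
    unfolding lipschitz_bound_def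
  proof (intro conjI ballI)
    show "0 \<le> \<bar>M\<bar> * K + \<bar>N\<bar> * L" using L0 by simp
    fix x y assume xy: "x \<in> mspace Y" "y \<in> mspace Y"
    have "f x * g x - f y * g y = f x * (g x - g y) + g y * (f x - f y)"
      by (simp add: algebra_simps)
    then have "\<bar>f x * g x - f y * g y\<bar> \<le> \<bar>f x\<bar> * \<bar>g x - g y\<bar> + \<bar>g y\<bar> * \<bar>f x - f y\<bar>"
      by (metis abs_mult abs_triangle_ineq)
    also have "\<dots> \<le> \<bar>M\<bar> * (K * mdist Y x y) + \<bar>N\<bar> * (L * mdist Y x y)"
      using L M K N xy unfolding lipschitz_bound_def
      by (intro add_mono mult_mono) (auto intro: order_trans[OF _ abs_ge_self])
    finally show "\<bar>f x * g x - f y * g y\<bar> \<le> (\<bar>M\<bar> * K + \<bar>N\<bar> * L) * mdist Y x y"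
      by (simp add: algebra_simps)
  qed
  moreover have "\<forall>x\<in>mspace Y. \<bar>f x * g x\<bar> \<le> \<bar>M\<bar> * \<bar>N\<bar>"
    using M N unfolding abs_mult by (intro ballI mult_mono) (auto intro: order_trans[OF _ abs_ge_self])
  ultimately show ?thesis by (intro bounded_lipschitzI) (assumption, rule bspec)
qed

lemma bounded_lipschitz_sum:
  "(\<And>i. i \<in> I \<Longrightarrow> bounded_lipschitz Y (f i)) \<Longrightarrow> bounded_lipschitz Y (\<lambda>x. \<Sum>i\<in>I. f i x)"
  by (induction I rule: infinite_finite_induct) (auto simp: bounded_lipschitz_const bounded_lipschitz_add)

definition clip :: "real \<Rightarrow> real \<Rightarrow> real" where
  "clip M t = max (- M) (min M t)"

lemma clip_lipschitz: "\<bar>clip M s - clip M t\<bar> \<le> \<bar>s - t\<bar>"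
  unfolding clip_def by linarith

lemma clip_bound: "0 \<le> M \<Longrightarrow> \<bar>clip M t\<bar> \<le> M"
  unfolding clip_def by linarith

lemma clip_id: "\<bar>t\<bar> \<le> M \<Longrightarrow> clip M t = t"
  unfolding clip_def by linarith

lemma bounded_lipschitz_clip:
  assumes "lipschitz_fun Y f" "0 \<le> M" shows "bounded_lipschitz Y (\<lambda>x. clip M (f x))"
proof -
  obtain L where "lipschitz_bound Y L f" using assms(1) by (rule lipschitz_funE)
  then have "lipschitz_bound Y L (\<lambda>x. clip M (f x))"
    using clip_lipschitz by (rule lipschitz_bound_nonexpansive)
  then show ?thesis by (rule bounded_lipschitzI[OF _ clip_bound[OF assms(2)]])
qed

text \<open>
  McShane's extension of \<open>v\<close> from \<open>S\<close>: the largest one that is Lipschitz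
  with constant \<open>L\<close>.
\<close>

definition mcshane :: "'a metric \<Rightarrow> 'a set \<Rightarrow> real \<Rightarrow> ('a \<Rightarrow> real) \<Rightarrow> 'a \<Rightarrow> real" where
  "mcshane Y S L v z = (INF y\<in>S. v y + L * mdist Y z y)"

lemma mcshane_bdd:
  assumes S: "S \<subseteq> mspace Y" and L: "0 \<le> L"
    and v: "\<And>x y. x \<in> S \<Longrightarrow> y \<in> S \<Longrightarrow> \<bar>v x - v y\<bar> \<le> L * mdist Y x y"
    and z: "z \<in> mspace Y"
  shows "bdd_below ((\<lambda>y. v y + L * mdist Y z y) ` S)"
proof (cases "S = {}")
  case False
  then obtain y0 where y0: "y0 \<in> S" by blast
  show ?thesis
  proof (rule bdd_belowI2)
    fix y assume y: "y \<in> S"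
    have "mdist Y y0 y \<le> mdist Y y0 z + mdist Y z y"
      using y y0 S z by (intro mdist_triangle) auto
    then have "L * mdist Y y0 y \<le> L * (mdist Y y0 z + mdist Y z y)" using L by (rule mult_left_mono)
    then show "v y0 - L * mdist Y y0 z \<le> v y + L * mdist Y z y"
      using v[OF y0 y] by (simp add: algebra_simps)
  qed
qed simp

lemma mcshane_lipschitz:
  assumes S: "S \<subseteq> mspace Y" and L: "0 \<le> L"
    and v: "\<And>x y. x \<in> S \<Longrightarrow> y \<in> S \<Longrightarrow> \<bar>v x - v y\<bar> \<le> L * mdist Y x y"
  shows "lipschitz_bound Y L (mcshane Y S L v)"
proof (cases "S = {}")
  case True
  then show ?thesis using L by (simp add: lipschitz_bound_def mcshane_def)
next
  case False
  have *: "mcshane Y S L v z \<le> mcshane Y S L v w + L * mdist Y z w"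
    if zw: "z \<in> mspace Y" "w \<in> mspace Y" for z w
  proof -
    have "mcshane Y S L v z - L * mdist Y z w \<le> mcshane Y S L v w"
      unfolding mcshane_def[of Y S L v w]
    proof (rule cINF_greatest[OF False])
      fix y assume y: "y \<in> S"
      have "mcshane Y S L v z \<le> v y + L * mdist Y z y"
        unfolding mcshane_def using y by (intro cINF_lower mcshane_bdd[OF S L v] zw)
      also have "mdist Y z y \<le> mdist Y z w + mdist Y w y"
        using y S zw by (intro mdist_triangle) auto
      then have "v y + L * mdist Y z y \<le> v y + L * (mdist Y z w + mdist Y w y)"
        using L by (intro add_left_mono mult_left_mono)
      finally show "mcshane Y S L v z - L * mdist Y z w \<le> v y + L * mdist Y w y"
        by (simp add: algebra_simps)
    qed
    then show ?thesis by simp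
  qed
  have "\<bar>mcshane Y S L v z - mcshane Y S L v w\<bar> \<le> L * mdist Y z w"
    if "z \<in> mspace Y" "w \<in> mspace Y" for z w
    using *[OF that] *[OF that(2,1)] mdist_commute[of Y z w] by (simp add: abs_le_iff)
  then show ?thesis using L by (simp add: lipschitz_bound_def)
qed

lemma mcshane_extends:
  assumes S: "S \<subseteq> mspace Y" and L: "0 \<le> L"
    and v: "\<And>x y. x \<in> S \<Longrightarrow> y \<in> S \<Longrightarrow> \<bar>v x - v y\<bar> \<le> L * mdist Y x y"
    and x: "x \<in> S"
  shows "mcshane Y S L v x = v x"
proof (rule antisym)
  have "mdist Y x x = 0" using x S by auto
  moreover have "mcshane Y S L v x \<le> v x + L * mdist Y x x"
    unfolding mcshane_def using x S by (intro cINF_lower mcshane_bdd[OF S L v]) auto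
  ultimately show "mcshane Y S L v x \<le> v x" by simp
  show "v x \<le> mcshane Y S L v x"
    unfolding mcshane_def
  proof (rule cINF_greatest)
    show "S \<noteq> {}" using x by blast
    fix y assume "y \<in> S"
    then show "v x \<le> v y + L * mdist Y x y" using v[OF x, of y] by linarith
  qed
qed

section \<open>Finite Borel measures on a metric space\<close>

lemma space_metric_borel [simp]: "space (metric_borel Y) = mspace Y"
  unfolding metric_borel_def by (rule space_measure_of) (use openin_subset in fastforce)

lemma sets_metric_borel:
  "sets (metric_borel Y) = sigma_sets (mspace Y) {U. openin (mtopology_of Y) U}"
  unfolding metric_borel_def by (rule sets_measure_of) (use openin_subset in fastforce)

lemma mspace_metric_borel: "mspace Y \<in> sets (metric_borel Y)"
  using sets.top[of "metric_borel Y"] by simp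

lemma open_metric_borel: "openin (mtopology_of Y) U \<Longrightarrow> U \<in> sets (metric_borel Y)"
  unfolding sets_metric_borel by (rule sigma_sets.Basic) simp

lemma lipschitz_imp_continuous: "lipschitz_fun Y f \<Longrightarrow> continuous_map (mtopology_of Y) euclidean f"
  using Lipschitz_imp_Cauchy_continuous_map Cauchy_continuous_imp_continuous_map mtopology_of_euclidean
  by metis

lemma openin_lipschitz_preimage:
  assumes "lipschitz_fun Y f" "open S"
  shows "openin (mtopology_of Y) {x\<in>mspace Y. f x \<in> S}"
  using openin_continuous_map_preimage[OF lipschitz_imp_continuous[OF assms(1)], of S] assms(2)
  by simp

lemma lipschitz_measurable:
  assumes "lipschitz_fun Y f" shows "f \<in> borel_measurable (metric_borel Y)"
proof (rule borel_measurableI)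
  fix S :: "real set" assume "open S"
  have "f -` S \<inter> space (metric_borel Y) = {x\<in>mspace Y. f x \<in> S}" by auto
  then show "f -` S \<inter> space (metric_borel Y) \<in> sets (metric_borel Y)"
    using open_metric_borel[OF openin_lipschitz_preimage[OF assms \<open>open S\<close>]] by simp
qed

lemma finite_borel_measureD:
  assumes "finite_borel_measure Y \<mu>"
  shows "finite_measure \<mu>" "sets \<mu> = sets (metric_borel Y)" "space \<mu> = mspace Y"
  using assms sets_eq_imp_space_eq[of \<mu> "metric_borel Y"] by (auto simp: finite_borel_measure_def)

lemma lipschitz_borel_measurable:
  assumes "finite_borel_measure Y \<mu>" "lipschitz_fun Y f" shows "f \<in> borel_measurable \<mu>"
  using lipschitz_measurable[OF assms(2)] finite_borel_measureD(2)[OF assms(1)]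
  by (simp cong: measurable_cong_sets)

lemma integrable_bounded_lipschitz:
  assumes "finite_borel_measure Y \<mu>" "bounded_lipschitz Y f" shows "integrable \<mu> f"
proof -
  interpret finite_measure \<mu> using finite_borel_measureD[OF assms(1)] by simp
  obtain M where "\<And>x. x \<in> mspace Y \<Longrightarrow> \<bar>f x\<bar> \<le> M" using assms(2) bounded_lipschitz_bound by blast
  then show ?thesis
    using finite_borel_measureD(3)[OF assms(1)]
      lipschitz_borel_measurable[OF assms(1) bounded_lipschitz_imp_lipschitz[OF assms(2)]]
    by (intro integrable_const_bound[of f M]) auto
qed

text \<open>
  Lipschitz functions that increase to the indicator of an open set; they are truncated multiples
  of the distance to its complement.
\<close>

lemma open_cutoff:
  assumes W: "openin (mtopology_of Y) W"
  obtains \<eta> :: "nat \<Rightarrow> 'a \<Rightarrow> real" where "\<And>k. bounded_lipschitz Y (\<eta> k)"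
    "\<And>k x. 0 \<le> \<eta> k x" "\<And>k x. \<eta> k x \<le> 1"
    "\<And>k x. x \<in> mspace Y - W \<Longrightarrow> \<eta> k x = 0" "\<And>x. x \<in> W \<Longrightarrow> (\<lambda>k. \<eta> k x) \<longlonglongrightarrow> 1"
proof (cases "mspace Y - W = {}")
  case True
  \<comment> \<open>The distance to the empty set is an unspecified default value.\<close>
  then show thesis
    by (intro that[of "\<lambda>_ _. 1"]) (auto simp: bounded_lipschitz_const)
next
  case False
  define C where "C = mspace Y - W"
  define D where "D = mcshane Y C 1 (\<lambda>_. 0)"
  have C: "C \<noteq> {}" "C \<subseteq> mspace Y" using False by (auto simp: C_def)
  have D: "lipschitz_bound Y 1 D" unfolding D_def using C by (intro mcshane_lipschitz) auto
  have D0: "D x = 0" if "x \<in> C" for x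
    unfolding D_def using C that by (intro mcshane_extends) auto
  have Dpos: "0 < D x" if x: "x \<in> W" for x
  proof -
    have "openin (Metric_space.mtopology (mspace Y) (mdist Y)) W" using W by (simp add: mtopology_of_def)
    then obtain r where r: "r > 0" "Metric_space.mball (mspace Y) (mdist Y) x r \<subseteq> W"
      using x Metric_space.openin_mtopology[OF Metric_space_mspace_mdist] by metis
    have xY: "x \<in> mspace Y" using x openin_subset[OF W] by auto
    have "r \<le> D x" unfolding D_def mcshane_def
    proof (rule cINF_greatest[OF C(1)])
      fix y assume y: "y \<in> C"
      then have "y \<notin> Metric_space.mball (mspace Y) (mdist Y) x r" using r(2) by (auto simp: C_def)
      then show "r \<le> 0 + 1 * mdist Y x y"
        using y xY by (auto simp: C_def Metric_space.in_mball[OF Metric_space_mspace_mdist])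
    qed
    then show ?thesis using r by linarith
  qed
  define \<eta> where "\<eta> k x = max 0 (min 1 (real k * D x))" for k :: nat and x
  show thesis
  proof (rule that[of \<eta>])
    fix k x
    have "lipschitz_bound Y (\<bar>real k\<bar> * 1) (\<lambda>x. real k * D x)" by (rule lipschitz_bound_scale[OF D])
    then have "lipschitz_bound Y (\<bar>real k\<bar> * 1) (\<eta> k)" unfolding \<eta>_def
      by (rule lipschitz_bound_nonexpansive) linarith
    then show "bounded_lipschitz Y (\<eta> k)" by (rule bounded_lipschitzI[where M=1]) (auto simp: \<eta>_def)
    show "0 \<le> \<eta> k x" "\<eta> k x \<le> 1" by (auto simp: \<eta>_def)
    show "\<eta> k x = 0" if "x \<in> mspace Y - W" using that D0 by (auto simp: \<eta>_def C_def)
  next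
    fix x assume "x \<in> W"
    then obtain n :: nat where n: "1 < real n * D x" using Dpos reals_Archimedean3 by blast
    have "\<eta> k x = 1" if "n \<le> k" for k
    proof -
      have "real n * D x \<le> real k * D x" using that Dpos[OF \<open>x \<in> W\<close>] by (intro mult_right_mono) auto
      then show ?thesis using n by (simp add: \<eta>_def)
    qed
    then have "eventually (\<lambda>k. \<eta> k x = 1) sequentially" using eventually_sequentially by blast
    then show "(\<lambda>k. \<eta> k x) \<longlonglongrightarrow> 1" by (rule tendsto_eventually)
  qed
qed

text \<open>
  The approximable Borel sets contain the open sets, by the cutoff functions, and they are closed
  under complements and disjoint unions, so they are all the Borel sets. In an abstract metric
  space this induction does the work of inner regularity.
\<close>

lemma lipschitz_approx_indicator:
  assumes \<mu>: "finite_borel_measure Y \<mu>" and B: "B \<in> sets \<mu>"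
  shows "\<forall>e>0. \<exists>g. bounded_lipschitz Y g \<and> (LINT x|\<mu>. \<bar>g x - indicator B x\<bar>) < e"
proof -
  interpret finite_measure \<mu> using finite_borel_measureD[OF \<mu>] by simp
  note sets = finite_borel_measureD(2,3)[OF \<mu>]
  have int: "integrable \<mu> (\<lambda>x. \<bar>g x - indicator A x\<bar>)" if "bounded_lipschitz Y g" "A \<in> sets \<mu>" for g A
    using that integrable_bounded_lipschitz[OF \<mu>]
    by (intro integrable_abs Bochner_Integration.integrable_diff) (auto intro: integrable_real_indicator simp: emeasure_finite less_top[symmetric])
  have Isi: "Int_stable {U. openin (mtopology_of Y) U}" by (auto simp: Int_stable_def)
  have ss: "sigma_sets (mspace Y) {U. openin (mtopology_of Y) U} = sets \<mu>"
    using sets sets_metric_borel by metis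
  have sub: "{U. openin (mtopology_of Y) U} \<subseteq> Pow (mspace Y)" using openin_subset by fastforce
  have "B \<in> sigma_sets (mspace Y) {U. openin (mtopology_of Y) U}"
    using B sets by (simp add: sets_metric_borel)
  then show ?thesis
  proof (induction rule: sigma_sets_induct_disjoint[OF Isi sub, consumes 1, case_names basic empty compl union])
    case (basic W)
    then obtain \<eta> :: "nat \<Rightarrow> 'a \<Rightarrow> real" where \<eta>: "\<And>k. bounded_lipschitz Y (\<eta> k)"
      "\<And>k x. 0 \<le> \<eta> k x" "\<And>k x. \<eta> k x \<le> 1"
      "\<And>k x. x \<in> mspace Y - W \<Longrightarrow> \<eta> k x = 0" "\<And>x. x \<in> W \<Longrightarrow> (\<lambda>k. \<eta> k x) \<longlonglongrightarrow> 1"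
      using open_cutoff by blast
    have W: "W \<in> sets \<mu>" using basic open_metric_borel sets by simp
    have "(\<lambda>k. LINT x|\<mu>. \<bar>\<eta> k x - indicator W x\<bar>) \<longlonglongrightarrow> (LINT x|\<mu>. 0)"
    proof (rule integral_dominated_convergence[where w="\<lambda>_. 1"])
      show "AE x in \<mu>. (\<lambda>k. \<bar>\<eta> k x - indicator W x\<bar>) \<longlonglongrightarrow> 0"
      proof (rule AE_I2)
        fix x assume x: "x \<in> space \<mu>"
        show "(\<lambda>k. \<bar>\<eta> k x - indicator W x\<bar>) \<longlonglongrightarrow> 0"
        proof (cases "x \<in> W")
          case True
          have "(\<lambda>k. \<bar>\<eta> k x - 1\<bar>) \<longlonglongrightarrow> \<bar>1 - 1\<bar>" by (intro tendsto_intros \<eta>(5) True)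
          then show ?thesis using True by simp
        next
          case False
          then show ?thesis using \<eta>(4)[of x] x sets by (simp add: indicator_def)
        qed
      qed
      show "AE x in \<mu>. norm (\<bar>\<eta> k x - indicator W x\<bar>) \<le> 1" for k
      proof (rule AE_I2)
        fix x show "norm (\<bar>\<eta> k x - indicator W x\<bar>) \<le> 1"
          using \<eta>(2)[of k x] \<eta>(3)[of k x] by (cases "x \<in> W") auto
      qed
    qed (use borel_measurable_integrable[OF int[OF \<eta>(1) W]] in simp_all)
    then have lim: "(\<lambda>k. LINT x|\<mu>. \<bar>\<eta> k x - indicator W x\<bar>) \<longlonglongrightarrow> 0" by simp
    show ?case
    proof (intro allI impI)
      fix e :: real assume "e > 0"
      then have "eventually (\<lambda>k. (LINT x|\<mu>. \<bar>\<eta> k x - indicator W x\<bar>) < e) sequentially"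
        using lim order_tendstoD(2) by blast
      then obtain k where "(LINT x|\<mu>. \<bar>\<eta> k x - indicator W x\<bar>) < e"
        by (auto simp: eventually_sequentially)
      then show "\<exists>g. bounded_lipschitz Y g \<and> (LINT x|\<mu>. \<bar>g x - indicator W x\<bar>) < e"
        using \<eta>(1) by blast
    qed
  next
    case empty
    show ?case using bounded_lipschitz_const[of Y 0] by (intro allI impI exI[of _ "\<lambda>_. 0"]) simp
  next
    case (compl A)
    show ?case
    proof (intro allI impI)
      fix e :: real assume "e > 0"
      then obtain g where g: "bounded_lipschitz Y g" "(LINT x|\<mu>. \<bar>g x - indicator A x\<bar>) < e"
        using compl by blast
      have "(LINT x|\<mu>. \<bar>(1 - g x) - indicator (mspace Y - A) x\<bar>) = (LINT x|\<mu>. \<bar>g x - indicator A x\<bar>)"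
        using sets by (intro Bochner_Integration.integral_cong) (auto simp: indicator_def)
      then show "\<exists>g. bounded_lipschitz Y g \<and> (LINT x|\<mu>. \<bar>g x - indicator (mspace Y - A) x\<bar>) < e"
        using g bounded_lipschitz_diff[OF bounded_lipschitz_const g(1), of 1] by (intro exI[of _ "\<lambda>x. 1 - g x"]) simp
    qed
  next
    case (union A)
    have A: "range A \<subseteq> sets \<mu>" using union ss by simp
    then have A': "A i \<in> sets \<mu>" for i by blast
    show ?case
    proof (intro allI impI)
      fix e :: real assume e: "e > 0"
      have "(\<lambda>n. measure \<mu> (\<Union>i<n. A i)) \<longlonglongrightarrow> measure \<mu> (\<Union>n. \<Union>i<n. A i)"
        using A' by (intro finite_Lim_measure_incseq) (auto simp: incseq_def, use order.strict_trans2 in blast)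
      moreover have "(\<Union>n. \<Union>i<n. A i) = (\<Union>i. A i)" by auto
      ultimately have "(\<lambda>n. measure \<mu> (\<Union>i<n. A i)) \<longlonglongrightarrow> measure \<mu> (\<Union>i. A i)" by simp
      then have "eventually (\<lambda>n. measure \<mu> (\<Union>i. A i) - e/2 < measure \<mu> (\<Union>i<n. A i)) sequentially"
        using e by (intro order_tendstoD(1)) auto
      then obtain n where n: "measure \<mu> (\<Union>i. A i) - e/2 < measure \<mu> (\<Union>i<n. A i)"
        by (auto simp: eventually_sequentially)
      define d where "d = e / (2 * (real n + 1))"
      have d: "d > 0" using e by (simp add: d_def)
      have "\<forall>i. \<exists>g. bounded_lipschitz Y g \<and> (LINT x|\<mu>. \<bar>g x - indicator (A i) x\<bar>) < d"
        using union d by blast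
      then obtain G where G: "\<And>i. bounded_lipschitz Y (G i)"
        "\<And>i. (LINT x|\<mu>. \<bar>G i x - indicator (A i) x\<bar>) < d" by metis
      define g where "g = (\<lambda>x. \<Sum>i<n. G i x)"
      have g: "bounded_lipschitz Y g" unfolding g_def using G by (intro bounded_lipschitz_sum)
      \<comment> \<open>The part of the union that the first \<open>n\<close> approximations ignore.\<close>
      define R where "R = (\<Union>i. A i) - (\<Union>i<n. A i)"
      have R: "R \<in> sets \<mu>" using A' by (auto simp: R_def)
      have mR: "measure \<mu> R < e/2"
      proof -
        have "measure \<mu> R = measure \<mu> (\<Union>i. A i) - measure \<mu> (\<Union>i<n. A i)"
          unfolding R_def using A' by (intro finite_measure_Diff) auto
        then show ?thesis using n by simp
      qed
      have ind: "indicator (\<Union>i. A i) x = (\<Sum>i<n. indicator (A i) x) + (indicator R x :: real)" for x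
      proof -
        have "(\<Sum>i<n. indicator (A i) x) = (indicator (\<Union>i<n. A i) x :: real)"
          using union(1) by (intro indicator_UN_disjoint[symmetric])
            (auto simp: disjoint_family_on_def)
        moreover have "indicator (\<Union>i. A i) x = indicator (\<Union>i<n. A i) x + (indicator R x :: real)"
          by (auto simp: R_def indicator_def)
        ultimately show ?thesis by simp
      qed
      have "(LINT x|\<mu>. \<bar>g x - indicator (\<Union>i. A i) x\<bar>)
          \<le> (LINT x|\<mu>. (\<Sum>i<n. \<bar>G i x - indicator (A i) x\<bar>) + indicator R x)"
      proof (rule integral_mono)
        show "integrable \<mu> (\<lambda>x. \<bar>g x - indicator (\<Union>i. A i) x\<bar>)" using g A by (intro int) auto
        show "integrable \<mu> (\<lambda>x. (\<Sum>i<n. \<bar>G i x - indicator (A i) x\<bar>) + indicator R x)"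
          using int[OF G(1) A'] R
          by (intro Bochner_Integration.integrable_add Bochner_Integration.integrable_sum)
             (auto intro: integrable_real_indicator simp: emeasure_finite less_top[symmetric])
        fix x
        have "g x - indicator (\<Union>i. A i) x = (\<Sum>i<n. G i x - indicator (A i) x) - indicator R x"
          unfolding ind g_def by (simp add: sum_subtractf)
        then have "\<bar>g x - indicator (\<Union>i. A i) x\<bar> \<le> \<bar>\<Sum>i<n. G i x - indicator (A i) x\<bar> + \<bar>indicator R x\<bar>"
          by linarith
        also have "\<dots> \<le> (\<Sum>i<n. \<bar>G i x - indicator (A i) x\<bar>) + indicator R x"
          by (intro add_mono sum_abs) auto
        finally show "\<bar>g x - indicator (\<Union>i. A i) x\<bar> \<le> (\<Sum>i<n. \<bar>G i x - indicator (A i) x\<bar>) + indicator R x" .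
      qed
      also have "\<dots> = (\<Sum>i<n. LINT x|\<mu>. \<bar>G i x - indicator (A i) x\<bar>) + measure \<mu> R"
        using int[OF G(1) A'] R
        by (subst Bochner_Integration.integral_add) 
           (auto intro!: Bochner_Integration.integrable_sum integrable_real_indicator Bochner_Integration.integral_sum simp: emeasure_finite less_top[symmetric])
      also have "\<dots> \<le> (\<Sum>i<n. d) + measure \<mu> R" using G(2) by (intro add_right_mono sum_mono less_imp_le)
      also have "\<dots> < e" 
      proof -
        have "(\<Sum>i<n. d) \<le> e / 2" using e by (simp add: d_def field_simps)
        then show ?thesis using mR by linarith
      qed
      finally show "\<exists>g. bounded_lipschitz Y g \<and> (LINT x|\<mu>. \<bar>g x - indicator (\<Union>i. A i) x\<bar>) < e"
        using g by blast
    qed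
  qed
qed

section \<open>Density of the Lipschitz functions in $L^1$\<close>

lemma tendsto_0_by_bound:
  fixes a b :: "nat \<Rightarrow> real"
  assumes "\<And>n. \<bar>a n\<bar> \<le> b n" "b \<longlonglongrightarrow> 0" shows "a \<longlonglongrightarrow> 0"
  by (rule Lim_null_comparison[OF always_eventually assms(2)]) (simp add: assms(1))

text \<open>
  The form in which \<^const>\<open>borel_extension\<close> expresses convergence in $L^1$.
\<close>

definition L1_tends :: "'a measure \<Rightarrow> (nat \<Rightarrow> 'a \<Rightarrow> real) \<Rightarrow> ('a \<Rightarrow> real) \<Rightarrow> bool" where
  "L1_tends \<mu> g f \<longleftrightarrow> (\<lambda>n. \<integral>\<^sup>+x. ennreal \<bar>g n x - f x\<bar> \<partial>\<mu>) \<longlonglongrightarrow> 0"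

lemma L1_tends_iff:
  assumes "\<And>n. integrable \<mu> (g n)" "integrable \<mu> f"
  shows "L1_tends \<mu> g f \<longleftrightarrow> (\<lambda>n. LINT x|\<mu>. \<bar>g n x - f x\<bar>) \<longlonglongrightarrow> 0"
proof -
  have "(\<integral>\<^sup>+x. ennreal \<bar>g n x - f x\<bar> \<partial>\<mu>) = ennreal (LINT x|\<mu>. \<bar>g n x - f x\<bar>)" for n
    using assms by (intro nn_integral_eq_integral) auto
  then show ?thesis unfolding L1_tends_def by (simp add: ennreal_tendsto_0_iff)
qed

lemma L1_tends_mono:
  assumes "L1_tends \<mu> g f" "sets \<nu> = sets \<mu>" "\<And>B. B \<in> sets \<mu> \<Longrightarrow> emeasure \<nu> B \<le> emeasure \<mu> B"
  shows "L1_tends \<nu> g f"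
proof -
  have "\<nu> \<le> \<mu>" using le_measure[OF assms(2)] assms(2,3) by simp
  then have "(\<integral>\<^sup>+x. ennreal \<bar>g n x - f x\<bar> \<partial>\<nu>) \<le> (\<integral>\<^sup>+x. ennreal \<bar>g n x - f x\<bar> \<partial>\<mu>)" for n
    using assms(2) by (intro nn_integral_mono_measure) auto
  then show ?thesis using assms(1) unfolding L1_tends_def
    by (intro tendsto_sandwich[OF _ _ tendsto_const, of 0 "\<lambda>n. \<integral>\<^sup>+x. ennreal \<bar>g n x - f x\<bar> \<partial>\<nu>" _ "\<lambda>n. \<integral>\<^sup>+x. ennreal \<bar>g n x - f x\<bar> \<partial>\<mu>"]) auto
qed

lemma dominated_L1_tends:
  fixes f w :: "'a \<Rightarrow> real"
  assumes s: "\<And>i. integrable \<mu> (s i)" and f: "integrable \<mu> f"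
    and lim: "\<And>x. x \<in> space \<mu> \<Longrightarrow> (\<lambda>i. s i x) \<longlonglongrightarrow> f x"
    and w: "integrable \<mu> w" "\<And>i x. x \<in> space \<mu> \<Longrightarrow> \<bar>s i x\<bar> \<le> w x"
  shows "(\<lambda>i. LINT x|\<mu>. \<bar>s i x - f x\<bar>) \<longlonglongrightarrow> 0"
proof -
  have "(\<lambda>i. LINT x|\<mu>. \<bar>s i x - f x\<bar>) \<longlonglongrightarrow> (LINT x|\<mu>. 0)"
  proof (rule integral_dominated_convergence[where w="\<lambda>x. w x + \<bar>f x\<bar>"])
    show "AE x in \<mu>. (\<lambda>i. \<bar>s i x - f x\<bar>) \<longlonglongrightarrow> 0"
    proof (rule AE_I2)
      fix x assume "x \<in> space \<mu>"
      then have "(\<lambda>i. \<bar>s i x - f x\<bar>) \<longlonglongrightarrow> \<bar>f x - f x\<bar>" using lim by (intro tendsto_intros)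
      then show "(\<lambda>i. \<bar>s i x - f x\<bar>) \<longlonglongrightarrow> 0" by simp
    qed
    show "AE x in \<mu>. norm \<bar>s i x - f x\<bar> \<le> w x + \<bar>f x\<bar>" for i
    proof (rule AE_I2)
      fix x assume "x \<in> space \<mu>"
      then show "norm \<bar>s i x - f x\<bar> \<le> w x + \<bar>f x\<bar>" using w(2)[of x i] by simp
    qed
  qed (use s f w in \<open>auto intro: borel_measurable_integrable\<close>)
  then show ?thesis by simp
qed

lemma lipschitz_approx_integrable:
  assumes \<mu>: "finite_borel_measure Y \<mu>" and f: "integrable \<mu> f"
  shows "\<forall>e>0. \<exists>g. bounded_lipschitz Y g \<and> (LINT x|\<mu>. \<bar>g x - f x\<bar>) < e"
  using f
proof (induction rule: integrable_induct)
  case (base A c)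
  show ?case
  proof (intro allI impI)
    fix e :: real assume e: "e > 0"
    define d where "d = e / (\<bar>c\<bar> + 1)"
    have "d > 0" using e by (simp add: d_def)
    then obtain g where g: "bounded_lipschitz Y g" "(LINT x|\<mu>. \<bar>g x - indicator A x\<bar>) < d"
      using lipschitz_approx_indicator[OF \<mu> base(1)] by blast
    have "(LINT x|\<mu>. \<bar>c * g x - indicator A x *\<^sub>R c\<bar>) = (LINT x|\<mu>. \<bar>c\<bar> * \<bar>g x - indicator A x\<bar>)"
      by (simp add: abs_mult[symmetric] right_diff_distrib mult.commute)
    also have "\<dots> = \<bar>c\<bar> * (LINT x|\<mu>. \<bar>g x - indicator A x\<bar>)" by simp
    also have "\<dots> \<le> \<bar>c\<bar> * d" using g(2) by (intro mult_left_mono) auto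
    also have "\<dots> < e" using e by (simp add: d_def field_simps)
    finally show "\<exists>g. bounded_lipschitz Y g \<and> (LINT x|\<mu>. \<bar>g x - indicator A x *\<^sub>R c\<bar>) < e"
      using bounded_lipschitz_scale[OF g(1)] by blast
  qed
next
  case (add f1 f2)
  show ?case
  proof (intro allI impI)
    fix e :: real assume e: "e > 0"
    then have e2: "e/2 > 0" by simp
    obtain g1 where g1: "bounded_lipschitz Y g1" "(LINT x|\<mu>. \<bar>g1 x - f1 x\<bar>) < e/2"
      using add(3) e2 by blast
    obtain g2 where g2: "bounded_lipschitz Y g2" "(LINT x|\<mu>. \<bar>g2 x - f2 x\<bar>) < e/2"
      using add(4) e2 by blast
    note i = integrable_bounded_lipschitz[OF \<mu> g1(1)] integrable_bounded_lipschitz[OF \<mu> g2(1)] add(1,2)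
    have "(LINT x|\<mu>. \<bar>(g1 x + g2 x) - (f1 x + f2 x)\<bar>)
        \<le> (LINT x|\<mu>. \<bar>g1 x - f1 x\<bar> + \<bar>g2 x - f2 x\<bar>)"
      using i by (intro integral_mono) auto
    also have "\<dots> = (LINT x|\<mu>. \<bar>g1 x - f1 x\<bar>) + (LINT x|\<mu>. \<bar>g2 x - f2 x\<bar>)"
      using i by (intro Bochner_Integration.integral_add) auto
    finally show "\<exists>g. bounded_lipschitz Y g \<and> (LINT x|\<mu>. \<bar>g x - (f1 x + f2 x)\<bar>) < e"
      using g1 g2 by (intro exI[of _ "\<lambda>x. g1 x + g2 x"]) (auto simp: bounded_lipschitz_add)
  qed
next
  case (lim f s)
  have l: "(\<lambda>i. LINT x|\<mu>. \<bar>s i x - f x\<bar>) \<longlonglongrightarrow> 0"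
    using lim by (intro dominated_L1_tends[where w="\<lambda>x. 2 * \<bar>f x\<bar>"]) auto
  show ?case
  proof (intro allI impI)
    fix e :: real assume e: "e > 0"
    then have e2: "e/2 > 0" by simp
    obtain i where i: "(LINT x|\<mu>. \<bar>s i x - f x\<bar>) < e/2"
      using order_tendstoD(2)[OF l e2] by (auto simp: eventually_sequentially)
    obtain g where g: "bounded_lipschitz Y g" "(LINT x|\<mu>. \<bar>g x - s i x\<bar>) < e/2"
      using lim(5) e2 by blast
    note j = integrable_bounded_lipschitz[OF \<mu> g(1)] lim(1) lim(4)
    have "(LINT x|\<mu>. \<bar>g x - f x\<bar>) \<le> (LINT x|\<mu>. \<bar>g x - s i x\<bar> + \<bar>s i x - f x\<bar>)"
      using j by (intro integral_mono) auto
    also have "\<dots> = (LINT x|\<mu>. \<bar>g x - s i x\<bar>) + (LINT x|\<mu>. \<bar>s i x - f x\<bar>)"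
      using j by (intro Bochner_Integration.integral_add) auto
    finally show "\<exists>g. bounded_lipschitz Y g \<and> (LINT x|\<mu>. \<bar>g x - f x\<bar>) < e"
      using g i by (intro exI[of _ g]) auto
  qed
qed

text \<open>
  This is what makes the extension of a current to bounded Borel functions unique.
\<close>

lemma lipschitz_dense_L1:
  assumes \<mu>: "finite_borel_measure Y \<mu>" and f: "integrable \<mu> f"
  obtains g where "\<And>n. bounded_lipschitz Y (g n)" "L1_tends \<mu> g f"
proof -
  have "\<forall>n. \<exists>g. bounded_lipschitz Y g \<and> (LINT x|\<mu>. \<bar>g x - f x\<bar>) < inverse (real (Suc n))"
    using lipschitz_approx_integrable[OF \<mu> f] by simp
  then obtain g where g: "\<And>n. bounded_lipschitz Y (g n)"
    "\<And>n. (LINT x|\<mu>. \<bar>g n x - f x\<bar>) < inverse (real (Suc n))" by metis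
  have "(\<lambda>n. LINT x|\<mu>. \<bar>g n x - f x\<bar>) \<longlonglongrightarrow> 0"
    using g(2) by (intro tendsto_sandwich[OF _ _ tendsto_const LIMSEQ_inverse_real_of_nat])
      (auto intro!: always_eventually less_imp_le simp del: of_nat_Suc)
  then have "L1_tends \<mu> g f"
    using integrable_bounded_lipschitz[OF \<mu> g(1)] f by (subst L1_tends_iff) auto
  then show thesis using g(1) that by blast
qed

lemma L1_tends_integral:
  assumes \<mu>: "finite_borel_measure Y \<mu>" and g: "\<And>n. integrable \<mu> (g n)" and f: "integrable \<mu> f"
    and t: "L1_tends \<mu> g f" and h: "h \<in> borel_measurable \<mu>" "\<And>x. \<bar>h x\<bar> \<le> 1"
  shows "(\<lambda>n. LINT x|\<mu>. g n x * h x) \<longlonglongrightarrow> (LINT x|\<mu>. f x * h x)"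
    and "(\<lambda>n. LINT x|\<mu>. \<bar>g n x\<bar>) \<longlonglongrightarrow> (LINT x|\<mu>. \<bar>f x\<bar>)"
proof -
  have l: "(\<lambda>n. LINT x|\<mu>. \<bar>g n x - f x\<bar>) \<longlonglongrightarrow> 0" using t L1_tends_iff[OF g f] by simp
  have ih: "integrable \<mu> (\<lambda>x. k x * h x)" if k: "integrable \<mu> k" for k :: "'a \<Rightarrow> real"
  proof (rule Bochner_Integration.integrable_bound[OF k])
    show "(\<lambda>x. k x * h x) \<in> borel_measurable \<mu>" using k h by measurable
    show "AE x in \<mu>. norm (k x * h x) \<le> norm (k x)"
      using h(2) by (intro AE_I2) (simp add: abs_mult mult_left_le)
  qed
  have "\<bar>(LINT x|\<mu>. g n x * h x) - (LINT x|\<mu>. f x * h x)\<bar> \<le> (LINT x|\<mu>. \<bar>g n x - f x\<bar>)" for n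
  proof -
    have "(LINT x|\<mu>. g n x * h x) - (LINT x|\<mu>. f x * h x) = (LINT x|\<mu>. (g n x - f x) * h x)"
      using ih[OF g] ih[OF f] by (simp add: left_diff_distrib)
    also have "\<bar>\<dots>\<bar> \<le> (LINT x|\<mu>. \<bar>(g n x - f x) * h x\<bar>)" by (rule integral_abs_bound)
    also have "\<dots> \<le> (LINT x|\<mu>. \<bar>g n x - f x\<bar>)"
    proof (rule integral_mono)
      show "integrable \<mu> (\<lambda>x. \<bar>(g n x - f x) * h x\<bar>)" using g f by (intro integrable_abs ih) auto
      show "\<bar>(g n x - f x) * h x\<bar> \<le> \<bar>g n x - f x\<bar>" for x
        using h(2) by (simp add: abs_mult mult_left_le)
    qed (use g f in auto)
    finally show ?thesis .
  qed
  then have "(\<lambda>n. (LINT x|\<mu>. g n x * h x) - (LINT x|\<mu>. f x * h x)) \<longlonglongrightarrow> 0"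
    by (rule tendsto_0_by_bound[OF _ l])
  then show "(\<lambda>n. LINT x|\<mu>. g n x * h x) \<longlonglongrightarrow> (LINT x|\<mu>. f x * h x)"
    by (simp add: LIM_zero_iff)
  have "\<bar>(LINT x|\<mu>. \<bar>g n x\<bar>) - (LINT x|\<mu>. \<bar>f x\<bar>)\<bar> \<le> (LINT x|\<mu>. \<bar>g n x - f x\<bar>)" for n
  proof -
    have "(LINT x|\<mu>. \<bar>g n x\<bar>) - (LINT x|\<mu>. \<bar>f x\<bar>) = (LINT x|\<mu>. \<bar>g n x\<bar> - \<bar>f x\<bar>)"
      using g f by simp
    also have "\<bar>\<dots>\<bar> \<le> (LINT x|\<mu>. \<bar>\<bar>g n x\<bar> - \<bar>f x\<bar>\<bar>)" by (rule integral_abs_bound)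
    also have "\<dots> \<le> (LINT x|\<mu>. \<bar>g n x - f x\<bar>)" using g f by (intro integral_mono) auto
    finally show ?thesis .
  qed
  then have "(\<lambda>n. (LINT x|\<mu>. \<bar>g n x\<bar>) - (LINT x|\<mu>. \<bar>f x\<bar>)) \<longlonglongrightarrow> 0"
    by (rule tendsto_0_by_bound[OF _ l])
  then show "(\<lambda>n. LINT x|\<mu>. \<bar>g n x\<bar>) \<longlonglongrightarrow> (LINT x|\<mu>. \<bar>f x\<bar>)"
    by (simp add: LIM_zero_iff)
qed

section \<open>Functionals bounded in $L^1$\<close>

text \<open>
  The functionals \<open>f \<mapsto> T f ps\<close> for a fixed tuple \<open>ps\<close> of
  1-Lipschitz functions and a measure that controls \<open>T\<close>.
\<close>

locale L1_functional =
  fixes Y :: "'a metric" and \<mu> :: "'a measure" and F :: "('a \<Rightarrow> real) \<Rightarrow> real"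
  assumes fbm: "finite_borel_measure Y \<mu>"
    and lin: "\<And>f g a b. bounded_lipschitz Y f \<Longrightarrow> bounded_lipschitz Y g \<Longrightarrow>
        F (\<lambda>x. a * f x + b * g x) = a * F f + b * F g"
    and bound: "\<And>f. bounded_lipschitz Y f \<Longrightarrow> \<bar>F f\<bar> \<le> (LINT x|\<mu>. \<bar>f x\<bar>)"
begin

text \<open>
  The defining property is that of \<^const>\<open>borel_extension\<close>, with an arbitrary controlling measure
  in the place of the mass measure, whose existence is proved by means of this extension.
\<close>

definition ext :: "('a \<Rightarrow> real) \<Rightarrow> real" where
  "ext f = (THE c. \<forall>g. (\<forall>n. bounded_lipschitz Y (g n)) \<longrightarrow> L1_tends \<mu> g f \<longrightarrow>
     (\<lambda>n. F (g n)) \<longlonglongrightarrow> c)"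

sublocale finite_measure \<mu>
  using finite_borel_measureD[OF fbm] by simp

lemmas integrable_bl = integrable_bounded_lipschitz[OF fbm]

lemma F_diff_le:
  assumes "bounded_lipschitz Y f" "bounded_lipschitz Y g"
  shows "\<bar>F f - F g\<bar> \<le> (LINT x|\<mu>. \<bar>f x - g x\<bar>)"
  using bound[OF bounded_lipschitz_diff[OF assms]] lin[OF assms, of 1 "-1"] by simp

lemma ext_ex:
  assumes f: "integrable \<mu> f"
  shows "\<exists>c. \<forall>g. (\<forall>n. bounded_lipschitz Y (g n)) \<longrightarrow> L1_tends \<mu> g f \<longrightarrow>
     (\<lambda>n. F (g n)) \<longlonglongrightarrow> c"
proof -
  have tri: "\<bar>F k - F l\<bar> \<le> (LINT x|\<mu>. \<bar>k x - f x\<bar>) + (LINT x|\<mu>. \<bar>l x - f x\<bar>)"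
    if kl: "bounded_lipschitz Y k" "bounded_lipschitz Y l" for k l
  proof -
    have "\<bar>F k - F l\<bar> \<le> (LINT x|\<mu>. \<bar>k x - l x\<bar>)" by (rule F_diff_le[OF kl])
    also have "\<dots> \<le> (LINT x|\<mu>. \<bar>k x - f x\<bar> + \<bar>l x - f x\<bar>)"
      using integrable_bl[OF kl(1)] integrable_bl[OF kl(2)] f by (intro integral_mono) auto
    also have "\<dots> = (LINT x|\<mu>. \<bar>k x - f x\<bar>) + (LINT x|\<mu>. \<bar>l x - f x\<bar>)"
      using integrable_bl[OF kl(1)] integrable_bl[OF kl(2)] f
      by (intro Bochner_Integration.integral_add) auto
    finally show ?thesis .
  qed
  obtain g0 where g0: "\<And>n. bounded_lipschitz Y (g0 n)" "L1_tends \<mu> g0 f"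
    using lipschitz_dense_L1[OF fbm f] by blast
  have a0: "(\<lambda>n. LINT x|\<mu>. \<bar>g0 n x - f x\<bar>) \<longlonglongrightarrow> 0"
    using g0 L1_tends_iff[OF integrable_bl[OF g0(1)] f] by simp
  have "Cauchy (\<lambda>n. F (g0 n))"
  proof (rule metric_CauchyI)
    fix e :: real assume "e > 0"
    then have "e/2 > 0" by simp
    from order_tendstoD(2)[OF a0 this] obtain M where M: "\<And>n. n \<ge> M \<Longrightarrow> (LINT x|\<mu>. \<bar>g0 n x - f x\<bar>) < e/2"
      by (auto simp: eventually_sequentially)
    have "dist (F (g0 m)) (F (g0 n)) < e" if mn: "m \<ge> M" "n \<ge> M" for m n
      using tri[OF g0(1) g0(1), of m n] M[OF mn(1)] M[OF mn(2)] by (simp add: dist_real_def)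
    then show "\<exists>M. \<forall>m\<ge>M. \<forall>n\<ge>M. dist (F (g0 m)) (F (g0 n)) < e" by blast
  qed
  then obtain c where c: "(\<lambda>n. F (g0 n)) \<longlonglongrightarrow> c" using Cauchy_convergent convergentD by blast
  show ?thesis
  proof (intro exI allI impI)
    fix g :: "nat \<Rightarrow> 'a \<Rightarrow> real"
    assume "\<forall>n. bounded_lipschitz Y (g n)" and t: "L1_tends \<mu> g f"
    then have g: "\<And>n. bounded_lipschitz Y (g n)" by simp
    have a: "(\<lambda>n. LINT x|\<mu>. \<bar>g n x - f x\<bar>) \<longlonglongrightarrow> 0"
      using t L1_tends_iff[OF integrable_bl[OF g] f] by simp
    have "(\<lambda>n. F (g n) - F (g0 n)) \<longlonglongrightarrow> 0"
      by (rule tendsto_0_by_bound[OF tri[OF g g0(1)] tendsto_add_zero[OF a a0]])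
    from tendsto_add[OF this c] show "(\<lambda>n. F (g n)) \<longlonglongrightarrow> c" by simp
  qed
qed

lemma ext_tendsto:
  assumes f: "integrable \<mu> f" and g: "\<And>n. bounded_lipschitz Y (g n)" "L1_tends \<mu> g f"
  shows "(\<lambda>n. F (g n)) \<longlonglongrightarrow> ext f"
proof -
  obtain c where c: "\<forall>g. (\<forall>n. bounded_lipschitz Y (g n)) \<longrightarrow> L1_tends \<mu> g f \<longrightarrow>
     (\<lambda>n. F (g n)) \<longlonglongrightarrow> c" using ext_ex[OF f] by blast
  have "ext f = c" unfolding ext_def
  proof (rule the_equality)
    show "\<forall>g. (\<forall>n. bounded_lipschitz Y (g n)) \<longrightarrow> L1_tends \<mu> g f \<longrightarrow> (\<lambda>n. F (g n)) \<longlonglongrightarrow> c"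
      by (rule c)
    fix d assume "\<forall>g. (\<forall>n. bounded_lipschitz Y (g n)) \<longrightarrow> L1_tends \<mu> g f \<longrightarrow> (\<lambda>n. F (g n)) \<longlonglongrightarrow> d"
    then have "(\<lambda>n. F (g n)) \<longlonglongrightarrow> d" using g by blast
    moreover have "(\<lambda>n. F (g n)) \<longlonglongrightarrow> c" using g c by blast
    ultimately show "d = c" by (rule LIMSEQ_unique)
  qed
  then show ?thesis using c g by blast
qed

lemma ext_lincomb:
  assumes f: "integrable \<mu> f" and k: "integrable \<mu> k"
  shows "ext (\<lambda>x. a * f x + b * k x) = a * ext f + b * ext k"
proof -
  obtain g where g: "\<And>n. bounded_lipschitz Y (g n)" "L1_tends \<mu> g f"
    using lipschitz_dense_L1[OF fbm f] by blast
  obtain l where l: "\<And>n. bounded_lipschitz Y (l n)" "L1_tends \<mu> l k"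
    using lipschitz_dense_L1[OF fbm k] by blast
  note gi = integrable_bl[OF g(1)] and li = integrable_bl[OF l(1)]
  define w where "w n x = a * g n x + b * l n x" for n x
  have w: "bounded_lipschitz Y (w n)" for n unfolding w_def using g l by (intro bounded_lipschitz_lincomb)
  have fk: "integrable \<mu> (\<lambda>x. a * f x + b * k x)" using f k by simp
  have g0: "(\<lambda>n. LINT x|\<mu>. \<bar>g n x - f x\<bar>) \<longlonglongrightarrow> 0" using g(2) L1_tends_iff[OF gi f] by simp
  have l0: "(\<lambda>n. LINT x|\<mu>. \<bar>l n x - k x\<bar>) \<longlonglongrightarrow> 0" using l(2) L1_tends_iff[OF li k] by simp
  have le: "(LINT x|\<mu>. \<bar>w n x - (a * f x + b * k x)\<bar>)
      \<le> \<bar>a\<bar> * (LINT x|\<mu>. \<bar>g n x - f x\<bar>) + \<bar>b\<bar> * (LINT x|\<mu>. \<bar>l n x - k x\<bar>)" for n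
  proof -
    have "(LINT x|\<mu>. \<bar>w n x - (a * f x + b * k x)\<bar>)
      \<le> (LINT x|\<mu>. \<bar>a\<bar> * \<bar>g n x - f x\<bar> + \<bar>b\<bar> * \<bar>l n x - k x\<bar>)"
    proof (rule integral_mono)
      show "integrable \<mu> (\<lambda>x. \<bar>w n x - (a * f x + b * k x)\<bar>)" using integrable_bl[OF w] fk by auto
      fix x
      have "w n x - (a * f x + b * k x) = a * (g n x - f x) + b * (l n x - k x)"
        by (simp add: w_def algebra_simps)
      then show "\<bar>w n x - (a * f x + b * k x)\<bar> \<le> \<bar>a\<bar> * \<bar>g n x - f x\<bar> + \<bar>b\<bar> * \<bar>l n x - k x\<bar>"
        by (metis abs_mult abs_triangle_ineq)
    qed (use gi li f k in auto)
    also have "\<dots> = \<bar>a\<bar> * (LINT x|\<mu>. \<bar>g n x - f x\<bar>) + \<bar>b\<bar> * (LINT x|\<mu>. \<bar>l n x - k x\<bar>)"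
      using gi li f k by simp
    finally show ?thesis .
  qed
  have "(\<lambda>n. \<bar>a\<bar> * (LINT x|\<mu>. \<bar>g n x - f x\<bar>) + \<bar>b\<bar> * (LINT x|\<mu>. \<bar>l n x - k x\<bar>)) \<longlonglongrightarrow> 0"
    by (intro tendsto_add_zero tendsto_mult_right_zero g0 l0)
  from _ this have "(\<lambda>n. LINT x|\<mu>. \<bar>w n x - (a * f x + b * k x)\<bar>) \<longlonglongrightarrow> 0"
  proof (rule tendsto_0_by_bound)
    fix n
    have "0 \<le> (LINT x|\<mu>. \<bar>w n x - (a * f x + b * k x)\<bar>)" by (rule integral_nonneg_AE) simp
    with le[of n] show "\<bar>LINT x|\<mu>. \<bar>w n x - (a * f x + b * k x)\<bar>\<bar>
        \<le> \<bar>a\<bar> * (LINT x|\<mu>. \<bar>g n x - f x\<bar>) + \<bar>b\<bar> * (LINT x|\<mu>. \<bar>l n x - k x\<bar>)" by linarith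
  qed
  then have "L1_tends \<mu> w (\<lambda>x. a * f x + b * k x)" using L1_tends_iff[OF integrable_bl[OF w] fk] by simp
  from ext_tendsto[OF fk w this] have "(\<lambda>n. F (w n)) \<longlonglongrightarrow> ext (\<lambda>x. a * f x + b * k x)" .
  moreover have "F (w n) = a * F (g n) + b * F (l n)" for n unfolding w_def by (rule lin[OF g(1) l(1)])
  then have "F \<circ> w = (\<lambda>n. a * F (g n) + b * F (l n))" by (simp add: fun_eq_iff)
  then have "(\<lambda>n. F (w n)) \<longlonglongrightarrow> a * ext f + b * ext k"
    using tendsto_add[OF tendsto_mult_left[OF ext_tendsto[OF f g]] tendsto_mult_left[OF ext_tendsto[OF k l]]]
    by (simp add: comp_def)
  ultimately show ?thesis by (rule LIMSEQ_unique)
qed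

lemma ext_bound:
  assumes f: "integrable \<mu> f" shows "\<bar>ext f\<bar> \<le> (LINT x|\<mu>. \<bar>f x\<bar>)"
proof -
  obtain g where g: "\<And>n. bounded_lipschitz Y (g n)" "L1_tends \<mu> g f"
    using lipschitz_dense_L1[OF fbm f] by blast
  have "(\<lambda>n. \<bar>F (g n)\<bar>) \<longlonglongrightarrow> \<bar>ext f\<bar>" by (intro tendsto_intros ext_tendsto f g)
  moreover have "(\<lambda>n. LINT x|\<mu>. \<bar>g n x\<bar>) \<longlonglongrightarrow> (LINT x|\<mu>. \<bar>f x\<bar>)"
    by (rule L1_tends_integral(2)[OF fbm integrable_bl[OF g(1)] f g(2), of "\<lambda>_. 0"]) auto
  ultimately show ?thesis by (rule LIMSEQ_le) (use bound[OF g(1)] in auto)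
qed

lemma ext_bl:
  assumes f: "bounded_lipschitz Y f" shows "ext f = F f"
proof -
  have "L1_tends \<mu> (\<lambda>_. f) f" by (simp add: L1_tends_def)
  from ext_tendsto[OF integrable_bl[OF f] f this] show ?thesis by (simp add: LIMSEQ_const_iff)
qed

lemma ext_add: "integrable \<mu> f \<Longrightarrow> integrable \<mu> k \<Longrightarrow> ext (\<lambda>x. f x + k x) = ext f + ext k"
  using ext_lincomb[of f k 1 1] by (simp only: mult_1)

lemma ext_diff_le:
  assumes "integrable \<mu> f" "integrable \<mu> k" shows "\<bar>ext f - ext k\<bar> \<le> (LINT x|\<mu>. \<bar>f x - k x\<bar>)"
proof -
  have "ext f - ext k = ext (\<lambda>x. f x - k x)" using ext_lincomb[OF assms, of 1 "-1"] by (simp only: mult_1 mult_minus1 diff_conv_add_uminus)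
  moreover have "integrable \<mu> (\<lambda>x. f x - k x)" using assms by (rule Bochner_Integration.integrable_diff)
  ultimately show ?thesis using ext_bound[of "\<lambda>x. f x - k x"] by (simp only:)
qed

lemma integrable_ind [simp, intro]: "B \<in> sets \<mu> \<Longrightarrow> integrable \<mu> (indicator B :: 'a \<Rightarrow> real)"
  using emeasure_finite[of B] by (intro integrable_real_indicator) (auto simp: less_top[symmetric])

text \<open>
  The remainder of the series is bounded in $L^1$ by the measure of a tail of the union, so
  countable additivity comes from that of \<open>\<mu>\<close>.
\<close>

lemma ext_ind_sums:
  assumes A: "range A \<subseteq> sets \<mu>" and dis: "disjoint_family A"
  shows "(\<lambda>i. ext (indicator (A i))) sums ext (indicator (\<Union>i. A i))"
proof -
  have Ai: "A i \<in> sets \<mu>" for i using A by blast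
  have U: "(\<Union>i. A i) \<in> sets \<mu>" using Ai by blast
  have isum: "integrable \<mu> (\<lambda>x. \<Sum>i<n. indicator (A i) x :: real)" for n
    using Ai by (intro Bochner_Integration.integrable_sum integrable_ind)
  have s: "ext (\<lambda>x. \<Sum>i<n. indicator (A i) x) = (\<Sum>i<n. ext (indicator (A i)))" for n
  proof (induction n)
    case 0 then show ?case using ext_bl[OF bounded_lipschitz_const[of Y 0]] lin[OF bounded_lipschitz_const[of Y 0] bounded_lipschitz_const[of Y 0], of 0 0] by simp
  next
    case (Suc n)
    then show ?case using ext_add[OF isum[of n] integrable_ind[OF Ai[of n]]] by simp
  qed
  have msum: "(\<lambda>n. measure \<mu> (\<Union>i. A i) - (\<Sum>i<n. measure \<mu> (A i))) \<longlonglongrightarrow> 0"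
    using tendsto_diff[OF tendsto_const finite_measure_UNION[OF A dis, unfolded sums_def],
        of "measure \<mu> (\<Union>i. A i)"] by simp
  have le: "\<bar>ext (indicator (\<Union>i. A i)) - (\<Sum>i<n. ext (indicator (A i)))\<bar>
      \<le> measure \<mu> (\<Union>i. A i) - (\<Sum>i<n. measure \<mu> (A i))" for n
  proof -
    have ind: "(\<Sum>i<n. indicator (A i) x) = (indicator (\<Union>i<n. A i) x :: real)" for x
      using dis by (intro indicator_UN_disjoint[symmetric]) (auto simp: disjoint_family_on_def)
    have "\<bar>ext (indicator (\<Union>i. A i)) - (\<Sum>i<n. ext (indicator (A i)))\<bar>
      \<le> (LINT x|\<mu>. \<bar>indicator (\<Union>i. A i) x - (\<Sum>i<n. indicator (A i) x)\<bar>)"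
      unfolding s[symmetric] by (rule ext_diff_le[OF integrable_ind[OF U] isum])
    also have "\<dots> = (LINT x|\<mu>. indicator (\<Union>i. A i) x - (\<Sum>i<n. indicator (A i) x))"
    proof (rule Bochner_Integration.integral_cong[OF refl])
      fix x show "\<bar>indicator (\<Union>i. A i) x - (\<Sum>i<n. indicator (A i) x)\<bar>
          = indicator (\<Union>i. A i) x - (\<Sum>i<n. indicator (A i) x :: real)"
        unfolding ind by (auto simp: indicator_def)
    qed
    also have "\<dots> = measure \<mu> (\<Union>i. A i) - (\<Sum>i<n. measure \<mu> (A i))"
      using isum U Ai by (subst Bochner_Integration.integral_diff) auto
    finally show ?thesis .
  qed
  have "(\<lambda>n. ext (indicator (\<Union>i. A i)) - (\<Sum>i<n. ext (indicator (A i)))) \<longlonglongrightarrow> 0"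
    using le by (rule tendsto_0_by_bound[OF _ msum])
  from tendsto_diff[OF tendsto_const[of "ext (indicator (\<Union>i. A i))"] this]
  show ?thesis unfolding sums_def by simp
qed

text \<open>
  The set function \<open>B \<mapsto> \<mu> B + ext (indicator B)\<close> lies between 0 and
  \<open>2 \<mu> B\<close>. It is therefore a measure, and its Radon-Nikodym density minus 1
  represents the functional.
\<close>

lemma ext_density:
  obtains h where "h \<in> borel_measurable \<mu>" "\<And>x. \<bar>h x\<bar> \<le> 1"
    "\<And>f. integrable \<mu> f \<Longrightarrow> ext f = (LINT x|\<mu>. f x * h x)"
proof -
  define v where "v B = measure \<mu> B + ext (indicator B)" for B
  have vb: "0 \<le> v B" "v B \<le> 2 * measure \<mu> B" if B: "B \<in> sets \<mu>" for B
  proof -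
    have "(LINT x|\<mu>. \<bar>indicator B x\<bar>) = measure \<mu> B" using B by simp
    then have "\<bar>ext (indicator B)\<bar> \<le> measure \<mu> B" using ext_bound[OF integrable_ind[OF B]] by linarith
    then show "0 \<le> v B" "v B \<le> 2 * measure \<mu> B" unfolding v_def by linarith+
  qed
  define N where "N = measure_of (space \<mu>) (sets \<mu>) (\<lambda>B. ennreal (v B))"
  have ss: "sets N = sets \<mu>" "space N = space \<mu>" unfolding N_def by auto
  have eN: "emeasure N B = ennreal (v B)" if "B \<in> sets \<mu>" for B
  proof (rule emeasure_measure_of[OF N_def])
    show "sets \<mu> \<subseteq> Pow (space \<mu>)" by (rule sets.space_closed)
    have "v {} = 0" using vb[of "{}"] by simp
    then show "positive (sets N) (\<lambda>B. ennreal (v B))" by (simp add: positive_def)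
    show "countably_additive (sets N) (\<lambda>B. ennreal (v B))"
    proof (rule countably_additiveI)
      fix A :: "nat \<Rightarrow> 'a set" assume A: "range A \<subseteq> sets N" "disjoint_family A"
      then have "(\<lambda>i. v (A i)) sums v (\<Union>i. A i)"
        unfolding v_def ss by (intro sums_add finite_measure_UNION ext_ind_sums)
      then show "(\<Sum>i. ennreal (v (A i))) = ennreal (v (\<Union>i. A i))"
        using A vb ss by (intro suminf_ennreal_eq) auto
    qed
    show "B \<in> sets N" using that ss by simp
  qed
  have ac: "absolutely_continuous \<mu> N"
    unfolding absolutely_continuous_def
  proof
    fix B assume "B \<in> null_sets \<mu>"
    then have B: "B \<in> sets \<mu>" "measure \<mu> B = 0" by (auto simp: null_sets_def measure_def)
    then show "B \<in> null_sets N" using eN[OF B(1)] vb[OF B(1)] ss by (auto intro!: null_setsI)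
  qed
  obtain f0 where f0: "f0 \<in> borel_measurable \<mu>" "density \<mu> f0 = N"
    using Radon_Nikodym[OF ac ss(1)] by blast
  \<comment> \<open>The density exceeds 2 only on a null set, because \<open>N B \<le> 2 * \<mu> B\<close> for \<open>B = C\<close>.\<close>
  define C where "C = {x\<in>space \<mu>. 2 < f0 x}"
  have C: "C \<in> sets \<mu>" using f0(1) unfolding C_def by measurable
  have "(\<integral>\<^sup>+x. f0 x * indicator C x - 2 * indicator C x \<partial>\<mu>)
      = (\<integral>\<^sup>+x. f0 x * indicator C x \<partial>\<mu>) - (\<integral>\<^sup>+x. 2 * indicator C x \<partial>\<mu>)"
  proof (rule nn_integral_diff)
    show "(\<integral>\<^sup>+x. 2 * indicator C x \<partial>\<mu>) \<noteq> \<infinity>"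
      using C emeasure_finite by (simp add: nn_integral_cmult_indicator ennreal_mult_eq_top_iff)
    show "AE x in \<mu>. 2 * indicator C x \<le> f0 x * indicator C x"
      by (intro AE_I2) (auto simp: C_def indicator_def)
  qed (use f0 C in auto)
  also have "\<dots> = 0"
  proof -
    have "(\<integral>\<^sup>+x. f0 x * indicator C x \<partial>\<mu>) = emeasure N C"
      using f0 C by (simp add: emeasure_density[symmetric])
    also have "\<dots> \<le> ennreal (2 * measure \<mu> C)" using eN[OF C] vb[OF C] by (simp add: ennreal_leI)
    also have "\<dots> = (\<integral>\<^sup>+x. 2 * indicator C x \<partial>\<mu>)"
      using C by (simp add: nn_integral_cmult_indicator emeasure_eq_measure ennreal_mult)
    finally have le: "(\<integral>\<^sup>+x. f0 x * indicator C x \<partial>\<mu>) \<le> (\<integral>\<^sup>+x. 2 * indicator C x \<partial>\<mu>)" .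
    moreover have "(\<integral>\<^sup>+x. 2 * indicator C x \<partial>\<mu>) < top"
      using C by (simp add: nn_integral_cmult_indicator emeasure_eq_measure ennreal_mult_less_top)
    ultimately show ?thesis by (intro diff_eq_0_ennreal le_less_trans[OF le])
  qed
  finally have "AE x in \<mu>. f0 x * indicator C x - 2 * indicator C x = 0"
    using f0 C by (subst (asm) nn_integral_0_iff_AE) auto
  then have AE2: "AE x in \<mu>. f0 x \<le> 2"
  proof (rule AE_mp, intro AE_I2 impI)
    fix x assume x: "x \<in> space \<mu>" "f0 x * indicator C x - 2 * indicator C x = 0"
    show "f0 x \<le> 2"
    proof (rule ccontr)
      assume "\<not> f0 x \<le> 2"
      then have "2 < f0 x" by simp
      moreover have "f0 x - 2 = 0" using x \<open>2 < f0 x\<close> by (simp add: C_def)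
      ultimately show False by (auto simp: diff_eq_0_iff_ennreal dest: leD)
    qed
  qed
  define r where "r x = enn2real (min 2 (f0 x))" for x
  have m2: "min 2 (f0 x) < top" for x by (simp add: min_less_iff_disj)
  have r: "r \<in> borel_measurable \<mu>" using f0 unfolding r_def by measurable
  have r02: "0 \<le> r x" "r x \<le> 2" for x
  proof -
    show "0 \<le> r x" by (simp add: r_def)
    have "r x \<le> enn2real 2" unfolding r_def by (intro enn2real_mono) auto
    then show "r x \<le> 2" by simp
  qed
  have er: "ennreal (r x) = min 2 (f0 x)" for x unfolding r_def using m2 by simp
  have Nr: "N = density \<mu> (\<lambda>x. ennreal (r x))"
    unfolding f0(2)[symmetric] using f0 r AE2
    by (intro density_cong) (auto simp: er)
  define h where "h = (\<lambda>x. r x - 1)"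
  have h: "h \<in> borel_measurable \<mu>" "\<bar>h x\<bar> \<le> 1" for x
    using r r02[of x] by (auto simp: h_def)
  have ri: "integrable \<mu> (\<lambda>x. indicator B x * r x)" if "B \<in> sets \<mu>" for B
    using that r r02 by (intro integrable_const_bound[where B=2] AE_I2) (auto simp: abs_mult indicator_def)
  have ext_ind: "ext (indicator B) = (LINT x|\<mu>. indicator B x * h x)" if B: "B \<in> sets \<mu>" for B
  proof -
    have "ennreal (v B) = (\<integral>\<^sup>+x. ennreal (r x) * indicator B x \<partial>\<mu>)"
      using eN[OF B] r B by (simp add: Nr emeasure_density)
    also have "\<dots> = (\<integral>\<^sup>+x. ennreal (indicator B x * r x) \<partial>\<mu>)"
      by (intro nn_integral_cong) (auto simp: indicator_def)
    also have "\<dots> = ennreal (LINT x|\<mu>. indicator B x * r x)"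
      using ri[OF B] r02 by (intro nn_integral_eq_integral AE_I2) auto
    finally have "v B = (LINT x|\<mu>. indicator B x * r x)"
      using vb[OF B] r02 by (subst (asm) ennreal_inj) (auto intro!: integral_nonneg_AE)
    moreover have "(LINT x|\<mu>. indicator B x * h x) = (LINT x|\<mu>. indicator B x * r x) - measure \<mu> B"
      using ri[OF B] B by (simp add: h_def right_diff_distrib)
    ultimately show ?thesis by (simp add: v_def)
  qed
  have ih: "integrable \<mu> (\<lambda>x. k x * h x)" if k: "integrable \<mu> k" for k
  proof (rule Bochner_Integration.integrable_bound[OF k])
    show "(\<lambda>x. k x * h x) \<in> borel_measurable \<mu>" using k h by measurable
    show "AE x in \<mu>. norm (k x * h x) \<le> norm (k x)"
      using h(2) by (intro AE_I2) (simp add: abs_mult mult_left_le)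
  qed
  have "ext f = (LINT x|\<mu>. f x * h x)" if "integrable \<mu> f" for f
    using that
  proof (induction rule: integrable_induct)
    case (base A c)
    have "ext (\<lambda>x. indicator A x *\<^sub>R c) = c * ext (indicator A)"
      using ext_lincomb[OF integrable_ind[OF base(1)] integrable_ind[OF base(1)], of c 0] by (simp add: mult.commute)
    also have "\<dots> = (LINT x|\<mu>. c * (indicator A x * h x))"
      using ext_ind[OF base(1)] by simp
    finally show ?case by (simp add: ac_simps)
  next
    case (add f1 f2)
    then show ?case using ext_add[OF add(1,2)] ih[OF add(1)] ih[OF add(2)] by (simp add: distrib_right)
  next
    case (lim f s)
    have l: "(\<lambda>i. LINT x|\<mu>. \<bar>s i x - f x\<bar>) \<longlonglongrightarrow> 0"
      using lim by (intro dominated_L1_tends[where w="\<lambda>x. 2 * \<bar>f x\<bar>"]) auto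
    then have "L1_tends \<mu> s f" using L1_tends_iff[OF lim(1) lim(4)] by simp
    then have "(\<lambda>i. LINT x|\<mu>. s i x * h x) \<longlonglongrightarrow> (LINT x|\<mu>. f x * h x)"
      by (rule L1_tends_integral(1)[OF fbm lim(1) lim(4) _ h])
    then have "(\<lambda>i. ext (s i)) \<longlonglongrightarrow> (LINT x|\<mu>. f x * h x)" using lim(5) by simp
    moreover have "(\<lambda>i. ext (s i) - ext f) \<longlonglongrightarrow> 0"
      using ext_diff_le[OF lim(1) lim(4)]
      by (rule tendsto_0_by_bound[OF _ l])
    then have "(\<lambda>i. ext (s i)) \<longlonglongrightarrow> ext f" by (simp add: LIM_zero_iff)
    ultimately show ?case using LIMSEQ_unique by blast
  qed
  then show thesis using h that by blast
qed

end

section \<open>Sums of measures\<close>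

text \<open>
  The measures are meant to have the same measurable sets, which are read off from the first one.
\<close>

definition sum_measure :: "(nat \<Rightarrow> 'a measure) \<Rightarrow> 'a measure" where
  "sum_measure M = measure_of (space (M 0)) (sets (M 0)) (\<lambda>B. \<Sum>i. emeasure (M i) B)"

lemma sets_sum_measure [simp]: "sets (sum_measure M) = sets (M 0)"
  and space_sum_measure [simp]: "space (sum_measure M) = space (M 0)"
  unfolding sum_measure_def by auto

lemma suminf_swap_ennreal: "(\<Sum>i. \<Sum>n. (f i n :: ennreal)) = (\<Sum>n. \<Sum>i. f i n)"
proof -
  have "(\<Sum>i. \<Sum>n. f i n) = (\<integral>\<^sup>+i. (\<Sum>n. f i n) \<partial>count_space UNIV)"
    by (simp add: nn_integral_count_space_nat)
  also have "\<dots> = (\<Sum>n. \<integral>\<^sup>+i. f i n \<partial>count_space UNIV)"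
    by (rule nn_integral_suminf) simp
  also have "\<dots> = (\<Sum>n. \<Sum>i. f i n)" by (simp add: nn_integral_count_space_nat)
  finally show ?thesis .
qed

lemma emeasure_sum_measure:
  assumes M: "\<And>i. sets (M i) = sets (M 0)" and B: "B \<in> sets (M 0)"
  shows "emeasure (sum_measure M) B = (\<Sum>i. emeasure (M i) B)"
proof (rule emeasure_measure_of[OF sum_measure_def])
  show "sets (M 0) \<subseteq> Pow (space (M 0))" by (rule sets.space_closed)
  show "positive (sets (sum_measure M)) (\<lambda>B. \<Sum>i. emeasure (M i) B)" by (simp add: positive_def)
  show "countably_additive (sets (sum_measure M)) (\<lambda>B. \<Sum>i. emeasure (M i) B)"
  proof (rule countably_additiveI)
    fix A :: "nat \<Rightarrow> 'a set" assume A: "range A \<subseteq> sets (sum_measure M)" "disjoint_family A"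
    have "(\<Sum>i. \<Sum>n. emeasure (M n) (A i)) = (\<Sum>n. \<Sum>i. emeasure (M n) (A i))"
      by (rule suminf_swap_ennreal)
    also have "\<dots> = (\<Sum>n. emeasure (M n) (\<Union>i. A i))"
    proof (rule suminf_cong)
      fix n show "(\<Sum>i. emeasure (M n) (A i)) = emeasure (M n) (\<Union>i. A i)"
        using A M[of n] by (intro suminf_emeasure) auto
    qed
    finally show "(\<Sum>i. \<Sum>n. emeasure (M n) (A i)) = (\<Sum>n. emeasure (M n) (\<Union>i. A i))" .
  qed
  show "B \<in> sets (sum_measure M)" using B by simp
qed

lemma nn_integral_sum_measure:
  assumes M: "\<And>i. sets (M i) = sets (M 0)" and f: "f \<in> borel_measurable (M 0)"
  shows "(\<integral>\<^sup>+x. f x \<partial>sum_measure M) = (\<Sum>i. \<integral>\<^sup>+x. f x \<partial>M i)"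
  using f
proof (induction rule: borel_measurable_induct)
  case (cong f g)
  have sp: "space (M i) = space (M 0)" for i using M[of i] by (rule sets_eq_imp_space_eq)
  have "(\<integral>\<^sup>+x. f x \<partial>sum_measure M) = (\<integral>\<^sup>+x. g x \<partial>sum_measure M)"
    using cong by (intro nn_integral_cong) simp
  moreover have "(\<integral>\<^sup>+x. f x \<partial>M i) = (\<integral>\<^sup>+x. g x \<partial>M i)" for i
    using cong sp[of i] by (intro nn_integral_cong) simp
  ultimately show ?case using cong by simp
next
  case (set A)
  have "A \<in> sets (M i)" for i using set M[of i] by (rule ssubst[rotated])
  then have "(\<integral>\<^sup>+x. indicator A x \<partial>M i) = emeasure (M i) A" for i by (rule nn_integral_indicator)
  moreover have "(\<integral>\<^sup>+x. indicator A x \<partial>sum_measure M) = emeasure (sum_measure M) A"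
    using set by (intro nn_integral_indicator) simp
  ultimately show ?case using emeasure_sum_measure[where M=M, OF M set] by simp
next
  case (mult u c)
  have u: "u \<in> borel_measurable (M i)" for i using mult M[of i] by (simp cong: measurable_cong_sets)
  have us: "u \<in> borel_measurable (sum_measure M)" using mult by (simp cong: measurable_cong_sets)
  show ?case using mult.IH by (simp add: nn_integral_cmult[OF u] nn_integral_cmult[OF us])
next
  case (add u v)
  have u: "u \<in> borel_measurable (M i)" "v \<in> borel_measurable (M i)" for i
    using add M[of i] by (simp_all cong: measurable_cong_sets)
  have us: "u \<in> borel_measurable (sum_measure M)" "v \<in> borel_measurable (sum_measure M)"
    using add by (simp_all cong: measurable_cong_sets)
  have "(\<integral>\<^sup>+x. v x + u x \<partial>sum_measure M) = (\<integral>\<^sup>+x. v x \<partial>sum_measure M) + (\<integral>\<^sup>+x. u x \<partial>sum_measure M)"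
    using us by (intro nn_integral_add) auto
  also have "\<dots> = (\<Sum>i. (\<integral>\<^sup>+x. v x \<partial>M i) + (\<integral>\<^sup>+x. u x \<partial>M i))"
    using add.IH by (simp add: suminf_add[OF summableI summableI])
  also have "\<dots> = (\<Sum>i. \<integral>\<^sup>+x. v x + u x \<partial>M i)"
    using u by (intro suminf_cong nn_integral_add[symmetric]) auto
  finally show ?case .
next
  case (seq U)
  have U: "U i \<in> borel_measurable (M j)" for i j using seq(1)[of i] M[of j] by (simp cong: measurable_cong_sets)
  have Us: "U i \<in> borel_measurable (sum_measure M)" for i using seq(1)[of i] by (simp cong: measurable_cong_sets)
  have "(\<integral>\<^sup>+x. (SUP i. U i) x \<partial>sum_measure M) = (SUP i. \<integral>\<^sup>+x. U i x \<partial>sum_measure M)"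
    unfolding SUP_apply using seq Us by (intro nn_integral_monotone_convergence_SUP) auto
  also have "\<dots> = (SUP i. \<Sum>j. \<integral>\<^sup>+x. U i x \<partial>M j)" using seq.IH by simp
  also have "\<dots> = (\<Sum>j. SUP i. \<integral>\<^sup>+x. U i x \<partial>M j)"
  proof (rule ennreal_suminf_SUP_eq[symmetric])
    fix j show "incseq (\<lambda>i. \<integral>\<^sup>+x. U i x \<partial>M j)"
      using \<open>incseq U\<close> by (auto simp: incseq_def le_fun_def intro!: nn_integral_mono)
  qed
  also have "\<dots> = (\<Sum>j. \<integral>\<^sup>+x. (SUP i. U i) x \<partial>M j)"
    unfolding SUP_apply using seq U
    by (intro suminf_cong nn_integral_monotone_convergence_SUP[symmetric]) auto
  finally show ?case .
qed

definition add_measure :: "'a measure \<Rightarrow> 'a measure \<Rightarrow> 'a measure" where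
  "add_measure \<mu> \<nu> = sum_measure (\<lambda>i. if i = 0 then \<mu> else if i = 1 then \<nu> else null_measure \<mu>)"

lemma sets_add_measure [simp]: "sets (add_measure \<mu> \<nu>) = sets \<mu>"
  and space_add_measure [simp]: "space (add_measure \<mu> \<nu>) = space \<mu>"
  unfolding add_measure_def by simp_all

lemma emeasure_add_measure:
  assumes "sets \<nu> = sets \<mu>" "B \<in> sets \<mu>"
  shows "emeasure (add_measure \<mu> \<nu>) B = emeasure \<mu> B + emeasure \<nu> B"
proof -
  have "emeasure (add_measure \<mu> \<nu>) B
      = (\<Sum>i. emeasure (if i = 0 then \<mu> else if i = 1 then \<nu> else null_measure \<mu>) B)"
    unfolding add_measure_def using assms by (intro emeasure_sum_measure) auto
  also have "\<dots> = (\<Sum>i\<in>{0,1::nat}. emeasure (if i = 0 then \<mu> else if i = 1 then \<nu> else null_measure \<mu>) B)"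
    by (intro suminf_finite) auto
  finally show ?thesis by simp
qed

lemma nn_integral_add_measure:
  assumes "sets \<nu> = sets \<mu>" "f \<in> borel_measurable \<mu>"
  shows "(\<integral>\<^sup>+x. f x \<partial>add_measure \<mu> \<nu>) = (\<integral>\<^sup>+x. f x \<partial>\<mu>) + (\<integral>\<^sup>+x. f x \<partial>\<nu>)"
proof -
  have "(\<integral>\<^sup>+x. f x \<partial>add_measure \<mu> \<nu>)
      = (\<Sum>i. \<integral>\<^sup>+x. f x \<partial>(if i = 0 then \<mu> else if i = 1 then \<nu> else null_measure \<mu>))"
    unfolding add_measure_def using assms by (intro nn_integral_sum_measure) auto
  also have "\<dots> = (\<Sum>i\<in>{0,1::nat}. \<integral>\<^sup>+x. f x \<partial>(if i = 0 then \<mu> else if i = 1 then \<nu> else null_measure \<mu>))"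
    by (intro suminf_finite) (auto simp: nn_integral_null_measure)
  finally show ?thesis by simp
qed

lemma finite_borel_measure_add:
  assumes \<mu>: "finite_borel_measure Y \<mu>" and \<nu>: "finite_borel_measure Y \<nu>"
  shows "finite_borel_measure Y (add_measure \<mu> \<nu>)"
proof -
  note s = finite_borel_measureD[OF \<mu>] finite_borel_measureD[OF \<nu>]
  interpret a: finite_measure \<mu> by fact
  interpret b: finite_measure \<nu> by fact
  have "emeasure (add_measure \<mu> \<nu>) (space \<mu>) = emeasure \<mu> (space \<mu>) + emeasure \<nu> (space \<mu>)"
    using s by (intro emeasure_add_measure sets.top) simp
  then have "finite_measure (add_measure \<mu> \<nu>)"
    by (intro finite_measureI) simp
  then show ?thesis using s by (simp add: finite_borel_measure_def)
qed

section \<open>Densities dominated by a measure\<close>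

lemma integral_eq_nn_integral_abs:
  assumes "integrable \<mu> f" shows "ennreal (LINT x|\<mu>. \<bar>f x\<bar>) = (\<integral>\<^sup>+x. ennreal \<bar>f x\<bar> \<partial>\<mu>)"
  using assms by (intro nn_integral_eq_integral[symmetric]) auto

text \<open>
  Test the bound with Lipschitz approximations of \<open>sgn h\<close> on \<open>B\<close>. The
  approximation is taken in $L^1$ of \<open>\<mu> + \<nu>\<close>, so that both sides of the bound
  converge.
\<close>

lemma density_le_control:
  assumes \<mu>: "finite_borel_measure Y \<mu>" and \<nu>: "finite_borel_measure Y \<nu>"
    and h: "h \<in> borel_measurable \<mu>" "\<And>x. \<bar>h x\<bar> \<le> 1"
    and le: "\<And>f. bounded_lipschitz Y f \<Longrightarrow> \<bar>LINT x|\<mu>. f x * h x\<bar> \<le> (LINT x|\<nu>. \<bar>f x\<bar>)"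
    and B: "B \<in> sets \<mu>"
  shows "emeasure (density \<mu> (\<lambda>x. ennreal \<bar>h x\<bar>)) B \<le> emeasure \<nu> B"
proof -
  define \<sigma> where "\<sigma> = add_measure \<mu> \<nu>"
  have \<sigma>: "finite_borel_measure Y \<sigma>" unfolding \<sigma>_def by (rule finite_borel_measure_add[OF \<mu> \<nu>])
  note s\<mu> = finite_borel_measureD[OF \<mu>] and s\<nu> = finite_borel_measureD[OF \<nu>]
    and s\<sigma> = finite_borel_measureD[OF \<sigma>]
  define f where "f x = sgn (h x) * indicator B x" for x
  have fm: "f \<in> borel_measurable \<rho>" if "sets \<rho> = sets \<mu>" for \<rho>
  proof -
    have "f \<in> borel_measurable \<mu>" unfolding f_def[abs_def] using h B by measurable
    then show ?thesis using that by (simp cong: measurable_cong_sets)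
  qed
  have f1: "\<bar>f x\<bar> \<le> 1" for x by (auto simp: f_def indicator_def abs_sgn_eq)
  have fi: "integrable \<rho> f" if "finite_borel_measure Y \<rho>" for \<rho>
  proof -
    interpret finite_measure \<rho> using finite_borel_measureD[OF that] by simp
    show ?thesis using f1 fm[of \<rho>] finite_borel_measureD[OF that] s\<mu> by (intro integrable_const_bound[of f 1] AE_I2) auto
  qed
  obtain g where g: "\<And>n. bounded_lipschitz Y (g n)" "L1_tends \<sigma> g f"
    using lipschitz_dense_L1[OF \<sigma> fi[OF \<sigma>]] by blast
  have em: "emeasure \<sigma> A = emeasure \<mu> A + emeasure \<nu> A" if "A \<in> sets \<mu>" for A
    unfolding \<sigma>_def using that s\<mu> s\<nu> by (intro emeasure_add_measure) auto
  have g\<mu>: "L1_tends \<mu> g f" and g\<nu>: "L1_tends \<nu> g f"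
    using s\<mu> s\<nu> s\<sigma> em by (auto intro!: L1_tends_mono[OF g(2)])
  have "(\<lambda>n. LINT x|\<mu>. g n x * h x) \<longlonglongrightarrow> (LINT x|\<mu>. f x * h x)"
    by (rule L1_tends_integral(1)[OF \<mu> integrable_bounded_lipschitz[OF \<mu> g(1)] fi[OF \<mu>] g\<mu> h])
  moreover have "(\<lambda>n. LINT x|\<nu>. \<bar>g n x\<bar>) \<longlonglongrightarrow> (LINT x|\<nu>. \<bar>f x\<bar>)"
    by (rule L1_tends_integral(2)[OF \<nu> integrable_bounded_lipschitz[OF \<nu> g(1)] fi[OF \<nu>] g\<nu>, of "\<lambda>_. 0"]) auto
  ultimately have "(LINT x|\<mu>. f x * h x) \<le> (LINT x|\<nu>. \<bar>f x\<bar>)"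
    by (rule LIMSEQ_le) (use le[OF g(1)] abs_le_D1 in blast)
  also have "\<dots> \<le> (LINT x|\<nu>. indicator B x)"
  proof (rule integral_mono)
    show "integrable \<nu> (\<lambda>x. \<bar>f x\<bar>)" using fi[OF \<nu>] by simp
    interpret finite_measure \<nu> by (rule s\<nu>)
    show "integrable \<nu> (indicator B :: 'a \<Rightarrow> real)"
      using B s\<mu> s\<nu> emeasure_finite[of B] by (intro integrable_real_indicator) (auto simp: less_top[symmetric])
    show "\<bar>f x\<bar> \<le> indicator B x" for x by (auto simp: f_def indicator_def abs_sgn_eq)
  qed
  finally have le': "(LINT x|\<mu>. f x * h x) \<le> measure \<nu> B"
    using B s\<mu> s\<nu> sets.sets_into_space[of B \<nu>] by (simp add: Int_absorb2)
  have "emeasure (density \<mu> (\<lambda>x. ennreal \<bar>h x\<bar>)) B = (\<integral>\<^sup>+x. ennreal \<bar>h x\<bar> * indicator B x \<partial>\<mu>)"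
    using h B by (intro emeasure_density) auto
  also have "\<dots> = (\<integral>\<^sup>+x. ennreal (f x * h x) \<partial>\<mu>)"
    by (intro nn_integral_cong) (auto simp: f_def indicator_def abs_sgn ac_simps)
  also have "\<dots> = ennreal (LINT x|\<mu>. f x * h x)"
  proof (rule nn_integral_eq_integral)
    interpret finite_measure \<mu> by (rule s\<mu>)
    have "\<bar>f x * h x\<bar> \<le> 1" for x using mult_mono[OF f1[of x] h(2)[of x]] by (simp add: abs_mult)
    then show "integrable \<mu> (\<lambda>x. f x * h x)" using h fm[OF refl]
      by (intro integrable_const_bound[of _ 1] AE_I2) auto
    show "AE x in \<mu>. 0 \<le> f x * h x" by (intro AE_I2) (auto simp: f_def indicator_def sgn_mult_self_eq[symmetric] mult.commute abs_sgn[symmetric])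
  qed
  also have "\<dots> \<le> ennreal (measure \<nu> B)" using le' by (rule ennreal_leI)
  also have "\<dots> = emeasure \<nu> B"
    using finite_measure.emeasure_eq_measure[OF s\<nu>(1)] by simp
  finally show ?thesis .
qed

text \<open>
  On an open set the almost optimal test function can be supported inside the set: multiply a
  truncated approximation of \<open>sgn h\<close> by the cutoff functions of \<open>W\<close>.
\<close>

lemma density_open_approx:
  assumes \<mu>: "finite_borel_measure Y \<mu>"
    and h: "h \<in> borel_measurable \<mu>" "\<And>x. \<bar>h x\<bar> \<le> 1"
    and W: "openin (mtopology_of Y) W" and e: "e > 0"
  obtains f where "bounded_lipschitz Y f" "\<And>x. x \<in> mspace Y \<Longrightarrow> \<bar>f x\<bar> \<le> indicator W x"
    "measure (density \<mu> (\<lambda>x. ennreal \<bar>h x\<bar>)) W \<le> (LINT x|\<mu>. f x * h x) + e"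
proof -
  note s\<mu> = finite_borel_measureD[OF \<mu>]
  interpret finite_measure \<mu> by (rule s\<mu>)
  have Wm: "W \<in> sets \<mu>" using open_metric_borel[OF W] s\<mu> by simp
  define t where "t x = sgn (h x)" for x
  have tm: "t \<in> borel_measurable \<mu>" unfolding t_def[abs_def] using h by measurable
  have t1: "\<bar>t x\<bar> \<le> 1" for x by (auto simp: t_def abs_sgn_eq)
  have ti: "integrable \<mu> t" using t1 tm by (intro integrable_const_bound[of t 1] AE_I2) auto
  have twi: "integrable \<mu> (\<lambda>x. t x * indicator W x)"
    using t1 tm Wm by (intro integrable_const_bound[of _ 1] AE_I2) (auto simp: indicator_def)
  obtain g where g: "\<And>n. bounded_lipschitz Y (g n)" "L1_tends \<mu> g t"
    using lipschitz_dense_L1[OF \<mu> ti] by blast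
  obtain \<eta> :: "nat \<Rightarrow> 'a \<Rightarrow> real" where \<eta>: "\<And>k. bounded_lipschitz Y (\<eta> k)"
      "\<And>k x. 0 \<le> \<eta> k x" "\<And>k x. \<eta> k x \<le> 1"
      "\<And>k x. x \<in> mspace Y - W \<Longrightarrow> \<eta> k x = 0" "\<And>x. x \<in> W \<Longrightarrow> (\<lambda>k. \<eta> k x) \<longlonglongrightarrow> 1"
    using open_cutoff[OF W] by blast
  define f where "f n x = clip 1 (g n x) * \<eta> n x" for n x
  have f: "bounded_lipschitz Y (f n)" for n
    unfolding f_def using g(1) \<eta>(1) by (intro bounded_lipschitz_mult bounded_lipschitz_clip bounded_lipschitz_imp_lipschitz) auto
  note fi = integrable_bounded_lipschitz[OF \<mu> f] and gi = integrable_bounded_lipschitz[OF \<mu> g(1)]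
    and \<eta>i = integrable_bounded_lipschitz[OF \<mu> \<eta>(1)]
  have fW: "\<bar>f n x\<bar> \<le> indicator W x" if "x \<in> mspace Y" for n x
  proof (cases "x \<in> W")
    case True
    have "\<bar>clip 1 (g n x)\<bar> * \<bar>\<eta> n x\<bar> \<le> 1 * 1"
      using clip_bound[of 1 "g n x"] \<eta>(2,3)[of n x] by (intro mult_mono) auto
    then show ?thesis using True by (simp add: f_def abs_mult)
  next
    case False then show ?thesis using \<eta>(4)[of x n] that by (simp add: f_def)
  qed
  have ei: "integrable \<mu> (indicator W :: 'a \<Rightarrow> real)"
    using Wm emeasure_finite[of W] by (intro integrable_real_indicator) (auto simp: less_top[symmetric])
  have \<eta>0: "(\<lambda>n. LINT x|\<mu>. \<bar>\<eta> n x - indicator W x\<bar>) \<longlonglongrightarrow> 0"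
  proof (rule dominated_L1_tends[where w="\<lambda>_. 1"])
    fix x assume x: "x \<in> space \<mu>"
    show "(\<lambda>i. \<eta> i x) \<longlonglongrightarrow> indicator W x"
    proof (cases "x \<in> W")
      case True then show ?thesis using \<eta>(5) by simp
    next
      case False then show ?thesis using \<eta>(4)[of x] x s\<mu> by simp
    qed
    show "\<bar>\<eta> i x\<bar> \<le> 1" for i using \<eta>(2,3)[of i x] by simp
  qed (use \<eta>i ei in auto)
  have g0: "(\<lambda>n. LINT x|\<mu>. \<bar>g n x - t x\<bar>) \<longlonglongrightarrow> 0" using g(2) L1_tends_iff[OF gi ti] by simp
  have "(LINT x|\<mu>. \<bar>f n x - t x * indicator W x\<bar>)
      \<le> (LINT x|\<mu>. \<bar>g n x - t x\<bar>) + (LINT x|\<mu>. \<bar>\<eta> n x - indicator W x\<bar>)" for n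
  proof -
    have "(LINT x|\<mu>. \<bar>f n x - t x * indicator W x\<bar>)
      \<le> (LINT x|\<mu>. \<bar>g n x - t x\<bar> + \<bar>\<eta> n x - indicator W x\<bar>)"
    proof (rule integral_mono)
      fix x
      have "f n x - t x * indicator W x = (clip 1 (g n x) - clip 1 (t x)) * \<eta> n x + t x * (\<eta> n x - indicator W x)"
        using clip_id[OF t1] by (simp add: f_def algebra_simps)
      then have "\<bar>f n x - t x * indicator W x\<bar>
          \<le> \<bar>clip 1 (g n x) - clip 1 (t x)\<bar> * \<bar>\<eta> n x\<bar> + \<bar>t x\<bar> * \<bar>\<eta> n x - indicator W x\<bar>"
        by (metis abs_mult abs_triangle_ineq)
      also have "\<dots> \<le> \<bar>g n x - t x\<bar> * 1 + 1 * \<bar>\<eta> n x - indicator W x\<bar>"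
        using \<eta>(2,3)[of n x] t1[of x] by (intro add_mono mult_mono clip_lipschitz) auto
      finally show "\<bar>f n x - t x * indicator W x\<bar> \<le> \<bar>g n x - t x\<bar> + \<bar>\<eta> n x - indicator W x\<bar>" by simp
    qed (use fi twi gi ti \<eta>i ei in auto)
    also have "\<dots> = (LINT x|\<mu>. \<bar>g n x - t x\<bar>) + (LINT x|\<mu>. \<bar>\<eta> n x - indicator W x\<bar>)"
      using gi ti \<eta>i ei by (intro Bochner_Integration.integral_add) auto
    finally show ?thesis .
  qed
  then have "(\<lambda>n. LINT x|\<mu>. \<bar>f n x - t x * indicator W x\<bar>) \<longlonglongrightarrow> 0"
    by (intro tendsto_0_by_bound[OF _ tendsto_add_zero[OF g0 \<eta>0]]) (simp add: abs_of_nonneg integral_nonneg_AE)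
  then have "L1_tends \<mu> f (\<lambda>x. t x * indicator W x)" using L1_tends_iff[OF fi twi] by simp
  then have lim: "(\<lambda>n. LINT x|\<mu>. f n x * h x) \<longlonglongrightarrow> (LINT x|\<mu>. (t x * indicator W x) * h x)"
    by (rule L1_tends_integral(1)[OF \<mu> fi twi _ h])
  have eq: "emeasure (density \<mu> (\<lambda>x. ennreal \<bar>h x\<bar>)) W = ennreal (LINT x|\<mu>. (t x * indicator W x) * h x)"
  proof -
    have "emeasure (density \<mu> (\<lambda>x. ennreal \<bar>h x\<bar>)) W = (\<integral>\<^sup>+x. ennreal \<bar>h x\<bar> * indicator W x \<partial>\<mu>)"
      using h Wm by (intro emeasure_density) auto
    also have "\<dots> = (\<integral>\<^sup>+x. ennreal ((t x * indicator W x) * h x) \<partial>\<mu>)"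
      by (intro nn_integral_cong) (auto simp: t_def indicator_def abs_sgn ac_simps)
    also have "\<dots> = ennreal (LINT x|\<mu>. (t x * indicator W x) * h x)"
    proof (rule nn_integral_eq_integral)
      have "\<bar>(t x * indicator W x) * h x\<bar> \<le> 1" for x
        using mult_mono[OF t1[of x] h(2)[of x]] by (simp add: abs_mult indicator_def)
      then show "integrable \<mu> (\<lambda>x. (t x * indicator W x) * h x)" using h tm Wm
        by (intro integrable_const_bound[of _ 1] AE_I2) auto
      show "AE x in \<mu>. 0 \<le> (t x * indicator W x) * h x"
        by (intro AE_I2) (auto simp: t_def indicator_def mult.commute abs_sgn[symmetric])
    qed
    finally show ?thesis .
  qed
  have nn: "0 \<le> (LINT x|\<mu>. (t x * indicator W x) * h x)"
    by (intro integral_nonneg_AE AE_I2) (auto simp: t_def indicator_def mult.commute abs_sgn[symmetric])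
  have m: "measure (density \<mu> (\<lambda>x. ennreal \<bar>h x\<bar>)) W = (LINT x|\<mu>. (t x * indicator W x) * h x)"
    using eq nn by (simp add: measure_def)
  have "eventually (\<lambda>n. (LINT x|\<mu>. (t x * indicator W x) * h x) - e < (LINT x|\<mu>. f n x * h x)) sequentially"
    using lim e by (intro order_tendstoD(1)) auto
  then obtain n where "(LINT x|\<mu>. (t x * indicator W x) * h x) - e < (LINT x|\<mu>. f n x * h x)"
    by (auto simp: eventually_sequentially)
  then show thesis using that[OF f fW, of n] m by simp
qed

section \<open>The mass measure as a supremum\<close>

definition unit_tuple :: "nat \<Rightarrow> 'a metric \<Rightarrow> ('a \<Rightarrow> real) list \<Rightarrow> bool" where
  "unit_tuple m Y ps \<longleftrightarrow> length ps = m \<and> (\<forall>p\<in>set ps. lipschitz_bound Y 1 p)"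

lemma unit_tuple_form: "unit_tuple m Y ps \<Longrightarrow> bounded_lipschitz Y f \<Longrightarrow> form m Y f ps"
  unfolding unit_tuple_def form_def by (auto intro: lipschitz_funI)

lemma ex_unit_tuple: "unit_tuple m Y (replicate m (\<lambda>_. 0))"
proof -
  have "lipschitz_bound Y 1 (\<lambda>_. 0)" by (rule lipschitz_bound_mono[OF lipschitz_bound_const]) simp
  then show ?thesis by (simp add: unit_tuple_def)
qed

lemma controls_iff:
  "controls m Y T \<mu> \<longleftrightarrow> finite_borel_measure Y \<mu> \<and>
     (\<forall>f ps. bounded_lipschitz Y f \<longrightarrow> unit_tuple m Y ps \<longrightarrow> \<bar>T f ps\<bar> \<le> (LINT x|\<mu>. \<bar>f x\<bar>))"
  unfolding controls_def unit_tuple_def form_def by (auto intro: lipschitz_funI)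

definition linear_on_forms :: "nat \<Rightarrow> 'a metric \<Rightarrow> 'a functional \<Rightarrow> bool" where
  "linear_on_forms m Y T \<longleftrightarrow> (\<forall>f g ps a b. form m Y f ps \<longrightarrow> form m Y g ps \<longrightarrow>
        T (\<lambda>x. a * f x + b * g x) ps = a * T f ps + b * T g ps)"

text \<open>
  The property by which \<^const>\<open>mass_measure\<close> selects its value.
\<close>

definition minimal_control :: "nat \<Rightarrow> 'a metric \<Rightarrow> 'a functional \<Rightarrow> 'a measure \<Rightarrow> bool" where
  "minimal_control m Y T \<mu> \<longleftrightarrow> controls m Y T \<mu> \<and>
     (\<forall>\<nu>. controls m Y T \<nu> \<longrightarrow> (\<forall>B\<in>sets (metric_borel Y). emeasure \<mu> B \<le> emeasure \<nu> B))"

lemma controls_finite_borel: "controls m Y T \<mu> \<Longrightarrow> finite_borel_measure Y \<mu>"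
  by (simp add: controls_def)

lemma minimal_controlD:
  assumes "minimal_control m Y T \<mu>"
  shows "controls m Y T \<mu>" "finite_borel_measure Y \<mu>"
    "\<And>\<nu> B. controls m Y T \<nu> \<Longrightarrow> B \<in> sets (metric_borel Y) \<Longrightarrow> emeasure \<mu> B \<le> emeasure \<nu> B"
  using assms unfolding minimal_control_def controls_def by auto

lemma minimal_control_unique:
  assumes "minimal_control m Y T \<mu>" "minimal_control m Y T \<nu>" shows "\<mu> = \<nu>"
proof (rule measure_eqI)
  note s = finite_borel_measureD[OF minimal_controlD(2)[OF assms(1)]] finite_borel_measureD[OF minimal_controlD(2)[OF assms(2)]]
  then show "sets \<mu> = sets \<nu>" by simp
  fix B assume "B \<in> sets \<mu>"
  then show "emeasure \<mu> B = emeasure \<nu> B"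
    using s minimal_controlD[OF assms(1)] minimal_controlD[OF assms(2)] by (intro antisym) auto
qed

lemma mass_measure_eq:
  assumes "minimal_control m Y T \<mu>" shows "mass_measure m Y T = \<mu>"
  unfolding mass_measure_def
proof (rule the_equality)
  show "controls m Y T \<mu> \<and> (\<forall>\<nu>. controls m Y T \<nu> \<longrightarrow> (\<forall>B\<in>sets (metric_borel Y). emeasure \<mu> B \<le> emeasure \<nu> B))"
    using assms by (simp add: minimal_control_def)
  fix \<nu> assume "controls m Y T \<nu> \<and> (\<forall>\<nu>'. controls m Y T \<nu>' \<longrightarrow> (\<forall>B\<in>sets (metric_borel Y). emeasure \<nu> B \<le> emeasure \<nu>' B))"
  then have "minimal_control m Y T \<nu>" by (simp add: minimal_control_def)
  then show "\<nu> = \<mu>" using assms by (rule minimal_control_unique)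
qed

interpretation sup_measure: comm_monoid_set sup "bot :: 'a measure"
  by standard (auto intro!: antisym)

lemma sup_eq_sup_measure': "sets M = sets N \<Longrightarrow> sup M N = sup_measure' M N"
  using sets_eq_imp_space_eq[of M N] by (simp add: sup_measure_def sup_lexord_def)

text \<open>
  A property of measures with the same measurable sets passes from the members of a finite family
  to its supremum when it passes to the supremum of two.
\<close>

lemma finite_sup_measure_induct:
  assumes "finite P" "P \<noteq> {}" and "\<And>k. k \<in> P \<Longrightarrow> Q k" "\<And>k. Q k \<Longrightarrow> sets k = sets \<mu>"
    "\<And>k l. Q k \<Longrightarrow> Q l \<Longrightarrow> Q (sup_measure' k l)"
  shows "Q (sup_measure.F id P)"
  using assms(1,2,3)
proof (induction P rule: finite_ne_induct)
  case (singleton k) then show ?case by simp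
next
  case (insert k P)
  then have "Q k" "Q (sup_measure.F id P)" by auto
  moreover from this have "sup k (sup_measure.F id P) = sup_measure' k (sup_measure.F id P)"
    using assms(4) by (intro sup_eq_sup_measure') auto
  ultimately show ?case using insert assms(5) by simp
qed

lemma Sup_measure'_upper:
  assumes "\<And>k. k \<in> M \<Longrightarrow> sets k = sets \<mu>" "B \<in> sets \<mu>" "k \<in> M"
  shows "emeasure k B \<le> emeasure (Sup_measure' M) B"
proof -
  have "emeasure (Sup_measure' M) B = (SUP P\<in>{P. finite P \<and> P \<subseteq> M}. emeasure (sup_measure.F id P) B)"
    using assms by (intro emeasure_Sup_measure') auto
  moreover have "emeasure (sup_measure.F id {k}) B \<le> (SUP P\<in>{P. finite P \<and> P \<subseteq> M}. emeasure (sup_measure.F id P) B)"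
    using assms by (intro SUP_upper) auto
  ultimately show ?thesis by simp
qed

lemma Sup_measure'_least:
  assumes M: "\<And>k. k \<in> M \<Longrightarrow> sets k = sets \<mu>" and B: "B \<in> sets \<mu>" and ne: "M \<noteq> {}"
    and le: "\<And>k A. k \<in> M \<Longrightarrow> A \<in> sets \<mu> \<Longrightarrow> emeasure k A \<le> emeasure \<nu> A" and \<nu>: "sets \<nu> = sets \<mu>"
  shows "emeasure (Sup_measure' M) B \<le> emeasure \<nu> B"
proof -
  have "emeasure (Sup_measure' M) B = (SUP P\<in>{P. finite P \<and> P \<subseteq> M}. emeasure (sup_measure.F id P) B)"
    using assms by (intro emeasure_Sup_measure') auto
  also have "\<dots> \<le> emeasure \<nu> B"
  proof (rule SUP_least)
    fix P assume P: "P \<in> {P. finite P \<and> P \<subseteq> M}"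
    show "emeasure (sup_measure.F id P) B \<le> emeasure \<nu> B"
    proof (cases "P = {}")
      case False
      have "sets (sup_measure.F id P) = sets \<mu> \<and> (\<forall>A\<in>sets \<mu>. emeasure (sup_measure.F id P) A \<le> emeasure \<nu> A)"
      proof (rule finite_sup_measure_induct[where Q="\<lambda>k. sets k = sets \<mu> \<and> (\<forall>A\<in>sets \<mu>. emeasure k A \<le> emeasure \<nu> A)"])
        fix k l assume kl: "sets k = sets \<mu> \<and> (\<forall>A\<in>sets \<mu>. emeasure k A \<le> emeasure \<nu> A)"
          "sets l = sets \<mu> \<and> (\<forall>A\<in>sets \<mu>. emeasure l A \<le> emeasure \<nu> A)"
        then show "sets (sup_measure' k l) = sets \<mu> \<and> (\<forall>A\<in>sets \<mu>. emeasure (sup_measure' k l) A \<le> emeasure \<nu> A)"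
          using \<nu> by (auto intro!: emeasure_sup_measure'_le2)
      qed (use P False M le in auto)
      then show ?thesis using B by blast
    qed simp
  qed
  finally show ?thesis .
qed

lemma integral_mono_measure:
  fixes f :: "'a \<Rightarrow> real"
  assumes s: "sets \<mu> = sets \<nu>" and le: "\<And>B. B \<in> sets \<mu> \<Longrightarrow> emeasure \<mu> B \<le> emeasure \<nu> B"
    and f: "integrable \<mu> f" "integrable \<nu> f"
  shows "(LINT x|\<mu>. \<bar>f x\<bar>) \<le> (LINT x|\<nu>. \<bar>f x\<bar>)"
proof -
  have "\<mu> \<le> \<nu>" using le_measure[OF s] le by simp
  then have "(\<integral>\<^sup>+x. ennreal \<bar>f x\<bar> \<partial>\<mu>) \<le> (\<integral>\<^sup>+x. ennreal \<bar>f x\<bar> \<partial>\<nu>)"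
    using s by (intro nn_integral_mono_measure) auto
  then have "ennreal (LINT x|\<mu>. \<bar>f x\<bar>) \<le> ennreal (LINT x|\<nu>. \<bar>f x\<bar>)"
    using integral_eq_nn_integral_abs[OF f(1)] integral_eq_nn_integral_abs[OF f(2)] by simp
  then show ?thesis by (subst (asm) ennreal_le_iff) (auto intro: integral_nonneg_AE)
qed

lemma finite_borel_measure_le:
  assumes \<mu>: "finite_borel_measure Y \<mu>" and s: "sets \<kappa> = sets \<mu>"
    and le: "\<And>B. B \<in> sets \<mu> \<Longrightarrow> emeasure \<kappa> B \<le> emeasure \<mu> B"
  shows "finite_borel_measure Y \<kappa>"
proof -
  note s\<mu> = finite_borel_measureD[OF \<mu>]
  have "emeasure \<kappa> (space \<kappa>) \<le> emeasure \<mu> (space \<mu>)"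
    using le[of "space \<mu>"] sets_eq_imp_space_eq[OF s] by simp
  also have "\<dots> < \<infinity>" using finite_measure.emeasure_finite[OF s\<mu>(1)] by (simp add: less_top[symmetric])
  finally have "finite_measure \<kappa>" by (intro finite_measureI) auto
  then show ?thesis using s s\<mu> by (simp add: finite_borel_measure_def)
qed

lemma density_abs_le:
  assumes "h \<in> borel_measurable \<mu>" "\<And>x. \<bar>h x\<bar> \<le> (1::real)" "B \<in> sets \<mu>"
  shows "emeasure (density \<mu> (\<lambda>x. ennreal \<bar>h x\<bar>)) B \<le> emeasure \<mu> B"
proof -
  have "emeasure (density \<mu> (\<lambda>x. ennreal \<bar>h x\<bar>)) B = (\<integral>\<^sup>+x. ennreal \<bar>h x\<bar> * indicator B x \<partial>\<mu>)"
    using assms by (intro emeasure_density) auto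
  also have "\<dots> \<le> (\<integral>\<^sup>+x. indicator B x \<partial>\<mu>)"
    using assms(2) by (intro nn_integral_mono) (auto simp: indicator_def)
  also have "\<dots> = emeasure \<mu> B" using assms by simp
  finally show ?thesis .
qed

text \<open>
  The set \<open>H\<close> contains the densities of the functionals \<open>f \<mapsto> T f
  ps\<close> with respect to \<open>\<mu>\<close>.
\<close>

definition mass_densities ::
    "nat \<Rightarrow> 'a metric \<Rightarrow> 'a functional \<Rightarrow> 'a measure \<Rightarrow> ('a \<Rightarrow> real) set \<Rightarrow> bool" where
  "mass_densities m Y T \<mu> H \<longleftrightarrow> H \<noteq> {} \<and>
     (\<forall>h\<in>H. h \<in> borel_measurable \<mu> \<and> (\<forall>x. \<bar>h x\<bar> \<le> 1) \<and>
        (\<exists>ps. unit_tuple m Y ps \<and> (\<forall>f. bounded_lipschitz Y f \<longrightarrow> T f ps = (LINT x|\<mu>. f x * h x)))) \<and>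
     minimal_control m Y T (Sup_measure' ((\<lambda>h. density \<mu> (\<lambda>x. ennreal \<bar>h x\<bar>)) ` H))"

text \<open>
  The supremum of the measures $|h|\mu$ controls \<open>T\<close> because each functional \<open>f
  \<mapsto> T f ps\<close> is integration against one of the densities. It is minimal because any
  measure that controls \<open>T\<close> dominates each $|h|\mu$, and a supremum lies below every
  upper bound.
\<close>

lemma ex_mass_densities:
  assumes lin: "linear_on_forms m Y T" and c: "controls m Y T \<mu>"
  shows "\<exists>H. mass_densities m Y T \<mu> H"
proof -
  have \<mu>: "finite_borel_measure Y \<mu>" using c by (rule controls_finite_borel)
  note s\<mu> = finite_borel_measureD[OF \<mu>]
  have "\<exists>h. h \<in> borel_measurable \<mu> \<and> (\<forall>x. \<bar>h x\<bar> \<le> 1) \<and>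
      (\<forall>f. bounded_lipschitz Y f \<longrightarrow> T f ps = (LINT x|\<mu>. f x * h x))" if ps: "unit_tuple m Y ps" for ps
  proof -
    interpret L1_functional Y \<mu> "\<lambda>f. T f ps"
    proof
      show "finite_borel_measure Y \<mu>" by (rule \<mu>)
      show "T (\<lambda>x. a * f x + b * g x) ps = a * T f ps + b * T g ps"
        if "bounded_lipschitz Y f" "bounded_lipschitz Y g" for f g a b
        using lin unit_tuple_form[OF ps] that unfolding linear_on_forms_def by blast
      show "\<bar>T f ps\<bar> \<le> (LINT x|\<mu>. \<bar>f x\<bar>)" if "bounded_lipschitz Y f" for f
        using c ps that unfolding controls_iff by blast
    qed
    obtain h where h: "h \<in> borel_measurable \<mu>" "\<And>x. \<bar>h x\<bar> \<le> 1"
      "\<And>f. integrable \<mu> f \<Longrightarrow> ext f = (LINT x|\<mu>. f x * h x)" using ext_density by blast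
    have "T f ps = (LINT x|\<mu>. f x * h x)" if "bounded_lipschitz Y f" for f
      using h(3)[OF integrable_bl[OF that]] ext_bl[OF that] by simp
    then show ?thesis using h by blast
  qed
  then obtain hh where hh: "\<And>ps. unit_tuple m Y ps \<Longrightarrow> hh ps \<in> borel_measurable \<mu>"
    "\<And>ps x. unit_tuple m Y ps \<Longrightarrow> \<bar>hh ps x\<bar> \<le> 1"
    "\<And>ps f. unit_tuple m Y ps \<Longrightarrow> bounded_lipschitz Y f \<Longrightarrow> T f ps = (LINT x|\<mu>. f x * hh ps x)"
    by metis
  define H where "H = hh ` {ps. unit_tuple m Y ps}"
  define D where "D = (\<lambda>h. density \<mu> (\<lambda>x. ennreal \<bar>h x\<bar>)) ` H"
  have H: "H \<noteq> {}" using ex_unit_tuple[of m Y] by (auto simp: H_def)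
  then have D: "D \<noteq> {}" by (simp add: D_def)
  have Ds: "sets k = sets \<mu>" if "k \<in> D" for k using that by (auto simp: D_def)
  define S where "S = Sup_measure' D"
  have Ss: "sets S = sets \<mu>" unfolding S_def by (rule sets_Sup_measure'[OF Ds D])
  have S\<mu>: "emeasure S B \<le> emeasure \<mu> B" if "B \<in> sets \<mu>" for B
    unfolding S_def
  proof (rule Sup_measure'_least[OF Ds that D])
    fix k A assume "k \<in> D" "A \<in> sets \<mu>"
    then show "emeasure k A \<le> emeasure \<mu> A" using hh by (auto simp: D_def H_def intro!: density_abs_le)
  qed auto
  have Sf: "finite_borel_measure Y S" by (rule finite_borel_measure_le[OF \<mu> Ss S\<mu>])
  have "controls m Y T S"
    unfolding controls_iff
  proof (intro conjI allI impI Sf)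
    fix f ps assume f: "bounded_lipschitz Y f" and ps: "unit_tuple m Y ps"
    let ?h = "hh ps"
    note h = hh(1)[OF ps] hh(2)[OF ps]
    define k where "k = density \<mu> (\<lambda>x. ennreal \<bar>?h x\<bar>)"
    have kD: "k \<in> D" using ps by (auto simp: k_def D_def H_def)
    have kf: "finite_borel_measure Y k"
      using h by (intro finite_borel_measure_le[OF \<mu>]) (auto simp: k_def intro!: density_abs_le)
    have fi: "integrable \<mu> f" "integrable S f" "integrable k f"
      using f Sf \<mu> kf integrable_bounded_lipschitz by auto
    have "\<bar>T f ps\<bar> = \<bar>LINT x|\<mu>. f x * ?h x\<bar>" using hh(3)[OF ps f] by simp
    also have "\<dots> \<le> (LINT x|\<mu>. \<bar>f x * ?h x\<bar>)" by (rule integral_abs_bound)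
    also have "\<dots> = (LINT x|\<mu>. \<bar>?h x\<bar> *\<^sub>R \<bar>f x\<bar>)" by (simp add: abs_mult mult.commute)
    also have "\<dots> = (LINT x|k. \<bar>f x\<bar>)"
      unfolding k_def using h fi(1) by (intro integral_density[symmetric]) auto
    also have "\<dots> \<le> (LINT x|S. \<bar>f x\<bar>)"
    proof (rule integral_mono_measure)
      show "sets k = sets S" using Ds[OF kD] Ss by simp
      show "emeasure k B \<le> emeasure S B" if "B \<in> sets k" for B
        unfolding S_def using that Ds[OF kD] kD by (intro Sup_measure'_upper[OF Ds]) auto
    qed (use fi in auto)
    finally show "\<bar>T f ps\<bar> \<le> (LINT x|S. \<bar>f x\<bar>)" .
  qed
  moreover have "emeasure S B \<le> emeasure \<nu> B" if \<nu>: "controls m Y T \<nu>" and B: "B \<in> sets (metric_borel Y)" for \<nu> B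
    unfolding S_def
  proof (rule Sup_measure'_least[OF Ds _ D])
    show "B \<in> sets \<mu>" "sets \<nu> = sets \<mu>" using B s\<mu> finite_borel_measureD[OF controls_finite_borel[OF \<nu>]] by auto
    fix k A assume "k \<in> D" and A: "A \<in> sets \<mu>"
    then obtain ps where ps: "unit_tuple m Y ps" and k: "k = density \<mu> (\<lambda>x. ennreal \<bar>hh ps x\<bar>)"
      by (auto simp: D_def H_def)
    show "emeasure k A \<le> emeasure \<nu> A" unfolding k
    proof (rule density_le_control[OF \<mu> controls_finite_borel[OF \<nu>] hh(1,2)[OF ps] _ A])
      fix f assume f: "bounded_lipschitz Y f"
      show "\<bar>LINT x|\<mu>. f x * hh ps x\<bar> \<le> (LINT x|\<nu>. \<bar>f x\<bar>)"
        using \<nu> f ps unfolding controls_iff hh(3)[OF ps f, symmetric] by blast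
    qed
  qed
  ultimately have "minimal_control m Y T S" by (simp add: minimal_control_def)
  then have min: "minimal_control m Y T (Sup_measure' ((\<lambda>h. density \<mu> (\<lambda>x. ennreal \<bar>h x\<bar>)) ` H))"
    by (simp add: S_def D_def)
  have rep: "h \<in> borel_measurable \<mu> \<and> (\<forall>x. \<bar>h x\<bar> \<le> 1) \<and>
      (\<exists>ps. unit_tuple m Y ps \<and> (\<forall>f. bounded_lipschitz Y f \<longrightarrow> T f ps = (LINT x|\<mu>. f x * h x)))"
    if hH: "h \<in> H" for h
  proof -
    obtain ps where ps: "unit_tuple m Y ps" and h: "h = hh ps" using hH unfolding H_def by blast
    show ?thesis unfolding h
      by (intro conjI exI[of _ ps] allI impI hh(1)[OF ps] hh(2)[OF ps] hh(3)[OF ps] ps)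
  qed
  have "mass_densities m Y T \<mu> H" unfolding mass_densities_def
    by (rule conjI[OF H conjI[OF ballI[OF rep] min]])
  then show ?thesis by (rule exI)
qed

lemma minimal_control_mass_measure:
  assumes "linear_on_forms m Y T" "finite_mass m Y T"
  shows "minimal_control m Y T (mass_measure m Y T)"
proof -
  obtain \<mu> where "controls m Y T \<mu>" using assms(2) by (auto simp: finite_mass_def)
  then obtain S where S: "minimal_control m Y T S"
    using ex_mass_densities[OF assms(1)] unfolding mass_densities_def by blast
  show ?thesis unfolding mass_measure_eq[OF S] by (rule S)
qed

section \<open>Lower semicontinuity of mass\<close>

text \<open>
  The inequality $\kappa(W) \le \liminf_j \nu_j(W)$ for all open \<open>W\<close>, written with an
  error \<open>e\<close> so that such inequalities can be added.
\<close>

definition open_dominated :: "'a metric \<Rightarrow> 'a measure \<Rightarrow> (nat \<Rightarrow> 'a measure) \<Rightarrow> bool" where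
  "open_dominated Y \<kappa> \<nu> \<longleftrightarrow> (\<forall>W e. openin (mtopology_of Y) W \<longrightarrow> e > 0 \<longrightarrow>
     (\<forall>\<^sub>F j in sequentially. measure \<kappa> W \<le> measure (\<nu> j) W + e))"

lemma measure_le_L1:
  assumes \<mu>: "finite_borel_measure Y \<mu>" and g: "bounded_lipschitz Y g" and B: "B \<in> sets \<mu>"
    and A: "A \<in> sets \<mu>" "\<And>x. x \<in> A \<Longrightarrow> 1/2 \<le> \<bar>g x - indicator B x\<bar>"
  shows "measure \<mu> A \<le> 2 * (LINT x|\<mu>. \<bar>g x - indicator B x\<bar>)"
proof -
  interpret finite_measure \<mu> using finite_borel_measureD[OF \<mu>] by simp
  have ii: "integrable \<mu> (indicator C :: 'a \<Rightarrow> real)" if "C \<in> sets \<mu>" for C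
    using that emeasure_finite[of C] by (intro integrable_real_indicator) (auto simp: less_top[symmetric])
  have i: "integrable \<mu> (\<lambda>x. \<bar>g x - indicator B x\<bar>)"
    using integrable_bounded_lipschitz[OF \<mu> g] ii[OF B] by auto
  have "measure \<mu> A = (LINT x|\<mu>. indicator A x)" using A sets.sets_into_space[OF A(1)] by (simp add: Int_absorb2)
  also have "\<dots> \<le> (LINT x|\<mu>. 2 * \<bar>g x - indicator B x\<bar>)"
  proof (rule integral_mono)
    show "integrable \<mu> (indicator A :: 'a \<Rightarrow> real)" by (rule ii[OF A(1)])
    show "integrable \<mu> (\<lambda>x. 2 * \<bar>g x - indicator B x\<bar>)" using i by simp
    fix x show "indicator A x \<le> 2 * \<bar>g x - indicator B x\<bar>"
      using A(2)[of x] by (cases "x \<in> A") auto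
  qed
  also have "\<dots> = 2 * (LINT x|\<mu>. \<bar>g x - indicator B x\<bar>)" by simp
  finally show ?thesis .
qed

text \<open>
  The supremum of \<open>k\<close> and \<open>l\<close> measures \<open>W\<close>, up to an error,
  by \<open>k\<close> on a Borel set \<open>V\<close> and by \<open>l\<close> off
  \<open>V\<close>. A Lipschitz function \<open>g\<close> close to the indicator of
  \<open>V\<close> in $L^1$ replaces these two sets by the disjoint open sets \<open>g >
  1/2\<close> and \<open>g < 1/2\<close>, and the limit inferior is superadditive on disjoint
  sets.
\<close>

lemma open_dominated_sup:
  assumes \<mu>: "finite_borel_measure Y \<mu>" and \<nu>: "\<And>j. finite_borel_measure Y (\<nu> j)"
    and k: "sets k = sets \<mu>" "\<And>B. B \<in> sets \<mu> \<Longrightarrow> emeasure k B \<le> emeasure \<mu> B" "open_dominated Y k \<nu>"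
    and l: "sets l = sets \<mu>" "\<And>B. B \<in> sets \<mu> \<Longrightarrow> emeasure l B \<le> emeasure \<mu> B" "open_dominated Y l \<nu>"
  shows "open_dominated Y (sup_measure' k l) \<nu>"
  unfolding open_dominated_def
proof (intro allI impI)
  fix W and e :: real assume W: "openin (mtopology_of Y) W" and e: "e > 0"
  note s\<mu> = finite_borel_measureD[OF \<mu>]
  have kf: "finite_borel_measure Y k" and lf: "finite_borel_measure Y l"
    using k l by (auto intro: finite_borel_measure_le[OF \<mu>])
  interpret k: finite_measure k using finite_borel_measureD[OF kf] by simp
  interpret l: finite_measure l using finite_borel_measureD[OF lf] by simp
  interpret m: finite_measure \<mu> by (rule s\<mu>)
  have op: "A \<in> sets \<mu>" if "openin (mtopology_of Y) A" for A using open_metric_borel[OF that] s\<mu> by simp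
  have Wm: "W \<in> sets \<mu>" by (rule op[OF W])
  define s where "s = sup_measure' k l"
  have es: "emeasure s W = (SUP V\<in>sets k. emeasure k (W \<inter> V) + emeasure l (W \<inter> - V))"
    unfolding s_def using k l Wm by (intro emeasure_sup_measure') auto
  have "\<exists>V\<in>sets \<mu>. measure s W < measure k (W \<inter> V) + measure l (W - V) + e/5"
  proof (rule ccontr)
    assume "\<not> ?thesis"
    then have V: "measure k (W \<inter> V) + measure l (W - V) \<le> measure s W - e/5" if "V \<in> sets \<mu>" for V
      using that by (auto simp: not_less le_diff_eq)
    have "emeasure s W \<le> ennreal (measure s W - e/5)"
      unfolding es
    proof (rule SUP_least)
      fix V assume "V \<in> sets k"
      then have "emeasure k (W \<inter> V) + emeasure l (W \<inter> - V) = ennreal (measure k (W \<inter> V) + measure l (W - V))"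
        by (simp add: k.emeasure_eq_measure l.emeasure_eq_measure Diff_eq)
      also have "\<dots> \<le> ennreal (measure s W - e/5)" using V[of V] \<open>V \<in> sets k\<close> k(1) by (intro ennreal_leI) simp
      finally show "emeasure k (W \<inter> V) + emeasure l (W \<inter> - V) \<le> ennreal (measure s W - e/5)" .
    qed
    moreover have "0 \<le> measure s W - e/5" using V[OF sets.empty_sets] measure_nonneg[of k "W \<inter> {}"] measure_nonneg[of l "W - {}"] by linarith
    ultimately have "measure s W \<le> measure s W - e/5"
      unfolding measure_def[of s W] by (metis enn2real_ennreal enn2real_mono ennreal_less_top)
    then show False using e by simp
  qed
  then obtain V where V: "V \<in> sets \<mu>" and VW: "measure s W < measure k (W \<inter> V) + measure l (W - V) + e/5" by blast
  have "e/10 > 0" using e by simp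
  then obtain g where g: "bounded_lipschitz Y g" "(LINT x|\<mu>. \<bar>g x - indicator V x\<bar>) < e/10"
    using lipschitz_approx_indicator[OF \<mu> V] by blast
  define W1 where "W1 = W \<inter> {x\<in>mspace Y. g x \<in> {1/2<..}}"
  define W2 where "W2 = W \<inter> {x\<in>mspace Y. g x \<in> {..<1/2}}"
  have gl: "lipschitz_fun Y g" using g(1) by (rule bounded_lipschitz_imp_lipschitz)
  have W12: "openin (mtopology_of Y) W1" "openin (mtopology_of Y) W2"
    unfolding W1_def W2_def
    by (intro openin_Int W openin_lipschitz_preimage[OF gl] open_greaterThan open_lessThan)+
  have WY: "W \<subseteq> mspace Y" using openin_subset[OF W] by simp
  define A1 where "A1 = W \<inter> V - W1"
  define A2 where "A2 = W - V - W2"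
  have A: "A1 \<in> sets \<mu>" "A2 \<in> sets \<mu>" using Wm V op[OF W12(1)] op[OF W12(2)] by (auto simp: A1_def A2_def)
  have A1: "measure \<mu> A1 \<le> e/5"
    using measure_le_L1[OF \<mu> g(1) V A(1)] g(2) WY by (force simp: A1_def W1_def)
  have A2: "measure \<mu> A2 \<le> e/5"
    using measure_le_L1[OF \<mu> g(1) V A(2)] g(2) WY by (force simp: A2_def W2_def)
  have kle: "measure k B \<le> measure \<mu> B" if "B \<in> sets \<mu>" for B
    using k(2)[OF that] by (simp add: k.emeasure_eq_measure m.emeasure_eq_measure)
  have lle: "measure l B \<le> measure \<mu> B" if "B \<in> sets \<mu>" for B
    using l(2)[OF that] by (simp add: l.emeasure_eq_measure m.emeasure_eq_measure)
  have sk: "W1 \<in> sets k" "A1 \<in> sets k" "W2 \<in> sets l" "A2 \<in> sets l"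
    unfolding k(1) l(1) by (intro op W12 A)+
  have "W \<inter> V \<subseteq> W1 \<union> A1" by (auto simp: A1_def)
  then have "measure k (W \<inter> V) \<le> measure k (W1 \<union> A1)"
    by (rule k.finite_measure_mono[OF _ sets.Un[OF sk(1,2)]])
  also have "\<dots> \<le> measure k W1 + measure k A1" by (rule measure_Un_le[OF sk(1,2)])
  finally have 1: "measure k (W \<inter> V) \<le> measure k W1 + e/5" using kle[OF A(1)] A1 by linarith
  have "W - V \<subseteq> W2 \<union> A2" by (auto simp: A2_def)
  then have "measure l (W - V) \<le> measure l (W2 \<union> A2)"
    by (rule l.finite_measure_mono[OF _ sets.Un[OF sk(3,4)]])
  also have "\<dots> \<le> measure l W2 + measure l A2" by (rule measure_Un_le[OF sk(3,4)])
  finally have 2: "measure l (W - V) \<le> measure l W2 + e/5" using lle[OF A(2)] A2 by linarith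
  have e5: "e/5 > 0" using e by simp
  have "\<forall>\<^sub>F j in sequentially. measure k W1 \<le> measure (\<nu> j) W1 + e/5"
    using k(3) W12(1) e5 unfolding open_dominated_def by blast
  moreover have "\<forall>\<^sub>F j in sequentially. measure l W2 \<le> measure (\<nu> j) W2 + e/5"
    using l(3) W12(2) e5 unfolding open_dominated_def by blast
  ultimately show "\<forall>\<^sub>F j in sequentially. measure (sup_measure' k l) W \<le> measure (\<nu> j) W + e"
  proof eventually_elim
    case (elim j)
    interpret n: finite_measure "\<nu> j" using finite_borel_measureD[OF \<nu>] by simp
    have sn: "sets (\<nu> j) = sets \<mu>" using finite_borel_measureD[OF \<nu>] s\<mu> by simp
    have "W1 \<in> sets (\<nu> j)" "W2 \<in> sets (\<nu> j)" "W \<in> sets (\<nu> j)" unfolding sn by (intro op W12 W)+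
    moreover have "W1 \<inter> W2 = {}" "W1 \<union> W2 \<subseteq> W" by (auto simp: W1_def W2_def)
    ultimately have "measure (\<nu> j) W1 + measure (\<nu> j) W2 = measure (\<nu> j) (W1 \<union> W2)"
      and "measure (\<nu> j) (W1 \<union> W2) \<le> measure (\<nu> j) W"
      using n.finite_measure_Union[of W1 W2] n.finite_measure_mono[of "W1 \<union> W2" W] by simp_all
    then have "measure (\<nu> j) W1 + measure (\<nu> j) W2 \<le> measure (\<nu> j) W" by linarith
    then show ?case using elim 1 2 VW unfolding s_def by linarith
  qed
qed

text \<open>
  A supremum of measures is attained on a given set, up to an error, by a finite subfamily.
\<close>

lemma open_dominated_Sup:
  assumes \<mu>: "finite_borel_measure Y \<mu>" and \<nu>: "\<And>j. finite_borel_measure Y (\<nu> j)" and ne: "M \<noteq> {}"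
    and M: "\<And>k. k \<in> M \<Longrightarrow> sets k = sets \<mu>" "\<And>k B. k \<in> M \<Longrightarrow> B \<in> sets \<mu> \<Longrightarrow> emeasure k B \<le> emeasure \<mu> B"
      "\<And>k. k \<in> M \<Longrightarrow> open_dominated Y k \<nu>"
  shows "open_dominated Y (Sup_measure' M) \<nu>"
  unfolding open_dominated_def
proof (intro allI impI)
  fix W and e :: real assume W: "openin (mtopology_of Y) W" and e: "e > 0"
  note s\<mu> = finite_borel_measureD[OF \<mu>]
  have Wm: "W \<in> sets \<mu>" using open_metric_borel[OF W] s\<mu> by simp
  let ?S = "Sup_measure' M"
  have Sf: "finite_borel_measure Y ?S"
    by (rule finite_borel_measure_le[OF \<mu> sets_Sup_measure'[OF M(1) ne]]) (auto intro!: Sup_measure'_least[OF M(1) _ ne M(2)])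
  interpret S: finite_measure ?S using finite_borel_measureD[OF Sf] by simp
  let ?Q = "\<lambda>k. sets k = sets \<mu> \<and> (\<forall>B\<in>sets \<mu>. emeasure k B \<le> emeasure \<mu> B) \<and> open_dominated Y k \<nu>"
  have Q: "?Q (sup_measure.F id P)" if "finite P" "P \<subseteq> M" "P \<noteq> {}" for P
  proof (rule finite_sup_measure_induct[where Q="?Q"])
    fix k l assume k: "?Q k" and l: "?Q l"
    then have sl: "sets l = sets k" "sets \<mu> = sets k" by simp_all
    have "open_dominated Y (sup_measure' k l) \<nu>"
      by (rule open_dominated_sup[OF \<mu> \<nu>]) (use k l in auto)
    moreover have "emeasure (sup_measure' k l) B \<le> emeasure \<mu> B" if B: "B \<in> sets \<mu>" for B
      using k l B by (intro emeasure_sup_measure'_le2) auto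
    moreover have "sets (sup_measure' k l) = sets \<mu>" using k sets_sup_measure'[OF sl(1)] by simp
    ultimately show "?Q (sup_measure' k l)" by blast
  qed (use that M in auto)
  have "\<exists>P. finite P \<and> P \<subseteq> M \<and> measure ?S W < measure (sup_measure.F id P) W + e/2"
  proof (rule ccontr)
    assume no: "\<not> ?thesis"
    have P: "measure (sup_measure.F id P) W \<le> measure ?S W - e/2" if "finite P" "P \<subseteq> M" for P
    proof -
      have "\<not> (measure ?S W < measure (sup_measure.F id P) W + e/2)" using no that by blast
      then show ?thesis by linarith
    qed
    have "emeasure ?S W = (SUP P\<in>{P. finite P \<and> P \<subseteq> M}. emeasure (sup_measure.F id P) W)"
      using M(1) Wm ne by (intro emeasure_Sup_measure') auto
    also have "\<dots> \<le> ennreal (measure ?S W - e/2)"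
    proof (rule SUP_least)
      fix P assume "P \<in> {P. finite P \<and> P \<subseteq> M}"
      then have P': "finite P" "P \<subseteq> M" by auto
      show "emeasure (sup_measure.F id P) W \<le> ennreal (measure ?S W - e/2)"
      proof (cases "P = {}")
        case False
        have "finite_borel_measure Y (sup_measure.F id P)" using Q[OF P' False] by (intro finite_borel_measure_le[OF \<mu>]) auto
        from finite_borel_measureD(1)[OF this] interpret P: finite_measure "sup_measure.F id P" .
        show ?thesis using P[OF P'] unfolding P.emeasure_eq_measure by (rule ennreal_leI)
      qed simp
    qed
    finally have "emeasure ?S W \<le> ennreal (measure ?S W - e/2)" .
    moreover have "0 \<le> measure ?S W - e/2" using P[OF finite.emptyI empty_subsetI] measure_nonneg[of "sup_measure.F id {}" W] by linarith
    ultimately have "measure ?S W \<le> measure ?S W - e/2" by (simp add: S.emeasure_eq_measure)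
    then show False using e by simp
  qed
  then obtain P where P: "finite P" "P \<subseteq> M" "measure ?S W < measure (sup_measure.F id P) W + e/2" by blast
  show "\<forall>\<^sub>F j in sequentially. measure ?S W \<le> measure (\<nu> j) W + e"
  proof (cases "P = {}")
    case True
    have "measure ?S W \<le> measure (\<nu> j) W + e" for j
    proof -
      have "measure (sup_measure.F id P) W = 0" using True by (simp add: measure_def)
      then show ?thesis using P(3) e measure_nonneg[of "\<nu> j" W] by linarith
    qed
    then show ?thesis by simp
  next
    case False
    then have "open_dominated Y (sup_measure.F id P) \<nu>" using Q P by blast
    then have "\<forall>\<^sub>F j in sequentially. measure (sup_measure.F id P) W \<le> measure (\<nu> j) W + e/2"
      using W e unfolding open_dominated_def by simp
    then show ?thesis by eventually_elim (use P(3) in linarith)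
  qed
qed

text \<open>
  By the description of the mass as a supremum, it suffices to treat one density \<open>h\<close>.
  There a single test function supported in the open set already gives almost all of its mass.
\<close>

lemma mass_measure_lsc:
  assumes lin: "linear_on_forms m Y S" and \<kappa>: "minimal_control m Y S \<kappa>"
    and \<nu>: "\<And>j. finite_borel_measure Y (\<nu> j)"
    and lim: "\<And>f ps e. bounded_lipschitz Y f \<Longrightarrow> unit_tuple m Y ps \<Longrightarrow> e > 0 \<Longrightarrow>
       \<forall>\<^sub>F j in sequentially. \<bar>S f ps\<bar> \<le> (LINT x|\<nu> j. \<bar>f x\<bar>) + e"
  shows "open_dominated Y \<kappa> \<nu>"
proof -
  have \<kappa>f: "finite_borel_measure Y \<kappa>" by (rule minimal_controlD(2)[OF \<kappa>])
  obtain H where H: "mass_densities m Y S \<kappa> H" using ex_mass_densities[OF lin minimal_controlD(1)[OF \<kappa>]] by blast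
  have Hh: "h \<in> borel_measurable \<kappa>" "\<And>x. \<bar>h x\<bar> \<le> 1"
    "\<exists>ps. unit_tuple m Y ps \<and> (\<forall>f. bounded_lipschitz Y f \<longrightarrow> S f ps = (LINT x|\<kappa>. f x * h x))"
    if "h \<in> H" for h using H that unfolding mass_densities_def by auto
  have "open_dominated Y (Sup_measure' ((\<lambda>h. density \<kappa> (\<lambda>x. ennreal \<bar>h x\<bar>)) ` H)) \<nu>"
  proof (rule open_dominated_Sup[OF \<kappa>f \<nu>])
    fix k assume "k \<in> (\<lambda>h. density \<kappa> (\<lambda>x. ennreal \<bar>h x\<bar>)) ` H"
    then obtain h where h: "h \<in> H" and k: "k = density \<kappa> (\<lambda>x. ennreal \<bar>h x\<bar>)" by blast
    show "sets k = sets \<kappa>" by (simp add: k)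
    show "emeasure k B \<le> emeasure \<kappa> B" if "B \<in> sets \<kappa>" for B
      unfolding k by (rule density_abs_le[OF Hh(1,2)[OF h] that])
    obtain ps where ps: "unit_tuple m Y ps" "\<And>f. bounded_lipschitz Y f \<Longrightarrow> S f ps = (LINT x|\<kappa>. f x * h x)"
      using Hh(3)[OF h] by blast
    show "open_dominated Y k \<nu>"
      unfolding open_dominated_def
    proof (intro allI impI)
      fix W and e :: real assume W: "openin (mtopology_of Y) W" and e: "e > 0"
      then have e2: "e/2 > 0" by simp
      obtain f where f: "bounded_lipschitz Y f" "\<And>x. x \<in> mspace Y \<Longrightarrow> \<bar>f x\<bar> \<le> indicator W x"
        "measure k W \<le> (LINT x|\<kappa>. f x * h x) + e/2"
        unfolding k using density_open_approx[OF \<kappa>f Hh(1,2)[OF h] W e2] by blast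
      show "\<forall>\<^sub>F j in sequentially. measure k W \<le> measure (\<nu> j) W + e"
        using lim[OF f(1) ps(1) e2]
      proof eventually_elim
        case (elim j)
        note s = finite_borel_measureD[OF \<nu>[of j]]
        interpret n: finite_measure "\<nu> j" by (rule s)
        have Wm: "W \<in> sets (\<nu> j)" using open_metric_borel[OF W] s by simp
        have "(LINT x|\<nu> j. \<bar>f x\<bar>) \<le> (LINT x|\<nu> j. indicator W x)"
          using integrable_bounded_lipschitz[OF \<nu> f(1), of j] f(2) s n.emeasure_finite[of W] Wm
          by (intro integral_mono integrable_real_indicator integrable_abs) (auto simp: less_top[symmetric])
        also have "\<dots> = measure (\<nu> j) W" using Wm sets.sets_into_space[OF Wm] by (simp add: Int_absorb2)
        finally show ?case using elim f(3) ps(2)[OF f(1)] by linarith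
      qed
    qed
  qed (use H in \<open>simp add: mass_densities_def\<close>)
  moreover have "minimal_control m Y S (Sup_measure' ((\<lambda>h. density \<kappa> (\<lambda>x. ennreal \<bar>h x\<bar>)) ` H))"
    using H unfolding mass_densities_def by blast
  note minimal_control_unique[OF \<kappa> this]
  ultimately show ?thesis by simp
qed

section \<open>Mass of a restriction\<close>

lemma integral_abs_add_measure:
  assumes s: "sets \<nu> = sets \<mu>" and f: "integrable \<mu> f" "integrable \<nu> (f :: 'a \<Rightarrow> real)"
  shows "(LINT x|add_measure \<mu> \<nu>. \<bar>f x\<bar>) = (LINT x|\<mu>. \<bar>f x\<bar>) + (LINT x|\<nu>. \<bar>f x\<bar>)"
proof -
  have fm: "f \<in> borel_measurable \<mu>" using f by simp
  then have fm': "f \<in> borel_measurable (add_measure \<mu> \<nu>)" by (simp cong: measurable_cong_sets)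
  have "(\<integral>\<^sup>+x. ennreal \<bar>f x\<bar> \<partial>add_measure \<mu> \<nu>) = (\<integral>\<^sup>+x. ennreal \<bar>f x\<bar> \<partial>\<mu>) + (\<integral>\<^sup>+x. ennreal \<bar>f x\<bar> \<partial>\<nu>)"
    using fm by (intro nn_integral_add_measure[OF s]) auto
  also have "\<dots> = ennreal ((LINT x|\<mu>. \<bar>f x\<bar>) + (LINT x|\<nu>. \<bar>f x\<bar>))"
    by (simp add: integral_eq_nn_integral_abs[OF f(1), symmetric] integral_eq_nn_integral_abs[OF f(2), symmetric] integral_nonneg_AE)
  finally have e: "(\<integral>\<^sup>+x. ennreal \<bar>f x\<bar> \<partial>add_measure \<mu> \<nu>) = ennreal ((LINT x|\<mu>. \<bar>f x\<bar>) + (LINT x|\<nu>. \<bar>f x\<bar>))" .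
  have "(LINT x|add_measure \<mu> \<nu>. \<bar>f x\<bar>) = enn2real (\<integral>\<^sup>+x. ennreal \<bar>f x\<bar> \<partial>add_measure \<mu> \<nu>)"
    using fm' by (intro integral_eq_nn_integral) auto
  then show ?thesis unfolding e by (simp add: integral_nonneg_AE del: ennreal_plus)
qed

text \<open>
  If \<open>\<nu>\<close> controls the restriction of \<open>T\<close> to \<open>A\<close>, then
  adding to it the mass of \<open>T\<close> outside \<open>A\<close> gives a measure that controls
  \<open>T\<close>. It is at least the mass measure of \<open>T\<close>, and inside
  \<open>A\<close> this says that \<open>\<nu>\<close> is.
\<close>

lemma minimal_control_restrict:
  assumes lin: "linear_on_forms m Y T" and fin: "finite_mass m Y T"
    and A: "A \<in> sets (metric_borel Y)"
  shows "minimal_control m Y (restrict_current m Y T A) (density (mass_measure m Y T) (\<lambda>x. ennreal (indicator A x)))"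
proof -
  define \<kappa> where "\<kappa> = mass_measure m Y T"
  have \<kappa>: "minimal_control m Y T \<kappa>" unfolding \<kappa>_def by (rule minimal_control_mass_measure[OF lin fin])
  note \<kappa>f = minimal_controlD(2)[OF \<kappa>]
  note s\<kappa> = finite_borel_measureD[OF \<kappa>f]
  interpret k: finite_measure \<kappa> by (rule s\<kappa>)
  have A\<kappa>: "A \<in> sets \<kappa>" using A s\<kappa> by simp
  define R where "R = restrict_current m Y T A"
  define A' where "A' = mspace Y - A"
  have A': "A' \<in> sets \<kappa>" unfolding A'_def using A\<kappa> sets.compl_sets[of A \<kappa>] s\<kappa> by simp
  define dA where "dA B = density \<kappa> (\<lambda>x. ennreal (indicator B x))" for B :: "'a set"
  have dAe: "emeasure (dA B) C = emeasure \<kappa> (C \<inter> B)" if "B \<in> sets \<kappa>" "C \<in> sets \<kappa>" for B C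
  proof -
    have "emeasure (dA B) C = (\<integral>\<^sup>+x. ennreal (indicator B x) * indicator C x \<partial>\<kappa>)"
      unfolding dA_def using that by (intro emeasure_density) auto
    also have "\<dots> = (\<integral>\<^sup>+x. indicator (C \<inter> B) x \<partial>\<kappa>)"
      by (intro nn_integral_cong) (auto simp: indicator_def)
    finally show ?thesis using that by simp
  qed
  have dAs: "sets (dA B) = sets \<kappa>" for B by (simp add: dA_def)
  have dAf: "finite_borel_measure Y (dA B)" if "B \<in> sets \<kappa>" for B
    by (rule finite_borel_measure_le[OF \<kappa>f dAs]) (auto simp: dAe that intro!: emeasure_mono)
  have dAi: "(LINT x|dA B. \<bar>f x\<bar>) = (LINT x|\<kappa>. \<bar>f x * indicator B x\<bar>)"
    if "B \<in> sets \<kappa>" "integrable \<kappa> f" for B and f :: "'a \<Rightarrow> real"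
  proof -
    have "(LINT x|dA B. \<bar>f x\<bar>) = (LINT x|\<kappa>. indicator B x *\<^sub>R \<bar>f x\<bar>)"
      unfolding dA_def using that by (intro integral_density) auto
    also have "\<dots> = (LINT x|\<kappa>. \<bar>f x * indicator B x\<bar>)"
      by (intro Bochner_Integration.integral_cong) (auto simp: indicator_def)
    finally show ?thesis .
  qed
  have ext: "\<bar>R f ps\<bar> \<le> (LINT x|\<kappa>. \<bar>f x * indicator A x\<bar>)"
      "\<bar>T f ps\<bar> \<le> \<bar>R f ps\<bar> + (LINT x|\<kappa>. \<bar>f x * indicator A' x\<bar>)"
    if ps: "unit_tuple m Y ps" and f: "bounded_lipschitz Y f" for f ps
  proof -
    interpret L1_functional Y \<kappa> "\<lambda>f. T f ps"
    proof
      show "finite_borel_measure Y \<kappa>" by (rule \<kappa>f)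
      show "T (\<lambda>x. a * f x + b * g x) ps = a * T f ps + b * T g ps"
        if "bounded_lipschitz Y f" "bounded_lipschitz Y g" for f g a b
        using lin unit_tuple_form[OF ps] that unfolding linear_on_forms_def by blast
      show "\<bar>T f ps\<bar> \<le> (LINT x|\<kappa>. \<bar>f x\<bar>)" if "bounded_lipschitz Y f" for f
        using minimal_controlD(1)[OF \<kappa>] ps that unfolding controls_iff by blast
    qed
    have fi: "integrable \<kappa> f" by (rule integrable_bl[OF f])
    have iA: "integrable \<kappa> (\<lambda>x. f x * indicator B x)" if "B \<in> sets \<kappa>" for B
      by (rule integrable_real_mult_indicator[OF that fi])
    have R: "R f ps = ext (\<lambda>x. f x * indicator A x)"
      unfolding ext_def by (simp only: R_def restrict_current_def borel_extension_def L1_tends_def \<kappa>_def)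
    show "\<bar>R f ps\<bar> \<le> (LINT x|\<kappa>. \<bar>f x * indicator A x\<bar>)"
      unfolding R by (rule ext_bound[OF iA[OF A\<kappa>]])
    have "f x * indicator A x + f x * indicator A' x = f x" if "x \<in> space \<kappa>" for x
      using that s\<kappa> by (auto simp: A'_def indicator_def)
    then have "(LINT x|\<kappa>. \<bar>(f x * indicator A x + f x * indicator A' x) - f x\<bar>) = (LINT x|\<kappa>. 0)"
      by (intro Bochner_Integration.integral_cong) auto
    then have "\<bar>ext (\<lambda>x. f x * indicator A x + f x * indicator A' x) - ext f\<bar> \<le> 0"
      using ext_diff_le[OF Bochner_Integration.integrable_add[OF iA[OF A\<kappa>] iA[OF A']] fi] by simp
    then have "T f ps = ext (\<lambda>x. f x * indicator A x) + ext (\<lambda>x. f x * indicator A' x)"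
      using ext_bl[OF f] ext_add[OF iA[OF A\<kappa>] iA[OF A']] by simp
    then show "\<bar>T f ps\<bar> \<le> \<bar>R f ps\<bar> + (LINT x|\<kappa>. \<bar>f x * indicator A' x\<bar>)"
      using ext_bound[OF iA[OF A']] unfolding R by linarith
  qed
  have c: "controls m Y R (dA A)"
    unfolding controls_iff using dAf[OF A\<kappa>] ext(1) dAi[OF A\<kappa>] integrable_bounded_lipschitz[OF \<kappa>f] by simp
  have min: "emeasure (dA A) B \<le> emeasure \<nu> B" if \<nu>: "controls m Y R \<nu>" and B: "B \<in> sets (metric_borel Y)" for \<nu> B
  proof -
    have \<nu>f: "finite_borel_measure Y \<nu>" by (rule controls_finite_borel[OF \<nu>])
    note s\<nu> = finite_borel_measureD[OF \<nu>f]
    define \<sigma> where "\<sigma> = add_measure \<nu> (dA A')"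
    have ss: "sets (dA A') = sets \<nu>" using dAs s\<kappa> s\<nu> by simp
    have "controls m Y T \<sigma>"
      unfolding controls_iff
    proof (intro conjI allI impI)
      show "finite_borel_measure Y \<sigma>" unfolding \<sigma>_def by (rule finite_borel_measure_add[OF \<nu>f dAf[OF A']])
      fix f ps assume f: "bounded_lipschitz Y f" and ps: "unit_tuple m Y ps"
      have "\<bar>R f ps\<bar> \<le> (LINT x|\<nu>. \<bar>f x\<bar>)" using \<nu> f ps unfolding controls_iff by blast
      then have "\<bar>T f ps\<bar> \<le> (LINT x|\<nu>. \<bar>f x\<bar>) + (LINT x|dA A'. \<bar>f x\<bar>)"
        using ext(2)[OF ps f] dAi[OF A' integrable_bounded_lipschitz[OF \<kappa>f f]] by linarith
      then show "\<bar>T f ps\<bar> \<le> (LINT x|\<sigma>. \<bar>f x\<bar>)"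
        unfolding \<sigma>_def using f \<nu>f dAf[OF A'] integrable_bounded_lipschitz
        by (subst integral_abs_add_measure[OF ss]) auto
    qed
    moreover have BA: "B \<inter> A \<in> sets (metric_borel Y)" using B A by simp
    ultimately have "emeasure \<kappa> (B \<inter> A) \<le> emeasure \<sigma> (B \<inter> A)" by (rule minimal_controlD(3)[OF \<kappa>])
    also have "\<dots> = emeasure \<nu> (B \<inter> A) + emeasure (dA A') (B \<inter> A)"
      unfolding \<sigma>_def using BA s\<nu> by (intro emeasure_add_measure[OF ss]) simp
    also have "emeasure (dA A') (B \<inter> A) = emeasure \<kappa> (B \<inter> A \<inter> A')" using BA s\<kappa> by (intro dAe A') simp
    also have "B \<inter> A \<inter> A' = {}" by (auto simp: A'_def)
    finally have "emeasure \<kappa> (B \<inter> A) \<le> emeasure \<nu> (B \<inter> A)" by simp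
    also have "\<dots> \<le> emeasure \<nu> B" using B s\<nu> by (intro emeasure_mono) auto
    finally show ?thesis using B s\<kappa> by (subst dAe[OF A\<kappa>]) auto
  qed
  show ?thesis using c min unfolding minimal_control_def dA_def R_def \<kappa>_def by blast
qed

lemma mass_restrict:
  assumes lin: "linear_on_forms m Y T" and fin: "finite_mass m Y T"
    and A: "A \<in> sets (metric_borel Y)"
  shows "mass m Y (restrict_current m Y T A) = measure (mass_measure m Y T) A"
proof -
  define \<kappa> where "\<kappa> = mass_measure m Y T"
  have \<kappa>: "minimal_control m Y T \<kappa>" unfolding \<kappa>_def by (rule minimal_control_mass_measure[OF lin fin])
  note s\<kappa> = finite_borel_measureD[OF minimal_controlD(2)[OF \<kappa>]]
  have A\<kappa>: "A \<in> sets \<kappa>" "A \<subseteq> mspace Y" using A s\<kappa> sets.sets_into_space[OF A] by auto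
  have "emeasure (density \<kappa> (\<lambda>x. ennreal (indicator A x))) (mspace Y)
      = (\<integral>\<^sup>+x. ennreal (indicator A x) * indicator (mspace Y) x \<partial>\<kappa>)"
    using A\<kappa> sets.top[of \<kappa>] s\<kappa> by (intro emeasure_density) auto
  also have "\<dots> = (\<integral>\<^sup>+x. indicator A x \<partial>\<kappa>)"
    using A\<kappa> by (intro nn_integral_cong) (auto simp: indicator_def)
  also have "\<dots> = emeasure \<kappa> A" using A\<kappa> by simp
  finally show ?thesis
    unfolding mass_def mass_measure_eq[OF minimal_control_restrict[OF lin fin A]] \<kappa>_def[symmetric]
    by (simp add: measure_def)
qed

section \<open>Completions and isometric embeddings\<close>

lemma mdist_self [simp]: "x \<in> mspace M \<Longrightarrow> mdist M x x = 0"
  by (rule Metric_space.mdist_zero[OF Metric_space_mspace_mdist])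

lemma openin_mball_of: "openin (mtopology_of M) (mball_of M x r)"
  unfolding mtopology_of_def mball_of_def by (rule Metric_space.openin_mball[OF Metric_space_mspace_mdist])

lemma limitin_mtopology_of:
  "limitin (mtopology_of M) \<sigma> l F \<longleftrightarrow>
     l \<in> mspace M \<and> eventually (\<lambda>n. \<sigma> n \<in> mspace M) F \<and> ((\<lambda>n. mdist M (\<sigma> n) l) \<longlongrightarrow> 0) F"
  unfolding mtopology_of_def by (rule Metric_space.limitin_metric_dist_null[OF Metric_space_mspace_mdist])

lemma mdist_reverse:
  assumes "x \<in> mspace M" "y \<in> mspace M" "a \<in> mspace M" "b \<in> mspace M"
  shows "\<bar>mdist M x y - mdist M a b\<bar> \<le> mdist M x a + mdist M y b"
  using mdist_triangle[of x M a y] mdist_triangle[of a M b y] mdist_triangle[of a M x b]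
    mdist_triangle[of x M y b] assms mdist_commute[of M] by (smt (verit))

lemma mdist_tendsto:
  assumes s: "\<And>n. \<sigma> n \<in> mspace M" "\<And>n. \<tau> n \<in> mspace M"
    and l: "limitin (mtopology_of M) \<sigma> x sequentially" "limitin (mtopology_of M) \<tau> y sequentially"
  shows "(\<lambda>n. mdist M (\<sigma> n) (\<tau> n)) \<longlonglongrightarrow> mdist M x y"
proof -
  have xy: "x \<in> mspace M" "y \<in> mspace M" and 0: "(\<lambda>n. mdist M (\<sigma> n) x) \<longlonglongrightarrow> 0" "(\<lambda>n. mdist M (\<tau> n) y) \<longlonglongrightarrow> 0"
    using l unfolding limitin_mtopology_of by auto
  have "(\<lambda>n. mdist M (\<sigma> n) (\<tau> n) - mdist M x y) \<longlonglongrightarrow> 0"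
    by (rule tendsto_0_by_bound[OF mdist_reverse[OF s xy] tendsto_add_zero[OF 0]])
  then show ?thesis by (simp add: LIM_zero_iff)
qed

text \<open>
  Isometry makes the image of a Cauchy sequence Cauchy, so it converges in the complete space
  \<open>Z\<close>, and to the same limit for any two sequences with a common limit. The
  description by \<open>THE\<close> is thus proper.
\<close>

lemma extend_to_completion:
  assumes comp: "is_completion X Xc" and Z: "mcomplete_of Z" and \<phi>: "isometric_embedding X Z \<phi>"
  shows "isometric_embedding Xc Z (extend_to_completion X Xc Z \<phi>)"
    and "\<And>x. x \<in> mspace X \<Longrightarrow> extend_to_completion X Xc Z \<phi> x = \<phi> x"
proof -
  define \<psi> where "\<psi> = extend_to_completion X Xc Z \<phi>"
  have sub: "mspace X \<subseteq> mspace Xc" and dX: "\<And>x y. x \<in> mspace X \<Longrightarrow> y \<in> mspace X \<Longrightarrow> mdist Xc x y = mdist X x y"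
    and cl: "mtopology_of Xc closure_of mspace X = mspace Xc"
    using comp by (auto simp: is_completion_def)
  have \<phi>Z: "\<phi> x \<in> mspace Z" if "x \<in> mspace X" for x using \<phi> that by (auto simp: isometric_embedding_def)
  have d\<phi>: "mdist Z (\<phi> x) (\<phi> y) = mdist Xc x y" if "x \<in> mspace X" "y \<in> mspace X" for x y
    using \<phi> that dX by (auto simp: isometric_embedding_def)
  have approx: "\<exists>\<sigma>. range \<sigma> \<subseteq> mspace X \<and> limitin (mtopology_of Xc) \<sigma> x sequentially" if "x \<in> mspace Xc" for x
    using that Metric_space.closure_of_sequentially[OF Metric_space_mspace_mdist, of Xc "mspace X"] cl
    unfolding mtopology_of_def by blast
  have lim: "limitin (mtopology_of Z) (\<phi> \<circ> \<sigma>) (\<psi> x) sequentially"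
    if x: "range \<sigma> \<subseteq> mspace X" "limitin (mtopology_of Xc) \<sigma> x sequentially" for \<sigma> x
  proof -
    have \<sigma>X: "\<sigma> n \<in> mspace X" for n using x by blast
    have "Metric_space.MCauchy (mspace Xc) (mdist Xc) \<sigma>"
      using x sub unfolding mtopology_of_def
      by (intro Metric_space.convergent_imp_MCauchy[OF Metric_space_mspace_mdist]) auto
    then have "Metric_space.MCauchy (mspace Z) (mdist Z) (\<phi> \<circ> \<sigma>)"
      unfolding Metric_space.MCauchy_def[OF Metric_space_mspace_mdist]
      using \<sigma>X \<phi>Z d\<phi> by auto
    then obtain z where z: "limitin (mtopology_of Z) (\<phi> \<circ> \<sigma>) z sequentially"
      using Z unfolding mcomplete_of_def Metric_space.mcomplete_def[OF Metric_space_mspace_mdist] mtopology_of_def by blast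
    have all: "limitin (mtopology_of Z) (\<phi> \<circ> \<tau>) z sequentially"
      if t: "range \<tau> \<subseteq> mspace X" "limitin (mtopology_of Xc) \<tau> x sequentially" for \<tau>
    proof -
      have \<tau>X: "\<tau> n \<in> mspace X" for n using t by blast
      have "(\<lambda>n. mdist Xc (\<tau> n) (\<sigma> n)) \<longlonglongrightarrow> mdist Xc x x"
        using \<tau>X \<sigma>X sub by (intro mdist_tendsto t x) auto
      moreover have "x \<in> mspace Xc" using x by (simp add: limitin_mtopology_of)
      then have "mdist Xc x x = 0" by auto
      ultimately have 1: "(\<lambda>n. mdist Xc (\<tau> n) (\<sigma> n)) \<longlonglongrightarrow> 0" by simp
      have 2: "(\<lambda>n. mdist Z (\<phi> (\<sigma> n)) z) \<longlonglongrightarrow> 0" and zZ: "z \<in> mspace Z"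
        using z by (auto simp: limitin_mtopology_of)
      have "\<bar>mdist Z (\<phi> (\<tau> n)) z\<bar> \<le> mdist Xc (\<tau> n) (\<sigma> n) + mdist Z (\<phi> (\<sigma> n)) z" for n
        using mdist_triangle[OF \<phi>Z[OF \<tau>X[of n]] \<phi>Z[OF \<sigma>X[of n]] zZ] d\<phi>[OF \<tau>X \<sigma>X] by simp
      from tendsto_0_by_bound[OF this tendsto_add_zero[OF 1 2]]
      show ?thesis using zZ \<phi>Z \<tau>X by (simp add: limitin_mtopology_of)
    qed
    have "\<psi> x = z" unfolding \<psi>_def extend_to_completion_def
    proof (rule the_equality)
      show "\<forall>\<tau>. range \<tau> \<subseteq> mspace X \<longrightarrow> limitin (mtopology_of Xc) \<tau> x sequentially \<longrightarrow>
        limitin (mtopology_of Z) (\<phi> \<circ> \<tau>) z sequentially" using all by blast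
      fix w assume "\<forall>\<tau>. range \<tau> \<subseteq> mspace X \<longrightarrow> limitin (mtopology_of Xc) \<tau> x sequentially \<longrightarrow>
        limitin (mtopology_of Z) (\<phi> \<circ> \<tau>) w sequentially"
      then have "limitin (mtopology_of Z) (\<phi> \<circ> \<sigma>) w sequentially" using x by blast
      then show "w = z" using z unfolding mtopology_of_def
        by (rule Metric_space.limitin_metric_unique[OF Metric_space_mspace_mdist]) simp
    qed
    then show ?thesis using z by simp
  qed
  show "extend_to_completion X Xc Z \<phi> x = \<phi> x" if x: "x \<in> mspace X" for x
  proof -
    have "limitin (mtopology_of Xc) (\<lambda>_. x) x sequentially" using x sub by (auto simp: limitin_mtopology_of)
    then have "limitin (mtopology_of Z) (\<phi> \<circ> (\<lambda>_. x)) (\<psi> x) sequentially" using x by (intro lim) auto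
    moreover have "limitin (mtopology_of Z) (\<phi> \<circ> (\<lambda>_. x)) (\<phi> x) sequentially"
      using \<phi>Z[OF x] by (simp add: limitin_mtopology_of)
    ultimately have "\<psi> x = \<phi> x" unfolding mtopology_of_def
      by (rule Metric_space.limitin_metric_unique[OF Metric_space_mspace_mdist]) simp
    then show ?thesis by (simp add: \<psi>_def)
  qed
  show "isometric_embedding Xc Z (extend_to_completion X Xc Z \<phi>)"
    unfolding isometric_embedding_def \<psi>_def[symmetric]
  proof (intro conjI ballI Pi_I)
    fix x assume "x \<in> mspace Xc"
    then show "\<psi> x \<in> mspace Z" using approx lim unfolding limitin_mtopology_of by blast
  next
    fix x y assume xy: "x \<in> mspace Xc" "y \<in> mspace Xc"
    obtain \<sigma> where s: "range \<sigma> \<subseteq> mspace X" "limitin (mtopology_of Xc) \<sigma> x sequentially" using approx xy by blast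
    obtain \<tau> where t: "range \<tau> \<subseteq> mspace X" "limitin (mtopology_of Xc) \<tau> y sequentially" using approx xy by blast
    have X: "\<sigma> n \<in> mspace X" "\<tau> n \<in> mspace X" for n using s t by auto
    have "(\<lambda>n. mdist Xc (\<sigma> n) (\<tau> n)) \<longlonglongrightarrow> mdist Xc x y"
      using X sub by (intro mdist_tendsto s t) auto
    moreover have "(\<lambda>n. mdist Z ((\<phi> \<circ> \<sigma>) n) ((\<phi> \<circ> \<tau>) n)) \<longlonglongrightarrow> mdist Z (\<psi> x) (\<psi> y)"
      using X \<phi>Z by (intro mdist_tendsto lim s t) auto
    ultimately show "mdist Z (\<psi> x) (\<psi> y) = mdist Xc x y"
      using d\<phi>[OF X] LIMSEQ_unique by simp
  qed
qed

lemma isometric_embedding_inj: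
  assumes \<phi>: "isometric_embedding X Z \<phi>" shows "inj_on \<phi> (mspace X)"
proof (rule inj_onI)
  fix x y assume xy: "x \<in> mspace X" "y \<in> mspace X" "\<phi> x = \<phi> y"
  have "mdist Z (\<phi> x) (\<phi> y) = mdist X x y" using \<phi> xy(1,2) unfolding isometric_embedding_def by blast
  then have "mdist X x y = mdist Z (\<phi> x) (\<phi> y)" by (rule sym)
  also have "\<dots> = 0" unfolding xy(3) using \<phi> xy(2) by (intro mdist_self) (auto simp: isometric_embedding_def)
  finally show "x = y" using xy by simp
qed

lemma measurable_metric_borelI:
  assumes "f \<in> space M \<rightarrow> mspace Y" "\<And>U. openin (mtopology_of Y) U \<Longrightarrow> f -` U \<inter> space M \<in> sets M"
  shows "f \<in> measurable M (metric_borel Y)"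
  unfolding metric_borel_def using assms openin_subset[of "mtopology_of Y"]
  by (intro measurable_measure_of) auto

lemma lipschitz_bound_isometric:
  assumes "isometric_embedding X Z \<psi>" "lipschitz_bound Z L f"
  shows "lipschitz_bound X L (f \<circ> \<psi>)"
  unfolding lipschitz_bound_def comp_apply
proof (intro conjI ballI)
  show "0 \<le> L" using assms(2) by (simp add: lipschitz_bound_def)
  fix x y assume xy: "x \<in> mspace X" "y \<in> mspace X"
  then have "\<psi> x \<in> mspace Z" "\<psi> y \<in> mspace Z" "mdist Z (\<psi> x) (\<psi> y) = mdist X x y"
    using assms(1) by (auto simp: isometric_embedding_def)
  then show "\<bar>f (\<psi> x) - f (\<psi> y)\<bar> \<le> L * mdist X x y"
    using assms(2) unfolding lipschitz_bound_def by metis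
qed

lemma bounded_lipschitz_isometric:
  assumes \<psi>: "isometric_embedding X Z \<psi>" and f: "bounded_lipschitz Z f"
  shows "bounded_lipschitz X (f \<circ> \<psi>)"
proof -
  obtain L M where L: "lipschitz_bound Z L f" and M: "\<forall>x\<in>mspace Z. \<bar>f x\<bar> \<le> M" using f by (rule bounded_lipschitzE)
  show ?thesis
    by (rule bounded_lipschitzI[OF lipschitz_bound_isometric[OF \<psi> L], of M])
       (use \<psi> M in \<open>auto simp: isometric_embedding_def\<close>)
qed

lemma isometric_measurable:
  assumes \<psi>: "isometric_embedding X Z \<psi>"
  shows "\<psi> \<in> measurable (metric_borel X) (metric_borel Z)"
proof (rule measurable_metric_borelI)
  show "\<psi> \<in> space (metric_borel X) \<rightarrow> mspace Z" using \<psi> by (simp add: isometric_embedding_def)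
  fix U assume U: "openin (mtopology_of Z) U"
  have "Lipschitz_continuous_map X Z \<psi>"
    using \<psi> unfolding Lipschitz_continuous_map_def isometric_embedding_def by (auto intro!: exI[of _ 1])
  then have "continuous_map (mtopology_of X) (mtopology_of Z) \<psi>"
    by (intro Cauchy_continuous_imp_continuous_map Lipschitz_imp_Cauchy_continuous_map)
  from openin_continuous_map_preimage[OF this U]
  have "openin (mtopology_of X) {x \<in> mspace X. \<psi> x \<in> U}" by simp
  moreover have "{x \<in> mspace X. \<psi> x \<in> U} = \<psi> -` U \<inter> space (metric_borel X)" by auto
  ultimately show "\<psi> -` U \<inter> space (metric_borel X) \<in> sets (metric_borel X)" using open_metric_borel by metis
qed

lemma isometric_image_closed:
  assumes \<psi>: "isometric_embedding X Z \<psi>" and X: "mcomplete_of X"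
  shows "openin (mtopology_of Z) (mspace Z - \<psi> ` mspace X)"
proof -
  have \<psi>Z: "\<psi> x \<in> mspace Z" if "x \<in> mspace X" for x using \<psi> that by (auto simp: isometric_embedding_def)
  have d: "mdist Z (\<psi> x) (\<psi> y) = mdist X x y" if "x \<in> mspace X" "y \<in> mspace X" for x y
    using \<psi> that by (auto simp: isometric_embedding_def)
  have "closedin (mtopology_of Z) (\<psi> ` mspace X)"
    unfolding mtopology_of_def Metric_space.metric_closedin_iff_sequentially_closed[OF Metric_space_mspace_mdist]
  proof (intro conjI allI impI)
    show "\<psi> ` mspace X \<subseteq> mspace Z" using \<psi>Z by auto
    fix \<sigma> l assume \<sigma>: "range \<sigma> \<subseteq> \<psi> ` mspace X \<and> limitin (Metric_space.mtopology (mspace Z) (mdist Z)) \<sigma> l sequentially"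
    then have "\<forall>n. \<exists>x. x \<in> mspace X \<and> \<sigma> n = \<psi> x" by blast
    then obtain \<tau> where \<tau>: "\<And>n. \<tau> n \<in> mspace X" "\<And>n. \<sigma> n = \<psi> (\<tau> n)" by metis
    have "Metric_space.MCauchy (mspace Z) (mdist Z) \<sigma>"
      using \<sigma> \<psi>Z by (intro Metric_space.convergent_imp_MCauchy[OF Metric_space_mspace_mdist]) auto
    then have "Metric_space.MCauchy (mspace X) (mdist X) \<tau>"
      unfolding Metric_space.MCauchy_def[OF Metric_space_mspace_mdist] using \<tau> d by auto
    then obtain x where "limitin (Metric_space.mtopology (mspace X) (mdist X)) \<tau> x sequentially"
      using X unfolding mcomplete_of_def Metric_space.mcomplete_def[OF Metric_space_mspace_mdist] by blast
    then have x: "x \<in> mspace X" "(\<lambda>n. mdist X (\<tau> n) x) \<longlonglongrightarrow> 0"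
      unfolding Metric_space.limitin_metric_dist_null[OF Metric_space_mspace_mdist] by auto
    then have "limitin (Metric_space.mtopology (mspace Z) (mdist Z)) \<sigma> (\<psi> x) sequentially"
      unfolding Metric_space.limitin_metric_dist_null[OF Metric_space_mspace_mdist]
      using \<tau> d \<psi>Z by simp
    then have "l = \<psi> x"
      using \<sigma> Metric_space.limitin_metric_unique[OF Metric_space_mspace_mdist] trivial_limit_sequentially by metis
    then show "l \<in> \<psi> ` mspace X" using x by blast
  qed
  then show ?thesis by (simp add: closedin_def)
qed

text \<open>
  The inverse is continuous on the image: a ball around a point of an open set \<open>U\<close> of
  \<open>X\<close> is matched by the ball of the same radius in \<open>Z\<close>.
\<close>

lemma isometric_inverse_measurable:
  assumes \<psi>: "isometric_embedding X Z \<psi>" and M: "sets M = sets (metric_borel Z)"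
  shows "inv_into (mspace X) \<psi> \<in> measurable (restrict_space M (\<psi> ` mspace X)) (metric_borel X)"
proof (rule measurable_metric_borelI)
  let ?S = "\<psi> ` mspace X" and ?\<theta> = "inv_into (mspace X) \<psi>"
  have \<psi>Z: "\<psi> x \<in> mspace Z" if "x \<in> mspace X" for x using \<psi> that by (auto simp: isometric_embedding_def)
  have d: "mdist Z (\<psi> x) (\<psi> y) = mdist X x y" if "x \<in> mspace X" "y \<in> mspace X" for x y
    using \<psi> that by (auto simp: isometric_embedding_def)
  have inj: "inj_on \<psi> (mspace X)" by (rule isometric_embedding_inj[OF \<psi>])
  have sp: "space M = mspace Z" using sets_eq_imp_space_eq[OF M] by simp
  have S: "space (restrict_space M ?S) = ?S" using sp \<psi>Z by (auto simp: space_restrict_space)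
  show "?\<theta> \<in> space (restrict_space M ?S) \<rightarrow> mspace X" unfolding S by (auto intro: inv_into_into)
  fix U assume U: "openin (mtopology_of X) U"
  define O' where "O' = (\<Union>{mball_of Z (\<psi> x) r | x r. x \<in> U \<and> mball_of X x r \<subseteq> U})"
  have "openin (mtopology_of Z) O'" unfolding O'_def
    by (intro openin_Union) (auto simp: mtopology_of_def mball_of_def Metric_space.openin_mball[OF Metric_space_mspace_mdist])
  then have O'M: "O' \<in> sets M" using M open_metric_borel by simp
  have UX: "U \<subseteq> mspace X" using openin_subset[OF U] by simp
  have "?\<theta> -` U \<inter> ?S = ?S \<inter> O'"
  proof (intro equalityI subsetI)
    fix z assume z: "z \<in> ?\<theta> -` U \<inter> ?S"
    then obtain x where x: "x \<in> mspace X" "z = \<psi> x" by blast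
    then have "x \<in> U" using z inj by simp
    then obtain r where r: "r > 0" "mball_of X x r \<subseteq> U"
      using U Metric_space.openin_mtopology[OF Metric_space_mspace_mdist] unfolding mtopology_of_def mball_of_def by metis
    have "z \<in> mball_of Z (\<psi> x) r" using x \<psi>Z r by simp
    then show "z \<in> ?S \<inter> O'" using x r \<open>x \<in> U\<close> unfolding O'_def by blast
  next
    fix z assume z: "z \<in> ?S \<inter> O'"
    then obtain y where y: "y \<in> mspace X" "z = \<psi> y" by blast
    obtain x r where x: "x \<in> U" "mball_of X x r \<subseteq> U" "z \<in> mball_of Z (\<psi> x) r" using z unfolding O'_def by blast
    then have "y \<in> mball_of X x r" using y UX d[of x y] by auto
    then have "y \<in> U" using x by blast
    then show "z \<in> ?\<theta> -` U \<inter> ?S" using y inj by simp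
  qed
  moreover have "?S \<inter> O' \<in> sets (restrict_space M ?S)" using O'M by (auto simp: sets_restrict_space)
  ultimately show "?\<theta> -` U \<inter> space (restrict_space M ?S) \<in> sets (restrict_space M ?S)" unfolding S by simp
qed

section \<open>Push-forward under isometric embeddings\<close>

lemma metric_currentD:
  assumes "metric_current m Y T"
  shows "linear_on_forms m Y T" "finite_mass m Y T"
    "minimal_control m Y T (mass_measure m Y T)"
    "finite_borel_measure Y (mass_measure m Y T)"
proof -
  show 1: "linear_on_forms m Y T" using assms unfolding metric_current_def multilinear_def linear_on_forms_def by (elim conjE)
  show 2: "finite_mass m Y T" using assms unfolding metric_current_def by (elim conjE)
  show "minimal_control m Y T (mass_measure m Y T)" by (rule minimal_control_mass_measure[OF 1 2])
  then show "finite_borel_measure Y (mass_measure m Y T)" by (rule minimal_controlD(2))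
qed

text \<open>
  Functions are total, so two of them may represent the same function on the space. In the first
  argument the difference is seen by no measure on the space; in the others continuity along a
  constant sequence identifies the values.
\<close>

lemma current_cong:
  assumes T: "metric_current m Y T" and f: "bounded_lipschitz Y f" "bounded_lipschitz Y f'"
    and ps: "unit_tuple m Y ps" "unit_tuple m Y ps'"
    and ff: "\<And>x. x \<in> mspace Y \<Longrightarrow> f x = f' x"
    and pp: "\<And>i x. i < m \<Longrightarrow> x \<in> mspace Y \<Longrightarrow> (ps ! i) x = (ps' ! i) x"
  shows "T f ps = T f' ps'"
proof -
  note D = metric_currentD[OF T]
  note s = finite_borel_measureD[OF D(4)]
  have "T (\<lambda>x. 1 * f x + (-1) * f' x) ps = 1 * T f ps + (-1) * T f' ps"
    using D(1) unit_tuple_form[OF ps(1) f(1)] unit_tuple_form[OF ps(1) f(2)]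
    unfolding linear_on_forms_def by blast
  then have "T f ps - T f' ps = T (\<lambda>x. 1 * f x + (-1) * f' x) ps" by linarith
  also have "\<bar>\<dots>\<bar> \<le> (LINT x|mass_measure m Y T. \<bar>1 * f x + (-1) * f' x\<bar>)"
    using minimal_controlD(1)[OF D(3)] bounded_lipschitz_lincomb[OF f] ps(1) unfolding controls_iff by blast
  also have "\<dots> = (LINT x|mass_measure m Y T. 0)"
    using ff s by (intro Bochner_Integration.integral_cong) auto
  finally have 1: "T f ps = T f' ps" by simp
  have "(\<lambda>n::nat. T f' ps) \<longlonglongrightarrow> T f' ps'"
  proof -
    have c: "continuous_current m Y T" using T unfolding metric_current_def by (elim conjE)
    show ?thesis
      by (rule iffD1[OF continuous_current_def c, rule_format, where qs="\<lambda>_. ps" and L=1])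
         (use unit_tuple_form[OF ps(2) f(2)] ps(1) pp in \<open>auto simp: unit_tuple_def\<close>)
  qed
  then have "T f' ps = T f' ps'" by (simp add: LIMSEQ_const_iff)
  then show ?thesis using 1 by simp
qed

lemma unit_tuple_pushforward:
  assumes "isometric_embedding X Z \<psi>" "unit_tuple m Z ps"
  shows "unit_tuple m X (map (\<lambda>p. p \<circ> \<psi>) ps)"
  using assms unfolding unit_tuple_def by (auto intro: lipschitz_bound_isometric simp del: comp_apply)

lemma lipschitz_fun_isometric:
  assumes "isometric_embedding X Z \<psi>" "lipschitz_fun Z p" shows "lipschitz_fun X (p \<circ> \<psi>)"
  using assms(2) by (rule lipschitz_funE) (rule lipschitz_funI[OF lipschitz_bound_isometric[OF assms(1)]])

lemma form_pushforward:
  assumes "isometric_embedding X Z \<psi>" "form m Z f ps"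
  shows "form m X (f \<circ> \<psi>) (map (\<lambda>p. p \<circ> \<psi>) ps)"
  using assms(2) bounded_lipschitz_isometric[OF assms(1)] lipschitz_fun_isometric[OF assms(1)]
  unfolding form_def by auto

lemma linear_on_forms_pushforward:
  assumes \<psi>: "isometric_embedding X Z \<psi>" and T: "linear_on_forms m X T"
  shows "linear_on_forms m Z (pushforward \<psi> T)"
  unfolding linear_on_forms_def
proof (intro allI impI)
  fix f g ps a b assume "form m Z f ps" "form m Z g ps"
  then have "form m X (f \<circ> \<psi>) (map (\<lambda>p. p \<circ> \<psi>) ps)" "form m X (g \<circ> \<psi>) (map (\<lambda>p. p \<circ> \<psi>) ps)"
    using form_pushforward[OF \<psi>] by auto
  then have "T (\<lambda>x. a * (f \<circ> \<psi>) x + b * (g \<circ> \<psi>) x) (map (\<lambda>p. p \<circ> \<psi>) ps)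
     = a * T (f \<circ> \<psi>) (map (\<lambda>p. p \<circ> \<psi>) ps) + b * T (g \<circ> \<psi>) (map (\<lambda>p. p \<circ> \<psi>) ps)"
    using T unfolding linear_on_forms_def by blast
  then show "pushforward \<psi> T (\<lambda>x. a * f x + b * g x) ps = a * pushforward \<psi> T f ps + b * pushforward \<psi> T g ps"
    by (simp add: pushforward_def comp_def)
qed

text \<open>
  To see that a measure \<open>\<nu>\<close> controlling the push-forward dominates the image of
  the mass measure, extend the functions on \<open>X\<close> to \<open>Z\<close> by McShane's
  formula. Multiplying the first one by cutoffs that decrease to the indicator of the closed image
  of \<open>X\<close> changes nothing on \<open>X\<close>, and in the limit shows that the part of
  \<open>\<nu>\<close> on the image, pulled back to \<open>X\<close>, controls \<open>T\<close>.
\<close>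

lemma minimal_control_pushforward:
  assumes T: "metric_current m X T" and X: "mcomplete_of X" and \<psi>: "isometric_embedding X Z \<psi>"
  shows "minimal_control m Z (pushforward \<psi> T) (distr (mass_measure m X T) (metric_borel Z) \<psi>)"
proof -
  define \<kappa> where "\<kappa> = mass_measure m X T"
  have \<kappa>: "minimal_control m X T \<kappa>" "finite_borel_measure X \<kappa>" using metric_currentD[OF T] by (auto simp: \<kappa>_def)
  note s\<kappa> = finite_borel_measureD[OF \<kappa>(2)]
  interpret k: finite_measure \<kappa> by (rule s\<kappa>)
  have \<psi>m: "\<psi> \<in> measurable \<kappa> (metric_borel Z)" using isometric_measurable[OF \<psi>] s\<kappa> by (simp cong: measurable_cong_sets)
  have \<psi>Z: "\<psi> x \<in> mspace Z" if "x \<in> mspace X" for x using \<psi> that by (auto simp: isometric_embedding_def)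
  have d: "mdist Z (\<psi> x) (\<psi> y) = mdist X x y" if "x \<in> mspace X" "y \<in> mspace X" for x y
    using \<psi> that by (auto simp: isometric_embedding_def)
  define S where "S = \<psi> ` mspace X"
  define \<theta> where "\<theta> = inv_into (mspace X) \<psi>"
  have inj: "inj_on \<psi> (mspace X)" by (rule isometric_embedding_inj[OF \<psi>])
  have \<theta>: "\<theta> (\<psi> x) = x" if "x \<in> mspace X" for x unfolding \<theta>_def using inj that by (rule inv_into_f_f)
  have SZ: "S \<subseteq> mspace Z" using \<psi>Z by (auto simp: S_def)
  have "controls m Z (pushforward \<psi> T) (distr \<kappa> (metric_borel Z) \<psi>)"
    unfolding controls_iff
  proof (intro conjI allI impI)
    have "finite_measure (distr \<kappa> (metric_borel Z) \<psi>)" by (rule k.finite_measure_distr[OF \<psi>m])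
    then show "finite_borel_measure Z (distr \<kappa> (metric_borel Z) \<psi>)" by (simp add: finite_borel_measure_def)
    fix f ps assume f: "bounded_lipschitz Z f" and ps: "unit_tuple m Z ps"
    have "\<bar>pushforward \<psi> T f ps\<bar> \<le> (LINT x|\<kappa>. \<bar>(f \<circ> \<psi>) x\<bar>)"
      unfolding pushforward_def
      using minimal_controlD(1)[OF \<kappa>(1)] bounded_lipschitz_isometric[OF \<psi> f] unit_tuple_pushforward[OF \<psi> ps]
      unfolding controls_iff by blast
    also have "\<dots> = (LINT z|distr \<kappa> (metric_borel Z) \<psi>. \<bar>f z\<bar>)"
      using lipschitz_measurable[OF bounded_lipschitz_imp_lipschitz[OF f]]
      by (subst integral_distr[OF \<psi>m]) auto
    finally show "\<bar>pushforward \<psi> T f ps\<bar> \<le> (LINT z|distr \<kappa> (metric_borel Z) \<psi>. \<bar>f z\<bar>)" .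
  qed
  moreover have "emeasure (distr \<kappa> (metric_borel Z) \<psi>) B \<le> emeasure \<nu> B"
    if \<nu>: "controls m Z (pushforward \<psi> T) \<nu>" and B: "B \<in> sets (metric_borel Z)" for \<nu> B
  proof -
    have \<nu>f: "finite_borel_measure Z \<nu>" by (rule controls_finite_borel[OF \<nu>])
    note s\<nu> = finite_borel_measureD[OF \<nu>f]
    interpret n: finite_measure \<nu> by (rule s\<nu>)
    have opS: "openin (mtopology_of Z) (mspace Z - S)" unfolding S_def by (rule isometric_image_closed[OF \<psi> X])
    have "mspace Z - S \<in> sets \<nu>" using open_metric_borel[OF opS] s\<nu> by simp
    then have "space \<nu> - (mspace Z - S) \<in> sets \<nu>" by (rule sets.compl_sets)
    then have S\<nu>: "S \<in> sets \<nu>" using SZ s\<nu> by (simp add: double_diff)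
    define \<nu>S where "\<nu>S = restrict_space \<nu> S"
    define \<nu>' where "\<nu>' = distr \<nu>S (metric_borel X) \<theta>"
    have \<theta>m: "\<theta> \<in> measurable \<nu>S (metric_borel X)"
      unfolding \<theta>_def \<nu>S_def S_def using s\<nu> by (intro isometric_inverse_measurable[OF \<psi>]) simp
    have spS: "space \<nu>S = S" using SZ s\<nu> by (auto simp: \<nu>S_def space_restrict_space)
    have "finite_measure \<nu>S" unfolding \<nu>S_def using S\<nu>
      by (intro finite_measure_restrict_space s\<nu>) simp
    then have \<nu>'f: "finite_borel_measure X \<nu>'"
      using finite_measure.finite_measure_distr[OF _ \<theta>m] by (simp add: finite_borel_measure_def \<nu>'_def)
    obtain \<eta> :: "nat \<Rightarrow> _ \<Rightarrow> real" where \<eta>: "\<And>k. bounded_lipschitz Z (\<eta> k)"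
      "\<And>k x. 0 \<le> \<eta> k x" "\<And>k x. \<eta> k x \<le> 1"
      "\<And>k x. x \<in> mspace Z - (mspace Z - S) \<Longrightarrow> \<eta> k x = 0" "\<And>x. x \<in> mspace Z - S \<Longrightarrow> (\<lambda>k. \<eta> k x) \<longlonglongrightarrow> 1"
      using open_cutoff[OF opS] by blast
    have "controls m X T \<nu>'"
      unfolding controls_iff
    proof (intro conjI allI impI \<nu>'f)
      fix f ps assume f: "bounded_lipschitz X f" and ps: "unit_tuple m X ps"
      obtain L M where L: "lipschitz_bound X L f" and M: "\<forall>x\<in>mspace X. \<bar>f x\<bar> \<le> M" using f by (rule bounded_lipschitzE)
      define E where "E K p = mcshane Z S K (p \<circ> \<theta>)" for K p
      have E: "lipschitz_bound Z K (E K p)" "\<And>x. x \<in> mspace X \<Longrightarrow> E K p (\<psi> x) = p x"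
        if p: "lipschitz_bound X K p" for K p
      proof -
        have K0: "0 \<le> K" using p by (simp add: lipschitz_bound_def)
        have K: "\<bar>(p \<circ> \<theta>) x - (p \<circ> \<theta>) y\<bar> \<le> K * mdist Z x y" if "x \<in> S" "y \<in> S" for x y
          using that p \<theta> d unfolding S_def lipschitz_bound_def by auto
        show "lipschitz_bound Z K (E K p)" unfolding E_def by (rule mcshane_lipschitz[OF SZ K0 K])
        fix x assume x: "x \<in> mspace X"
        then have xS: "\<psi> x \<in> S" by (simp add: S_def)
        have "E K p (\<psi> x) = (p \<circ> \<theta>) (\<psi> x)" unfolding E_def
          by (rule mcshane_extends[OF SZ K0 _ xS]) (rule K)
        then show "E K p (\<psi> x) = p x" using \<theta>[OF x] by simp
      qed
      define M' where "M' = \<bar>M\<bar>"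
      define fe where "fe z = clip M' (E L f z)" for z
      have fe: "bounded_lipschitz Z fe" unfolding fe_def
        by (rule bounded_lipschitz_clip[OF lipschitz_funI[OF E(1)[OF L]]]) (simp add: M'_def)
      have fe\<psi>: "fe (\<psi> x) = f x" if "x \<in> mspace X" for x
        unfolding fe_def E(2)[OF L that] using M that by (intro clip_id) (auto simp: M'_def intro: order_trans[OF _ abs_ge_self])
      define pe where "pe = map (E 1) ps"
      have ps1: "lipschitz_bound X 1 (ps ! i)" if "i < m" for i using ps that by (auto simp: unit_tuple_def)
      have pe: "unit_tuple m Z pe" using ps E(1) by (auto simp: pe_def unit_tuple_def)
      define F where "F k z = fe z * (1 - \<eta> k z)" for k z
      have F: "bounded_lipschitz Z (F k)" for k unfolding F_def
        by (intro bounded_lipschitz_mult fe bounded_lipschitz_diff bounded_lipschitz_const \<eta>(1))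
      have le: "\<bar>T f ps\<bar> \<le> (LINT z|\<nu>. \<bar>F k z\<bar>)" for k
      proof -
        have "T f ps = T (F k \<circ> \<psi>) (map (\<lambda>p. p \<circ> \<psi>) pe)"
        proof (rule current_cong[OF T f bounded_lipschitz_isometric[OF \<psi> F] ps unit_tuple_pushforward[OF \<psi> pe]])
          fix x assume x: "x \<in> mspace X"
          then have "\<eta> k (\<psi> x) = 0" using \<psi>Z by (intro \<eta>(4)) (simp add: S_def)
          then show "f x = (F k \<circ> \<psi>) x" using fe\<psi>[OF x] by (simp add: F_def)
        next
          fix i x assume i: "i < m" and x: "x \<in> mspace X"
          then have "map (\<lambda>p. p \<circ> \<psi>) pe ! i = E 1 (ps ! i) \<circ> \<psi>" using ps by (simp add: pe_def unit_tuple_def)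
          then show "(ps ! i) x = (map (\<lambda>p. p \<circ> \<psi>) pe ! i) x" using E(2)[OF ps1[OF i] x] by simp
        qed
        then have "T f ps = pushforward \<psi> T (F k) pe" by (simp add: pushforward_def)
        then show ?thesis using \<nu> F pe unfolding controls_iff by simp
      qed
      have "(\<lambda>k. LINT z|\<nu>. \<bar>F k z\<bar>) \<longlonglongrightarrow> (LINT z|\<nu>. indicator S z *\<^sub>R \<bar>fe z\<bar>)"
      proof (rule integral_dominated_convergence[where w="\<lambda>z. \<bar>fe z\<bar>"])
        show "AE z in \<nu>. (\<lambda>k. \<bar>F k z\<bar>) \<longlonglongrightarrow> indicator S z *\<^sub>R \<bar>fe z\<bar>"
        proof (rule AE_I2)
          fix z assume z: "z \<in> space \<nu>"
          show "(\<lambda>k. \<bar>F k z\<bar>) \<longlonglongrightarrow> indicator S z *\<^sub>R \<bar>fe z\<bar>"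
          proof (cases "z \<in> S")
            case True
            then have "\<eta> k z = 0" for k using SZ by (intro \<eta>(4)) auto
            then show ?thesis using True by (simp add: F_def)
          next
            case False
            have "(\<lambda>k. \<bar>F k z\<bar>) \<longlonglongrightarrow> \<bar>fe z * (1 - 1)\<bar>"
              unfolding F_def using False z s\<nu> by (intro tendsto_intros \<eta>(5)) simp
            then show ?thesis using False by simp
          qed
        qed
        show "AE z in \<nu>. norm \<bar>F k z\<bar> \<le> \<bar>fe z\<bar>" for k
        proof (rule AE_I2)
          fix z
          have "\<bar>fe z\<bar> * \<bar>1 - \<eta> k z\<bar> \<le> \<bar>fe z\<bar> * 1" using \<eta>(2,3)[of k z] by (intro mult_left_mono) auto
          then show "norm \<bar>F k z\<bar> \<le> \<bar>fe z\<bar>" by (simp add: F_def abs_mult)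
        qed
        show "(\<lambda>z. indicator S z *\<^sub>R \<bar>fe z\<bar>) \<in> borel_measurable \<nu>"
          using S\<nu> borel_measurable_integrable[OF integrable_bounded_lipschitz[OF \<nu>f fe]] by measurable
      qed (use integrable_bounded_lipschitz[OF \<nu>f fe] integrable_bounded_lipschitz[OF \<nu>f F] in \<open>auto\<close>)
      then have "\<bar>T f ps\<bar> \<le> (LINT z|\<nu>. indicator S z *\<^sub>R \<bar>fe z\<bar>)"
        by (rule LIMSEQ_le_const) (use le in blast)
      also have "\<dots> = (LINT z|\<nu>S. \<bar>fe z\<bar>)"
        unfolding \<nu>S_def using S\<nu> by (intro integral_restrict_space[symmetric]) simp
      also have "\<dots> = (LINT z|\<nu>S. \<bar>f (\<theta> z)\<bar>)"
      proof (rule Bochner_Integration.integral_cong[OF refl])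
        fix z assume "z \<in> space \<nu>S"
        then obtain x where "x \<in> mspace X" "z = \<psi> x" unfolding spS S_def by blast
        then show "\<bar>fe z\<bar> = \<bar>f (\<theta> z)\<bar>" using fe\<psi> \<theta> by simp
      qed
      also have "\<dots> = (LINT x|\<nu>'. \<bar>f x\<bar>)"
        unfolding \<nu>'_def using lipschitz_measurable[OF bounded_lipschitz_imp_lipschitz[OF f]]
        by (subst integral_distr[OF \<theta>m]) auto
      finally show "\<bar>T f ps\<bar> \<le> (LINT x|\<nu>'. \<bar>f x\<bar>)" .
    qed
    define P where "P = \<psi> -` B \<inter> mspace X"
    have P: "P \<in> sets (metric_borel X)" unfolding P_def using measurable_sets[OF isometric_measurable[OF \<psi>] B] by simp
    have "emeasure (distr \<kappa> (metric_borel Z) \<psi>) B = emeasure \<kappa> P"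
      using B s\<kappa> by (subst emeasure_distr[OF \<psi>m]) (auto simp: P_def)
    also have "\<dots> \<le> emeasure \<nu>' P" by (rule minimal_controlD(3)[OF \<kappa>(1) \<open>controls m X T \<nu>'\<close> P])
    also have "\<dots> = emeasure \<nu>S (\<theta> -` P \<inter> S)" unfolding \<nu>'_def using P by (simp add: emeasure_distr[OF \<theta>m] spS)
    also have "\<dots> = emeasure \<nu> (\<theta> -` P \<inter> S)"
      unfolding \<nu>S_def using S\<nu> by (intro emeasure_restrict_space) auto
    also have "\<dots> \<le> emeasure \<nu> B"
      using B s\<nu> \<theta> by (intro emeasure_mono) (auto simp: P_def S_def)
    finally show ?thesis .
  qed
  ultimately show ?thesis unfolding minimal_control_def \<kappa>_def by blast
qed

section \<open>Flat convergence\<close>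

lemma unit_tuple_Cons:
  assumes "unit_tuple m Y ps" "lipschitz_bound Y 1 g" shows "unit_tuple (m + 1) Y (g # ps)"
  using assms by (auto simp: unit_tuple_def)

lemma metric_current_bound:
  assumes T: "metric_current m Y T" and ps: "unit_tuple m Y ps"
    and f: "bounded_lipschitz Y f" "\<And>x. x \<in> mspace Y \<Longrightarrow> \<bar>f x\<bar> \<le> M"
  shows "\<bar>T f ps\<bar> \<le> M * mass m Y T"
proof -
  note D = metric_currentD[OF T]
  note s = finite_borel_measureD[OF D(4)]
  interpret finite_measure "mass_measure m Y T" by (rule s)
  have "\<bar>T f ps\<bar> \<le> (LINT x|mass_measure m Y T. \<bar>f x\<bar>)"
    using minimal_controlD(1)[OF D(3)] f ps unfolding controls_iff by blast
  also have "\<dots> \<le> (LINT x|mass_measure m Y T. M)"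
    using integrable_bounded_lipschitz[OF D(4) f(1)] f(2) s by (intro integral_mono) auto
  also have "\<dots> = M * mass m Y T" using s by (simp add: mass_def)
  finally show ?thesis .
qed

text \<open>
  The first function of a boundary is bounded through its Lipschitz constant, since it becomes one
  of the differentiated functions.
\<close>

lemma boundary_bound:
  assumes B: "metric_current (m + 1) Y B" and ps: "unit_tuple m Y ps"
    and f: "lipschitz_bound Y L f" and L: "0 < L"
  shows "\<bar>boundary B f ps\<bar> \<le> L * mass (m + 1) Y B"
proof -
  \<comment> \<open>The vanishing summand brings \<open>g\<close> into the form in which multilinearity is stated.\<close>
  define g where "g x = inverse L * f x + 0 * f x" for x
  have "lipschitz_bound Y (\<bar>inverse L\<bar> * L + \<bar>0\<bar> * L) g" unfolding g_def
    by (intro lipschitz_bound_add lipschitz_bound_scale f)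
  then have g: "lipschitz_bound Y 1 g" using L by simp
  have one: "bounded_lipschitz Y (\<lambda>_. 1)" by (rule bounded_lipschitz_const)
  have ugp: "unit_tuple (m + 1) Y (g # ps)" by (rule unit_tuple_Cons[OF ps g])
  have ml: "multilinear (m + 1) Y B" using B unfolding metric_current_def by (elim conjE)
  have "B (\<lambda>_. 1) ((g # ps)[0 := (\<lambda>x. L * g x + 0 * g x)])
      = L * B (\<lambda>_. 1) ((g # ps)[0 := g]) + 0 * B (\<lambda>_. 1) ((g # ps)[0 := g])"
    by (rule conjunct2[OF iffD1[OF multilinear_def ml], rule_format])
       (use unit_tuple_form[OF ugp one] lipschitz_funI[OF g] in auto)
  moreover have "(\<lambda>x. L * g x + 0 * g x) = f" using L by (auto simp: g_def)
  ultimately have "boundary B f ps = L * B (\<lambda>_. 1) (g # ps)" by (simp add: boundary_def)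
  moreover have "\<bar>B (\<lambda>_. 1) (g # ps)\<bar> \<le> 1 * mass (m + 1) Y B"
    by (rule metric_current_bound[OF B ugp one]) simp
  ultimately show ?thesis using L by (simp add: abs_mult)
qed

lemma integral_current_metric: "integral_current m Y T \<Longrightarrow> metric_current m Y T"
  by (simp add: integral_current_def integer_rectifiable_def)

lemma flat_limit_on_forms:
  assumes lim: "(\<lambda>j. flat_dist m Z (S j) S') \<longlonglongrightarrow> 0"
    and f: "bounded_lipschitz Z f" and ps: "unit_tuple m Z ps"
  shows "(\<lambda>j. S j f ps) \<longlonglongrightarrow> S' f ps"
proof (rule metric_LIMSEQ_I)
  fix e :: real assume e: "e > 0"
  obtain L0 M0 where L0: "lipschitz_bound Z L0 f" and M0: "\<forall>x\<in>mspace Z. \<bar>f x\<bar> \<le> M0" using f by (rule bounded_lipschitzE)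
  \<comment> \<open>One positive number that bounds both \<open>f\<close> and its Lipschitz constant.\<close>
  define L where "L = \<bar>L0\<bar> + \<bar>M0\<bar> + 1"
  have L: "lipschitz_bound Z L f" by (rule lipschitz_bound_mono[OF L0]) (simp add: L_def)
  have M: "\<bar>f x\<bar> \<le> L" if "x \<in> mspace Z" for x using M0 that unfolding L_def by fastforce
  have Lp: "L > 0" unfolding L_def by linarith
  have "0 < ennreal (e / L)" using e Lp by simp
  from order_tendstoD(2)[OF lim this]
  have ev: "\<forall>\<^sub>F j in sequentially. dist (S j f ps) (S' f ps) < e"
  proof eventually_elim
    case (elim j)
    then obtain A B where AB: "ennreal (mass m Z A + mass (m + 1) Z B) < ennreal (e / L)"
      "integral_current m Z A" "integral_current (m + 1) Z B"
      "\<forall>f ps. form m Z f ps \<longrightarrow> S' f ps - S j f ps = A f ps + boundary B f ps"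
      unfolding flat_dist_def Inf_less_iff by blast
    have nn: "0 \<le> mass m Z A" "0 \<le> mass (m + 1) Z B" by (simp_all add: mass_def)
    have AB1: "mass m Z A + mass (m + 1) Z B < e / L" using AB(1) nn by (simp add: ennreal_less_iff del: ennreal_plus)
    have "S' f ps - S j f ps = A f ps + boundary B f ps" using AB(4) unit_tuple_form[OF ps f] by blast
    moreover have "\<bar>A f ps\<bar> \<le> L * mass m Z A"
      by (rule metric_current_bound[OF integral_current_metric[OF AB(2)] ps f M])
    moreover have "\<bar>boundary B f ps\<bar> \<le> L * mass (m + 1) Z B"
      by (rule boundary_bound[OF integral_current_metric[OF AB(3)] ps L Lp])
    ultimately have "\<bar>S' f ps - S j f ps\<bar> \<le> L * (mass m Z A + mass (m + 1) Z B)"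
      unfolding distrib_left by linarith
    also have "\<dots> < e" using AB1 Lp by (simp add: pos_less_divide_eq mult.commute)
    finally show ?case by (simp add: dist_real_def abs_minus_commute)
  qed
  then show "\<exists>N. \<forall>n\<ge>N. dist (S n f ps) (S' f ps) < e" by (simp add: eventually_sequentially)
qed

section \<open>Dyadic cubes and lower density\<close>

lemma space_Rn_lebesgue [simp]: "space (Rn_lebesgue m) = {..<m} \<rightarrow>\<^sub>E UNIV"
  by (simp add: Rn_lebesgue_def space_PiM)

text \<open>
  The index of the half-open dyadic cube of side $2^{-k}$ that contains \<open>x\<close>.
\<close>

definition dyadic_cell :: "nat \<Rightarrow> nat \<Rightarrow> (nat \<Rightarrow> real) \<Rightarrow> nat \<Rightarrow> int" where
  "dyadic_cell m k x = (\<lambda>i\<in>{..<m}. \<lfloor>2 ^ k * x i\<rfloor>)"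

definition dyadic_cube :: "nat \<Rightarrow> nat \<Rightarrow> (nat \<Rightarrow> int) \<Rightarrow> (nat \<Rightarrow> real) set" where
  "dyadic_cube m k v = {x \<in> {..<m} \<rightarrow>\<^sub>E UNIV. dyadic_cell m k x = v}"

lemma dyadic_cubeD: "x \<in> dyadic_cube m k v \<Longrightarrow> dyadic_cell m k x = v"
  by (simp add: dyadic_cube_def)

lemma dyadic_cube_eq:
  assumes "v \<in> {..<m} \<rightarrow>\<^sub>E UNIV"
  shows "dyadic_cube m k v = (\<Pi>\<^sub>E i\<in>{..<m}. {real_of_int (v i) / 2 ^ k ..< (real_of_int (v i) + 1) / 2 ^ k})"
proof -
  have fl: "\<lfloor>2 ^ k * t\<rfloor> = n \<longleftrightarrow> t \<in> {of_int n / 2 ^ k ..< (of_int n + 1) / 2 ^ k}" for t :: real and n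
    by (simp add: floor_eq_iff divide_le_eq less_divide_eq mult.commute)
  show ?thesis
  proof (intro equalityI subsetI)
    fix x assume "x \<in> dyadic_cube m k v"
    then have x: "x \<in> {..<m} \<rightarrow>\<^sub>E UNIV" "dyadic_cell m k x = v" by (auto simp: dyadic_cube_def)
    have "\<lfloor>2 ^ k * x i\<rfloor> = v i" if "i < m" for i using x(2) that by (auto simp: dyadic_cell_def)
    then show "x \<in> (\<Pi>\<^sub>E i\<in>{..<m}. {real_of_int (v i) / 2 ^ k ..< (real_of_int (v i) + 1) / 2 ^ k})"
      using x(1) fl by (auto simp: PiE_iff)
  next
    fix x assume x: "x \<in> (\<Pi>\<^sub>E i\<in>{..<m}. {real_of_int (v i) / 2 ^ k ..< (real_of_int (v i) + 1) / 2 ^ k})"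
    have "\<lfloor>2 ^ k * x i\<rfloor> = v i" if "i < m" for i using x that fl[of "x i" "v i"] by (auto simp: PiE_iff)
    then have "dyadic_cell m k x = v" using assms by (auto simp: dyadic_cell_def PiE_iff extensional_def fun_eq_iff)
    then show "x \<in> dyadic_cube m k v" using x by (auto simp: dyadic_cube_def PiE_iff)
  qed
qed

lemma dyadic_cell_in: "dyadic_cell m k x \<in> {..<m} \<rightarrow>\<^sub>E UNIV"
  by (simp add: dyadic_cell_def)

lemma dyadic_cube_sets [measurable]:
  assumes "v \<in> {..<m} \<rightarrow>\<^sub>E UNIV" shows "dyadic_cube m k v \<in> sets (Rn_lebesgue m)"
  unfolding dyadic_cube_eq[OF assms] Rn_lebesgue_def by (intro sets_PiM_I_finite) auto

lemma emeasure_dyadic_cube: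
  assumes v: "v \<in> {..<m} \<rightarrow>\<^sub>E UNIV"
  shows "emeasure (Rn_lebesgue m) (dyadic_cube m k v) = ennreal ((1 / 2 ^ k) ^ m)"
proof -
  interpret product_sigma_finite "\<lambda>_::nat. lborel :: real measure" by standard
  have "emeasure (Rn_lebesgue m) (dyadic_cube m k v)
     = (\<Prod>i<m. emeasure lborel {of_int (v i) / 2 ^ k ..< (of_int (v i) + 1) / 2 ^ k :: real})"
    unfolding dyadic_cube_eq[OF v] Rn_lebesgue_def by (intro emeasure_PiM) auto
  also have "\<dots> = (\<Prod>i<m. ennreal (1 / 2 ^ k))"
  proof (rule prod.cong[OF refl])
    fix i
    have "of_int (v i) / 2 ^ k \<le> (of_int (v i) + 1) / (2 ^ k :: real)" by (intro divide_right_mono) auto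
    then show "emeasure lborel {of_int (v i) / 2 ^ k ..< (of_int (v i) + 1) / 2 ^ k :: real} = ennreal (1 / 2 ^ k)"
      by (simp add: diff_divide_distrib[symmetric])
  qed
  also have "\<dots> = ennreal ((1 / 2 ^ k) ^ m)" by (simp add: ennreal_power)
  finally show ?thesis .
qed

lemma countable_dyadic_cells: fixes m :: nat shows "countable ({..<m} \<rightarrow>\<^sub>E (UNIV :: int set))"
  by (intro countable_PiE) auto

lemma dyadic_cell_mono:
  assumes "l \<le> k" "dyadic_cell m k x = dyadic_cell m k y" shows "dyadic_cell m l x = dyadic_cell m l y"
proof -
  have fl: "\<lfloor>2 ^ l * t\<rfloor> = \<lfloor>2 ^ k * t\<rfloor> div 2 ^ (k - l)" for t :: real
  proof -
    have "\<lfloor>2 ^ l * t\<rfloor> = \<lfloor>(2 ^ k * t) / of_int (2 ^ (k - l))\<rfloor>"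
    proof -
      have "(2::real) ^ k = 2 ^ l * 2 ^ (k - l)" using assms(1) by (simp add: power_add[symmetric])
      then show ?thesis by simp
    qed
    also have "\<dots> = \<lfloor>2 ^ k * t\<rfloor> div 2 ^ (k - l)" by (rule floor_divide_real_eq_div) simp
    finally show ?thesis .
  qed
  show ?thesis
  proof (rule ext)
    fix i
    show "dyadic_cell m l x i = dyadic_cell m l y i"
    proof (cases "i < m")
      case True
      then have "\<lfloor>2 ^ k * x i\<rfloor> = \<lfloor>2 ^ k * y i\<rfloor>" using fun_cong[OF assms(2), of i] by (simp add: dyadic_cell_def)
      then show ?thesis using True by (simp add: dyadic_cell_def fl)
    qed (simp add: dyadic_cell_def)
  qed
qed

definition dyadic_union :: "nat \<Rightarrow> nat \<Rightarrow> (nat \<Rightarrow> real) set \<Rightarrow> bool" where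
  "dyadic_union m k S \<longleftrightarrow> S \<subseteq> {..<m} \<rightarrow>\<^sub>E UNIV \<and>
     (\<forall>x\<in>S. \<forall>y\<in>{..<m} \<rightarrow>\<^sub>E UNIV. dyadic_cell m k x = dyadic_cell m k y \<longrightarrow> y \<in> S)"

lemma dyadic_union_Collect:
  "dyadic_union m k {x \<in> {..<m} \<rightarrow>\<^sub>E UNIV. P (dyadic_cell m k x)}"
  unfolding dyadic_union_def
proof (intro conjI ballI impI)
  fix x y assume "x \<in> {x \<in> {..<m} \<rightarrow>\<^sub>E UNIV. P (dyadic_cell m k x)}" "y \<in> {..<m} \<rightarrow>\<^sub>E (UNIV :: real set)"
    "dyadic_cell m k x = dyadic_cell m k y"
  then show "y \<in> {x \<in> {..<m} \<rightarrow>\<^sub>E UNIV. P (dyadic_cell m k x)}" by simp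
qed (rule subsetI, simp)

lemma dyadic_unionD:
  assumes "dyadic_union m k S" "x \<in> S" "y \<in> {..<m} \<rightarrow>\<^sub>E UNIV" "dyadic_cell m k x = dyadic_cell m k y"
  shows "y \<in> S"
proof -
  have "\<forall>x\<in>S. \<forall>y\<in>{..<m} \<rightarrow>\<^sub>E UNIV. dyadic_cell m k x = dyadic_cell m k y \<longrightarrow> y \<in> S"
    by (rule conjunct2[OF iffD1[OF dyadic_union_def assms(1)]])
  from mp[OF bspec[OF bspec[OF this assms(2)] assms(3)] assms(4)] show ?thesis .
qed

lemma dyadic_union_eq:
  assumes S: "dyadic_union m k S"
  shows "S = (\<Union>v\<in>dyadic_cell m k ` S. dyadic_cube m k v)"
proof (intro equalityI subsetI)
  fix x assume x: "x \<in> S"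
  then have "x \<in> {..<m} \<rightarrow>\<^sub>E UNIV" using S unfolding dyadic_union_def by (elim conjE) (rule subsetD)
  then have "x \<in> dyadic_cube m k (dyadic_cell m k x)" by (simp add: dyadic_cube_def)
  then show "x \<in> (\<Union>v\<in>dyadic_cell m k ` S. dyadic_cube m k v)" by (intro UN_I[OF imageI[OF x]])
next
  fix y assume "y \<in> (\<Union>v\<in>dyadic_cell m k ` S. dyadic_cube m k v)"
  then obtain x where x: "x \<in> S" "y \<in> {..<m} \<rightarrow>\<^sub>E UNIV" "dyadic_cell m k y = dyadic_cell m k x"
    by (auto simp only: dyadic_cube_def)
  show "y \<in> S" by (rule dyadic_unionD[OF S x(1,2) x(3)[symmetric]])
qed

lemma dyadic_union_sets:
  assumes "dyadic_union m k S" shows "S \<in> sets (Rn_lebesgue m)"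
proof -
  have c: "dyadic_cell m k ` S \<subseteq> {..<m} \<rightarrow>\<^sub>E UNIV" by (rule image_subsetI) (rule dyadic_cell_in)
  have "(\<Union>v\<in>dyadic_cell m k ` S. dyadic_cube m k v) \<in> sets (Rn_lebesgue m)"
  proof (rule sets.countable_UN''[OF countable_subset[OF c countable_dyadic_cells]])
    show "dyadic_cube m k v \<in> sets (Rn_lebesgue m)" if "v \<in> dyadic_cell m k ` S" for v
      by (intro dyadic_cube_sets subsetD[OF c that])
  qed
  then show ?thesis by (rule subst[where P="\<lambda>A. A \<in> sets (Rn_lebesgue m)", OF dyadic_union_eq[OF assms, symmetric]])
qed

lemma dyadic_union_emeasure:
  assumes S: "dyadic_union m k S" and A: "A \<in> sets (Rn_lebesgue m)"
  shows "emeasure (Rn_lebesgue m) (A \<inter> S)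
    = (\<integral>\<^sup>+v. emeasure (Rn_lebesgue m) (A \<inter> dyadic_cube m k v) \<partial>count_space (dyadic_cell m k ` S))"
proof -
  have c: "dyadic_cell m k ` S \<subseteq> {..<m} \<rightarrow>\<^sub>E UNIV" by (rule image_subsetI) (rule dyadic_cell_in)
  have "A \<inter> S = (\<Union>v\<in>dyadic_cell m k ` S. A \<inter> dyadic_cube m k v)"
    by (rule trans[OF arg_cong[OF dyadic_union_eq[OF S], of "\<lambda>T. A \<inter> T"] Int_UN_distrib])
  moreover have "emeasure (Rn_lebesgue m) (\<Union>v\<in>dyadic_cell m k ` S. A \<inter> dyadic_cube m k v)
    = (\<integral>\<^sup>+v. emeasure (Rn_lebesgue m) (A \<inter> dyadic_cube m k v) \<partial>count_space (dyadic_cell m k ` S))"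
  proof (rule emeasure_UN_countable)
    show "A \<inter> dyadic_cube m k v \<in> sets (Rn_lebesgue m)" if "v \<in> dyadic_cell m k ` S" for v
      by (intro sets.Int A dyadic_cube_sets subsetD[OF c that])
    show "countable (dyadic_cell m k ` S)" by (rule countable_subset[OF c countable_dyadic_cells])
    show "disjoint_family_on (\<lambda>v. A \<inter> dyadic_cube m k v) (dyadic_cell m k ` S)"
      unfolding disjoint_family_on_def
    proof (intro ballI impI equals0I)
      fix v w x assume "v \<noteq> w" and x: "x \<in> (A \<inter> dyadic_cube m k v) \<inter> (A \<inter> dyadic_cube m k w)"
      have "dyadic_cell m k x = v" by (rule dyadic_cubeD[OF IntD2[OF IntD1[OF x]]])
      moreover have "dyadic_cell m k x = w" by (rule dyadic_cubeD[OF IntD2[OF IntD2[OF x]]])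
      ultimately have "v = w" by (rule trans[OF sym])
      with \<open>v \<noteq> w\<close> show False by contradiction
    qed
  qed
  ultimately show ?thesis by (rule ssubst[where P="\<lambda>B. emeasure (Rn_lebesgue m) B = _"])
qed

text \<open>
  Summation of the bound over the cubes of level \<open>k\<close>, which are countably many.
\<close>

lemma thin_dyadic_union:
  assumes S: "dyadic_union m k S" and E: "E \<in> sets (Rn_lebesgue m)"
    and thin: "\<And>x. x \<in> S \<Longrightarrow> emeasure (Rn_lebesgue m) (E \<inter> dyadic_cube m k (dyadic_cell m k x)) \<le> ennreal (\<epsilon> * (1 / 2 ^ k) ^ m)"
    and \<epsilon>: "0 \<le> \<epsilon>"
  shows "emeasure (Rn_lebesgue m) (E \<inter> S) \<le> ennreal \<epsilon> * emeasure (Rn_lebesgue m) S"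
proof -
  have Ss: "S \<in> sets (Rn_lebesgue m)" by (rule dyadic_union_sets[OF S])
  have sp: "space (Rn_lebesgue m) \<inter> A = A" if "A \<in> sets (Rn_lebesgue m)" for A
    using sets.sets_into_space[OF that] by blast
  have "emeasure (Rn_lebesgue m) (E \<inter> S)
    = (\<integral>\<^sup>+v. emeasure (Rn_lebesgue m) (E \<inter> dyadic_cube m k v) \<partial>count_space (dyadic_cell m k ` S))"
    by (rule dyadic_union_emeasure[OF S E])
  also have "\<dots> \<le> (\<integral>\<^sup>+v. ennreal \<epsilon> * emeasure (Rn_lebesgue m) (space (Rn_lebesgue m) \<inter> dyadic_cube m k v) \<partial>count_space (dyadic_cell m k ` S))"
  proof (rule nn_integral_mono)
    fix v assume "v \<in> space (count_space (dyadic_cell m k ` S))"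
    then obtain x where x: "x \<in> S" "v = dyadic_cell m k x" by auto
    have v: "v \<in> {..<m} \<rightarrow>\<^sub>E UNIV" unfolding x by (rule dyadic_cell_in)
    show "emeasure (Rn_lebesgue m) (E \<inter> dyadic_cube m k v)
        \<le> ennreal \<epsilon> * emeasure (Rn_lebesgue m) (space (Rn_lebesgue m) \<inter> dyadic_cube m k v)"
      unfolding sp[OF dyadic_cube_sets[OF v]] emeasure_dyadic_cube[OF v]
      using thin[OF x(1)] \<epsilon> x(2) by (simp add: ennreal_mult)
  qed
  also have "\<dots> = ennreal \<epsilon> * (\<integral>\<^sup>+v. emeasure (Rn_lebesgue m) (space (Rn_lebesgue m) \<inter> dyadic_cube m k v) \<partial>count_space (dyadic_cell m k ` S))"
    by (rule nn_integral_cmult) simp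
  also have "\<dots> = ennreal \<epsilon> * emeasure (Rn_lebesgue m) (space (Rn_lebesgue m) \<inter> S)"
    by (subst dyadic_union_emeasure[OF S sets.top]) simp
  finally show ?thesis unfolding sp[OF Ss] .
qed

text \<open>
  A point of \<open>E\<close> in some thin cube is assigned to the largest one. These cubes are
  disjoint, and \<open>E\<close> fills at most the proportion \<open>\<epsilon>\<close> of each.
  The set \<open>H k\<close> is the union of those of level \<open>k\<close>.
\<close>

lemma dyadic_thin_set_bound:
  assumes E: "E \<in> sets (Rn_lebesgue m)" and \<epsilon>: "0 \<le> \<epsilon>" and w: "w \<in> {..<m} \<rightarrow>\<^sub>E UNIV"
  defines "G \<equiv> \<lambda>k. {x \<in> {..<m} \<rightarrow>\<^sub>E UNIV. emeasure (Rn_lebesgue m) (E \<inter> dyadic_cube m k (dyadic_cell m k x)) \<le> ennreal (\<epsilon> * (1 / 2 ^ k) ^ m)}"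
  shows "emeasure (Rn_lebesgue m) (E \<inter> (\<Union>k. G k) \<inter> dyadic_cube m 0 w) \<le> ennreal \<epsilon>"
    and "(\<Union>k. G k) \<in> sets (Rn_lebesgue m)"
proof -
  have Gu: "dyadic_union m k (G k)" for k
    unfolding G_def by (rule dyadic_union_Collect[where
        P="\<lambda>v. emeasure (Rn_lebesgue m) (E \<inter> dyadic_cube m k v) \<le> ennreal (\<epsilon> * (1 / 2 ^ k) ^ m)"])
  have "G k \<in> sets (Rn_lebesgue m)" for k by (rule dyadic_union_sets[OF Gu])
  then show Gs: "(\<Union>k. G k) \<in> sets (Rn_lebesgue m)" by (intro sets.countable_UN) auto
  define H where "H k = (G k - (\<Union>l<k. G l)) \<inter> dyadic_cube m 0 w" for k
  have Hu: "dyadic_union m k (H k)" for k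
    unfolding dyadic_union_def
  proof (intro conjI ballI impI)
    show "H k \<subseteq> {..<m} \<rightarrow>\<^sub>E UNIV" by (auto simp: H_def G_def)
    fix x y assume x: "x \<in> H k" and y: "y \<in> {..<m} \<rightarrow>\<^sub>E UNIV" and xy: "dyadic_cell m k x = dyadic_cell m k y"
    have c: "dyadic_cell m l x = dyadic_cell m l y" if "l \<le> k" for l by (rule dyadic_cell_mono[OF that xy])
    have xs: "x \<in> {..<m} \<rightarrow>\<^sub>E UNIV" using x by (auto simp: H_def G_def)
    have G: "x \<in> G l \<longleftrightarrow> y \<in> G l" if "l \<le> k" for l using c[OF that] xs y by (simp add: G_def)
    have "y \<in> dyadic_cube m 0 w" using x y c[of 0] by (simp add: H_def dyadic_cube_def)
    then show "y \<in> H k" using x G by (auto simp: H_def)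
  qed
  have Hs: "H k \<in> sets (Rn_lebesgue m)" for k by (rule dyadic_union_sets[OF Hu])
  have Hd: "disjoint_family H"
  proof -
    have *: "H i \<inter> H j = {}" if "i < j" for i j using that unfolding H_def by blast
    show ?thesis unfolding disjoint_family_on_def
    proof (intro ballI impI)
      fix i j :: nat assume "i \<noteq> j"
      then have "i < j \<or> j < i" by linarith
      then have "H i \<inter> H j = {} \<or> H j \<inter> H i = {}" using * by (elim disjE) simp_all
      then show "H i \<inter> H j = {}" by (simp only: Int_commute[of "H j"] simp_thms)
    qed
  qed
  have U: "(\<Union>k. G k) \<inter> dyadic_cube m 0 w = (\<Union>k. H k)"
  proof (intro equalityI subsetI)
    fix x assume x: "x \<in> (\<Union>k. G k) \<inter> dyadic_cube m 0 w"
    define k where "k = (LEAST k. x \<in> G k)"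
    from x obtain k0 where "x \<in> G k0" by blast
    then have "x \<in> G k" unfolding k_def by (rule LeastI)
    moreover have "x \<notin> G l" if "l < k" for l using that unfolding k_def by (rule not_less_Least)
    ultimately have "x \<in> H k" using x unfolding H_def by blast
    then show "x \<in> (\<Union>k. H k)" by blast
  next
    fix x assume "x \<in> (\<Union>k. H k)"
    then show "x \<in> (\<Union>k. G k) \<inter> dyadic_cube m 0 w" unfolding H_def by blast
  qed
  have "emeasure (Rn_lebesgue m) (E \<inter> (\<Union>k. G k) \<inter> dyadic_cube m 0 w) = emeasure (Rn_lebesgue m) (\<Union>k. E \<inter> H k)"
    by (rule arg_cong[where f="emeasure (Rn_lebesgue m)"])
       (rule trans[OF Int_assoc trans[OF arg_cong[OF U, of "\<lambda>T. E \<inter> T"] Int_UN_distrib]])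
  also have "\<dots> = (\<Sum>k. emeasure (Rn_lebesgue m) (E \<inter> H k))"
  proof (rule suminf_emeasure[symmetric])
    show "range (\<lambda>k. E \<inter> H k) \<subseteq> sets (Rn_lebesgue m)" using Hs E by (simp add: image_subset_iff sets.Int)
    show "disjoint_family (\<lambda>k. E \<inter> H k)" using Hd by (rule disjoint_family_subset) simp
  qed
  also have "\<dots> \<le> (\<Sum>k. ennreal \<epsilon> * emeasure (Rn_lebesgue m) (H k))"
  proof (intro suminf_le summableI)
    fix k show "emeasure (Rn_lebesgue m) (E \<inter> H k) \<le> ennreal \<epsilon> * emeasure (Rn_lebesgue m) (H k)"
      by (rule thin_dyadic_union[OF Hu E _ \<epsilon>]) (simp add: H_def G_def)
  qed
  also have "\<dots> = ennreal \<epsilon> * (\<Sum>k. emeasure (Rn_lebesgue m) (H k))" by (rule ennreal_suminf_cmult)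
  also have "(\<Sum>k. emeasure (Rn_lebesgue m) (H k)) = emeasure (Rn_lebesgue m) (\<Union>k. H k)"
    by (rule suminf_emeasure[OF _ Hd]) (simp add: image_subset_iff Hs)
  also have "\<dots> \<le> emeasure (Rn_lebesgue m) (dyadic_cube m 0 w)"
    by (rule emeasure_mono[OF _ dyadic_cube_sets[OF w]]) (simp add: UN_subset_iff H_def)
  also have "\<dots> = 1" by (simp add: emeasure_dyadic_cube[OF w])
  finally show "emeasure (Rn_lebesgue m) (E \<inter> (\<Union>k. G k) \<inter> dyadic_cube m 0 w) \<le> ennreal \<epsilon>"
    by (simp add: mult_left_mono)
qed

text \<open>
  The exceptional points have thin cubes for every \<open>\<epsilon>\<close>; by the preceding
  bound they form a null set within each unit cube.
\<close>

lemma dyadic_density: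
  assumes E: "E \<in> sets (Rn_lebesgue m)"
  obtains N where "N \<in> null_sets (Rn_lebesgue m)"
    "\<And>x. x \<in> E - N \<Longrightarrow> \<exists>\<epsilon>>0. \<forall>k. ennreal (\<epsilon> * (1 / 2 ^ k) ^ m) \<le> emeasure (Rn_lebesgue m) (E \<inter> dyadic_cube m k (dyadic_cell m k x))"
proof -
  define G where "G n = (\<Union>k. {x \<in> {..<m} \<rightarrow>\<^sub>E UNIV. emeasure (Rn_lebesgue m) (E \<inter> dyadic_cube m k (dyadic_cell m k x)) \<le> ennreal (inverse (real (Suc n)) * (1 / 2 ^ k) ^ m)})" for n
  define N where "N = (\<Inter>n. E \<inter> G n)"
  have pos: "0 \<le> inverse (real (Suc n))" for n by simp
  have w0: "(\<lambda>i\<in>{..<m}. 0) \<in> {..<m} \<rightarrow>\<^sub>E (UNIV :: int set)" by simp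
  have Gs: "G n \<in> sets (Rn_lebesgue m)" for n unfolding G_def by (rule dyadic_thin_set_bound(2)[OF E pos w0])
  have Ns: "N \<in> sets (Rn_lebesgue m)" unfolding N_def using E Gs by (intro sets.countable_INT) auto
  have null: "N \<inter> dyadic_cube m 0 w \<in> null_sets (Rn_lebesgue m)" if w: "w \<in> {..<m} \<rightarrow>\<^sub>E UNIV" for w
  proof (rule null_setsI)
    show "N \<inter> dyadic_cube m 0 w \<in> sets (Rn_lebesgue m)" using Ns dyadic_cube_sets[OF w] by simp
    have le: "emeasure (Rn_lebesgue m) (N \<inter> dyadic_cube m 0 w) \<le> ennreal (inverse (real (Suc n)))" for n
    proof -
      have "emeasure (Rn_lebesgue m) (N \<inter> dyadic_cube m 0 w) \<le> emeasure (Rn_lebesgue m) (E \<inter> G n \<inter> dyadic_cube m 0 w)"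
        using E Gs dyadic_cube_sets[OF w] by (intro emeasure_mono) (auto simp: N_def)
      also have "\<dots> \<le> ennreal (inverse (real (Suc n)))"
        unfolding G_def by (rule dyadic_thin_set_bound(1)[OF E pos w])
      finally show ?thesis .
    qed
    have "(\<lambda>n. ennreal (inverse (real (Suc n)))) \<longlonglongrightarrow> ennreal 0"
      by (intro tendsto_ennrealI LIMSEQ_inverse_real_of_nat)
    then have "emeasure (Rn_lebesgue m) (N \<inter> dyadic_cube m 0 w) \<le> ennreal 0"
      by (rule LIMSEQ_le_const) (use le in blast)
    then show "emeasure (Rn_lebesgue m) (N \<inter> dyadic_cube m 0 w) = 0" by simp
  qed
  have "N = (\<Union>w\<in>{..<m} \<rightarrow>\<^sub>E UNIV. N \<inter> dyadic_cube m 0 w)"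
  proof -
    have "x \<in> (\<Union>w\<in>{..<m} \<rightarrow>\<^sub>E UNIV. N \<inter> dyadic_cube m 0 w)" if x: "x \<in> N" for x
    proof -
      have "x \<in> {..<m} \<rightarrow>\<^sub>E UNIV" using subsetD[OF sets.sets_into_space[OF Ns] x] by simp
      then have "x \<in> dyadic_cube m 0 (dyadic_cell m 0 x)" by (simp add: dyadic_cube_def)
      with x have "x \<in> N \<inter> dyadic_cube m 0 (dyadic_cell m 0 x)" by (rule IntI)
      then show ?thesis by (intro UN_I[OF dyadic_cell_in])
    qed
    moreover have "(\<Union>w\<in>{..<m} \<rightarrow>\<^sub>E UNIV. N \<inter> dyadic_cube m 0 w) \<subseteq> N" by (intro UN_least Int_lower1)
    ultimately show ?thesis by (intro equalityI[OF subsetI])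
  qed
  moreover have "(\<Union>w\<in>{..<m} \<rightarrow>\<^sub>E UNIV. N \<inter> dyadic_cube m 0 w) \<in> null_sets (Rn_lebesgue m)"
    by (rule null_sets_UN'[OF countable_dyadic_cells null])
  ultimately have N: "N \<in> null_sets (Rn_lebesgue m)" by simp
  show thesis
  proof (rule that[OF N])
    fix x assume x: "x \<in> E - N"
    then obtain n where n: "x \<notin> G n" by (auto simp: N_def)
    have xs: "x \<in> {..<m} \<rightarrow>\<^sub>E UNIV" using x sets.sets_into_space[OF E] by auto
    have "ennreal (inverse (real (Suc n)) * (1 / 2 ^ k) ^ m) \<le> emeasure (Rn_lebesgue m) (E \<inter> dyadic_cube m k (dyadic_cell m k x))" for k
    proof -
      have "\<not> emeasure (Rn_lebesgue m) (E \<inter> dyadic_cube m k (dyadic_cell m k x)) \<le> ennreal (inverse (real (Suc n)) * (1 / 2 ^ k) ^ m)"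
        using n xs unfolding G_def by blast
      then show ?thesis by (simp only: not_le less_imp_le)
    qed
    then show "\<exists>\<epsilon>>0. \<forall>k. ennreal (\<epsilon> * (1 / 2 ^ k) ^ m) \<le> emeasure (Rn_lebesgue m) (E \<inter> dyadic_cube m k (dyadic_cell m k x))"
      by (intro exI[of _ "inverse (real (Suc n))"]) simp
  qed
qed

lemma dyadic_cube_diameter:
  assumes "dyadic_cell m k x = dyadic_cell m k y"
  shows "L2_set (\<lambda>i. x i - y i) {..<m} \<le> real m * (1 / 2 ^ k)"
proof -
  have "L2_set (\<lambda>i. x i - y i) {..<m} \<le> (\<Sum>i<m. \<bar>x i - y i\<bar>)" by (rule L2_set_le_sum_abs)
  also have "\<dots> \<le> (\<Sum>i<m. 1 / 2 ^ k)"
  proof (rule sum_mono)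
    fix i assume "i \<in> {..<m}"
    then have "\<lfloor>2 ^ k * x i\<rfloor> = \<lfloor>2 ^ k * y i\<rfloor>" using fun_cong[OF assms, of i] by (simp add: dyadic_cell_def)
    then have "\<bar>2 ^ k * x i - 2 ^ k * y i\<bar> \<le> 1" by linarith
    moreover have "\<bar>2 ^ k * x i - 2 ^ k * y i\<bar> = 2 ^ k * \<bar>x i - y i\<bar>"
      by (simp add: right_diff_distrib[symmetric] abs_mult)
    ultimately have "2 ^ k * \<bar>x i - y i\<bar> \<le> 1" by simp
    then show "\<bar>x i - y i\<bar> \<le> 1 / 2 ^ k" by (simp add: pos_le_divide_eq mult.commute)
  qed
  finally show ?thesis by simp
qed

lemma dyadic_cube_subset_ball:
  assumes x: "x \<in> {..<m} \<rightarrow>\<^sub>E UNIV" and r: "real m * (1 / 2 ^ k) < r"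
  shows "dyadic_cube m k (dyadic_cell m k x) \<subseteq> mball_of (Rn_metric m) x r"
proof (rule subsetI)
  fix y assume y: "y \<in> dyadic_cube m k (dyadic_cell m k x)"
  have "L2_set (\<lambda>i. x i - y i) {..<m} < r"
    using dyadic_cube_diameter[OF dyadic_cubeD[OF y, symmetric]] r by linarith
  moreover have "y \<in> {..<m} \<rightarrow>\<^sub>E UNIV" using y by (simp add: dyadic_cube_def)
  ultimately show "y \<in> mball_of (Rn_metric m) x r" using x by simp
qed

lemma ex_dyadic_scale:
  assumes "0 < t" "t \<le> (1::real)"
  obtains k :: nat where "1 / 2 ^ k \<le> t" "t / 2 \<le> 1 / 2 ^ k"
proof -
  have ex: "\<exists>k::nat. (1/2) ^ k \<le> t"
    using real_arch_pow_inv[OF assms(1), of "1/2"] by (auto intro: less_imp_le)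
  define k where "k = (LEAST k::nat. (1/2) ^ k \<le> t)"
  have 1: "(1/2) ^ k \<le> t" unfolding k_def using ex by (rule LeastI_ex)
  have 2: "t / 2 \<le> (1/2) ^ k"
  proof (cases k)
    case 0 then show ?thesis using assms by simp
  next
    case (Suc l)
    then have "\<not> (1/2) ^ l \<le> t" using not_less_Least[of l "\<lambda>k. (1/2) ^ k \<le> t"] unfolding k_def by simp
    then show ?thesis unfolding Suc by simp
  qed
  show thesis using that[of k] 1 2 by (simp add: power_divide)
qed

lemma open_Rn_lebesgue:
  assumes U: "openin (mtopology_of (Rn_metric m)) U" shows "U \<in> sets (Rn_lebesgue m)"
proof -
  define V where "V k = {x \<in> {..<m} \<rightarrow>\<^sub>E UNIV. dyadic_cube m k (dyadic_cell m k x) \<subseteq> U}" for k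
  have "dyadic_union m k (V k)" for k unfolding V_def
    by (rule dyadic_union_Collect[where P="\<lambda>v. dyadic_cube m k v \<subseteq> U"])
  then have Vs: "V k \<in> sets (Rn_lebesgue m)" for k by (rule dyadic_union_sets)
  have Us: "U \<subseteq> {..<m} \<rightarrow>\<^sub>E UNIV" using openin_subset[OF U] by simp
  have "U = (\<Union>k. V k)"
  proof (intro equalityI subsetI)
    fix x assume x: "x \<in> U"
    then obtain r where r: "r > 0" "mball_of (Rn_metric m) x r \<subseteq> U"
      using U Metric_space.openin_mtopology[OF Metric_space_mspace_mdist] unfolding mtopology_of_def mball_of_def by metis
    have xs: "x \<in> {..<m} \<rightarrow>\<^sub>E UNIV" using x Us by blast
    obtain k :: nat where k: "(1/2) ^ k < r / (real m + 1)"
      using real_arch_pow_inv[of "r / (real m + 1)" "1/2"] r by auto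
    have "real m * (1 / 2 ^ k) < r"
    proof -
      have "real m * (1 / 2 ^ k) \<le> real m * (r / (real m + 1))" using k by (intro mult_left_mono) (auto simp: power_divide)
      also have "\<dots> < r" using r by (simp add: divide_less_eq)
      finally show ?thesis .
    qed
    then have "dyadic_cube m k (dyadic_cell m k x) \<subseteq> U"
      by (rule order_trans[OF dyadic_cube_subset_ball[OF xs] r(2)])
    then have "x \<in> V k" using xs by (simp add: V_def)
    then show "x \<in> (\<Union>k. V k)" by (rule UN_I[OF UNIV_I])
  next
    fix x assume "x \<in> (\<Union>k. V k)"
    then obtain k where "x \<in> V k" by (rule UN_E)
    then have "x \<in> {..<m} \<rightarrow>\<^sub>E UNIV" and sub: "dyadic_cube m k (dyadic_cell m k x) \<subseteq> U" by (simp_all add: V_def)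
    then have "x \<in> dyadic_cube m k (dyadic_cell m k x)" by (simp add: dyadic_cube_def)
    then show "x \<in> U" by (rule subsetD[OF sub])
  qed
  moreover have "(\<Union>k. V k) \<in> sets (Rn_lebesgue m)"
    by (rule sets.countable_UN) (simp add: image_subset_iff Vs)
  ultimately show ?thesis by (simp only:)
qed

text \<open>
  A weak form of the Lebesgue density theorem that holds by comparing a ball with the dyadic cube
  of almost the same size around its centre.
\<close>

lemma lower_density_positive:
  assumes E: "E \<in> sets (Rn_lebesgue m)"
  obtains N where "N \<in> null_sets (Rn_lebesgue m)"
    "\<And>x. x \<in> E - N \<Longrightarrow> \<exists>c>0. \<forall>r. 0 < r \<longrightarrow> r \<le> 1 \<longrightarrow>
       ennreal (c * r ^ m) \<le> emeasure (Rn_lebesgue m) (E \<inter> mball_of (Rn_metric m) x r)"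
proof -
  obtain N where N: "N \<in> null_sets (Rn_lebesgue m)"
    "\<And>x. x \<in> E - N \<Longrightarrow> \<exists>\<epsilon>>0. \<forall>k. ennreal (\<epsilon> * (1 / 2 ^ k) ^ m) \<le> emeasure (Rn_lebesgue m) (E \<inter> dyadic_cube m k (dyadic_cell m k x))"
    using dyadic_density[OF E] by blast
  show thesis
  proof (rule that[OF N(1)])
    fix x assume x: "x \<in> E - N"
    then obtain \<epsilon> where \<epsilon>: "\<epsilon> > 0" "\<And>k. ennreal (\<epsilon> * (1 / 2 ^ k) ^ m) \<le> emeasure (Rn_lebesgue m) (E \<inter> dyadic_cube m k (dyadic_cell m k x))"
      using N(2) by blast
    have xs: "x \<in> {..<m} \<rightarrow>\<^sub>E UNIV" using x sets.sets_into_space[OF E] by auto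
    \<comment> \<open>A dyadic cube of side at most \<open>r / (m + 1)\<close> has diameter less than \<open>r\<close>; rounding the side
      to a power of 2 costs another factor 2.\<close>
    define c where "c = \<epsilon> * (1 / (2 * (real m + 1))) ^ m"
    have "ennreal (c * r ^ m) \<le> emeasure (Rn_lebesgue m) (E \<inter> mball_of (Rn_metric m) x r)" if r: "0 < r" "r \<le> 1" for r
    proof -
      have t: "0 < r / (real m + 1)" "r / (real m + 1) \<le> 1" using r by (auto simp: divide_le_eq)
      obtain k :: nat where k: "1 / 2 ^ k \<le> r / (real m + 1)" "r / (real m + 1) / 2 \<le> 1 / 2 ^ k"
        using ex_dyadic_scale[OF t] by blast
      have "c * r ^ m = \<epsilon> * (r / (real m + 1) / 2) ^ m" by (simp add: c_def power_divide power_mult_distrib mult.commute)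
      also have "\<dots> \<le> \<epsilon> * (1 / 2 ^ k) ^ m" using \<epsilon>(1) k(2) r by (intro mult_left_mono power_mono) auto
      finally have "ennreal (c * r ^ m) \<le> ennreal (\<epsilon> * (1 / 2 ^ k) ^ m)" by (rule ennreal_leI)
      also have "\<dots> \<le> emeasure (Rn_lebesgue m) (E \<inter> dyadic_cube m k (dyadic_cell m k x))" by (rule \<epsilon>(2))
      also have "\<dots> \<le> emeasure (Rn_lebesgue m) (E \<inter> mball_of (Rn_metric m) x r)"
      proof (rule emeasure_mono)
        have "real m * (1 / 2 ^ k) < r"
        proof -
          have "real m * (1 / 2 ^ k) \<le> real m * (r / (real m + 1))" using k(1) by (intro mult_left_mono) auto
          also have "\<dots> < r" using r by (simp add: divide_less_eq)
          finally show ?thesis .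
        qed
        then show "E \<inter> dyadic_cube m k (dyadic_cell m k x) \<subseteq> E \<inter> mball_of (Rn_metric m) x r"
          by (intro Int_mono order_refl dyadic_cube_subset_ball[OF xs])
        show "E \<inter> mball_of (Rn_metric m) x r \<in> sets (Rn_lebesgue m)"
          by (intro sets.Int E open_Rn_lebesgue openin_mball_of)
      qed
      finally show ?thesis .
    qed
    moreover have "c > 0" using \<epsilon>(1) by (simp add: c_def)
    ultimately show "\<exists>c>0. \<forall>r. 0 < r \<longrightarrow> r \<le> 1 \<longrightarrow>
       ennreal (c * r ^ m) \<le> emeasure (Rn_lebesgue m) (E \<inter> mball_of (Rn_metric m) x r)" by blast
  qed
qed

section \<open>The mass of a chart\<close>

text \<open>
  Where \<open>g\<close> is not differentiable, \<^const>\<open>deriv\<close> returns \<open>SOME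
  D. False\<close>, a fixed number. So the bound holds at every point, with a constant that
  depends on \<open>L\<close> only.
\<close>

lemma deriv_lipschitz_bound:
  fixes g :: "real \<Rightarrow> real"
  assumes g: "\<And>s t. \<bar>g s - g t\<bar> \<le> L * \<bar>s - t\<bar>"
  shows "\<bar>deriv g x\<bar> \<le> max L \<bar>SOME D::real. False\<bar>"
proof (cases "\<exists>D. (g has_real_derivative D) (at x)")
  case True
  then obtain D where D: "(g has_real_derivative D) (at x)" by blast
  have "((\<lambda>h. \<bar>(g (x + h) - g x) / h\<bar>) \<longlongrightarrow> \<bar>D\<bar>) (at 0)"
    using D unfolding DERIV_def by (rule tendsto_rabs)
  moreover have "\<forall>\<^sub>F h in at 0. \<bar>(g (x + h) - g x) / h\<bar> \<le> L"
  proof (rule eventually_at_topological[THEN iffD2], intro exI conjI ballI impI)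
    show "open (UNIV :: real set)" "0 \<in> (UNIV :: real set)" by simp_all
    fix h :: real assume "h \<noteq> 0"
    then show "\<bar>(g (x + h) - g x) / h\<bar> \<le> L" using g[of "x + h" x] by (simp add: abs_divide divide_le_eq)
  qed
  ultimately have "\<bar>D\<bar> \<le> L" by (rule tendsto_upperbound) simp
  then show ?thesis using DERIV_imp_deriv[OF D] by simp
next
  case False
  then have "(\<lambda>D. (g has_real_derivative D) (at x)) = (\<lambda>D. False)" by (simp add: fun_eq_iff)
  then have "deriv g x = (SOME D. False)" by (simp add: deriv_def)
  then show ?thesis by simp
qed

lemma partial_deriv_bound:
  assumes h: "lipschitz_bound (Rn_metric m) L h" and x: "x \<in> {..<m} \<rightarrow>\<^sub>E UNIV" and j: "j < m"
  shows "\<bar>partial_deriv j h x\<bar> \<le> max L \<bar>SOME D::real. False\<bar>"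
  unfolding partial_deriv_def
proof (rule deriv_lipschitz_bound)
  fix s t :: real
  have xs: "x(j := r) \<in> {..<m} \<rightarrow>\<^sub>E UNIV" for r using x j by (auto simp: PiE_iff extensional_def)
  have L0: "0 \<le> L" using h by (simp add: lipschitz_bound_def)
  have "\<bar>h (x(j := s)) - h (x(j := t))\<bar> \<le> L * L2_set (\<lambda>i. (x(j := s)) i - (x(j := t)) i) {..<m}"
    using lipschitz_boundD[OF h, of "x(j := s)" "x(j := t)"] xs by (simp del: fun_upd_apply)
  also have "L2_set (\<lambda>i. (x(j := s)) i - (x(j := t)) i) {..<m} \<le> (\<Sum>i<m. \<bar>(x(j := s)) i - (x(j := t)) i\<bar>)"
    by (rule L2_set_le_sum_abs)
  also have "(\<Sum>i<m. \<bar>(x(j := s)) i - (x(j := t)) i\<bar>) = (\<Sum>i<m. if i = j then \<bar>s - t\<bar> else 0)"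
    by (intro sum.cong) auto
  also have "\<dots> = \<bar>s - t\<bar>" using j by simp
  finally show "\<bar>h (x(j := s)) - h (x(j := t))\<bar> \<le> L * \<bar>s - t\<bar>"
    using L0 by (simp add: mult_left_mono del: fun_upd_apply)
qed

lemma jacobian_det_bound:
  assumes h: "\<And>i. i < m \<Longrightarrow> lipschitz_bound (Rn_metric m) L (h i)" and x: "x \<in> {..<m} \<rightarrow>\<^sub>E UNIV"
  shows "\<bar>jacobian_det m h x\<bar> \<le> real (card {\<sigma>. \<sigma> permutes {..<m}}) * (max L \<bar>SOME D::real. False\<bar>) ^ m"
proof -
  let ?D = "max L \<bar>SOME D::real. False\<bar>"
  have "\<bar>jacobian_det m h x\<bar> \<le> (\<Sum>\<sigma> | \<sigma> permutes {..<m}. \<bar>of_int (sign \<sigma>) * (\<Prod>i<m. partial_deriv (\<sigma> i) (h i) x)\<bar>)"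
    unfolding jacobian_det_def by (rule sum_abs)
  also have "\<dots> \<le> (\<Sum>\<sigma> | \<sigma> permutes {..<m}. ?D ^ m)"
  proof (rule sum_mono)
    fix \<sigma> assume "\<sigma> \<in> {\<sigma>. \<sigma> permutes {..<m}}"
    then have \<sigma>: "\<sigma> i < m" if "i < m" for i using permutes_in_image[of \<sigma> "{..<m}" i] that by simp
    have "\<bar>of_int (sign \<sigma>) * (\<Prod>i<m. partial_deriv (\<sigma> i) (h i) x)\<bar> = (\<Prod>i<m. \<bar>partial_deriv (\<sigma> i) (h i) x\<bar>)"
      by (simp add: abs_mult abs_prod sign_def)
    also have "\<dots> \<le> (\<Prod>i<m. ?D)"
    proof (rule prod_mono)
      fix i assume "i \<in> {..<m}"
      then have i: "i < m" by simp
      show "0 \<le> \<bar>partial_deriv (\<sigma> i) (h i) x\<bar> \<and> \<bar>partial_deriv (\<sigma> i) (h i) x\<bar> \<le> ?D"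
        using partial_deriv_bound[OF h[OF i] x \<sigma>[OF i]] by simp
    qed
    finally show "\<bar>of_int (sign \<sigma>) * (\<Prod>i<m. partial_deriv (\<sigma> i) (h i) x)\<bar> \<le> ?D ^ m" by simp
  qed
  finally show ?thesis by simp
qed

text \<open>
  Only the identity permutation contributes.
\<close>

lemma jacobian_det_scaled_coordinates:
  "jacobian_det m (\<lambda>i x. c * x i) x = c ^ m"
proof -
  have pd: "partial_deriv j (\<lambda>x. c * x i) x = (if i = j then c else 0)" for i j
  proof (cases "i = j")
    case True
    have "((\<lambda>t. c * t) has_real_derivative c) (at (x j))" by (auto intro!: derivative_eq_intros)
    then show ?thesis unfolding partial_deriv_def using True by (simp add: DERIV_imp_deriv)
  next
    case False
    then show ?thesis unfolding partial_deriv_def by simp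
  qed
  have z: "of_int (sign \<sigma>) * (\<Prod>i<m. if i = \<sigma> i then c else 0) = (0::real)"
    if \<sigma>: "\<sigma> \<in> {\<sigma>. \<sigma> permutes {..<m}} - {id}" for \<sigma>
  proof -
    have p: "\<sigma> permutes {..<m}" "\<sigma> \<noteq> id" using \<sigma> by auto
    then obtain i where i: "\<sigma> i \<noteq> i" by (auto simp: fun_eq_iff)
    have "i \<in> {..<m}" using permutes_not_in[OF p(1), of i] i by blast
    then have "(\<Prod>i<m. if i = \<sigma> i then c else 0) = 0" using i by (intro prod_zero bexI[of _ i]) auto
    then show ?thesis by simp
  qed
  have "jacobian_det m (\<lambda>i x. c * x i) x
      = (\<Sum>\<sigma> | \<sigma> permutes {..<m}. of_int (sign \<sigma>) * (\<Prod>i<m. if i = \<sigma> i then c else 0))"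
    unfolding jacobian_det_def pd ..
  also have "\<dots> = (\<Sum>\<sigma>\<in>{id}. of_int (sign \<sigma>) * (\<Prod>i<m. if i = \<sigma> i then c else 0))"
    using z permutes_id by (intro sum.mono_neutral_right) (auto simp: finite_permutations)
  also have "\<dots> = c ^ m" by (simp add: sign_id)
  finally show ?thesis .
qed

text \<open>
  The integral of a function that is not integrable is 0, so \<open>g\<close> may be arbitrary.
\<close>

lemma abs_integral_le:
  fixes g w :: "'a \<Rightarrow> real"
  assumes w: "integrable M w" and gw: "\<And>x. x \<in> space M \<Longrightarrow> \<bar>g x\<bar> \<le> w x"
  shows "\<bar>LINT x|M. g x\<bar> \<le> (LINT x|M. w x)"
proof (cases "integrable M g")
  case True
  have "\<bar>LINT x|M. g x\<bar> \<le> (LINT x|M. \<bar>g x\<bar>)" by (rule integral_abs_bound)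
  also have "\<dots> \<le> (LINT x|M. w x)" using True w gw by (intro integral_mono) auto
  finally show ?thesis .
next
  case False
  have "0 \<le> w x" if "x \<in> space M" for x using gw[OF that] abs_ge_zero[of "g x"] by linarith
  then have "0 \<le> (LINT x|M. w x)" by (intro integral_nonneg_AE AE_I2)
  then show ?thesis using not_integrable_integral_eq[OF False] by simp
qed

text \<open>
  The image under \<open>\<phi>\<close> of the measure with density $|\theta|$; the restriction to
  \<open>K\<close> is there because \<open>\<phi>\<close> is arbitrary elsewhere.
\<close>

definition chart_mass ::
    "nat \<Rightarrow> 'a metric \<Rightarrow> (nat \<Rightarrow> real) set \<Rightarrow> ((nat \<Rightarrow> real) \<Rightarrow> int) \<Rightarrow> ((nat \<Rightarrow> real) \<Rightarrow> 'a) \<Rightarrow> 'a measure" where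
  "chart_mass m Y K \<theta> \<phi> =
     distr (density (restrict_space (Rn_lebesgue m) K) (\<lambda>x. ennreal \<bar>real_of_int (\<theta> x)\<bar>)) (metric_borel Y) \<phi>"

locale chart =
  fixes m :: nat and Y :: "'a metric" and K :: "(nat \<Rightarrow> real) set" and \<theta> :: "(nat \<Rightarrow> real) \<Rightarrow> int"
    and \<phi> :: "(nat \<Rightarrow> real) \<Rightarrow> 'a" and S :: "'a functional"
  assumes chart: "chart_current m Y K \<theta> \<phi> S"
begin

abbreviation "R \<equiv> restrict_space (Rn_lebesgue m) K"
abbreviation "dR \<equiv> mdist (Rn_metric m)"

lemma S_current: "metric_current m Y S"
  using chart by (simp add: chart_current_def)

lemma K_sub: "K \<subseteq> {..<m} \<rightarrow>\<^sub>E UNIV"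
proof -
  have "compactin (mtopology_of (Rn_metric m)) K" using chart by (simp add: chart_current_def bilipschitz_chart_def)
  from compactin_subset_topspace[OF this] show ?thesis by simp
qed

lemma K_sets: "K \<in> sets (Rn_lebesgue m)"
proof -
  have "compactin (mtopology_of (Rn_metric m)) K" using chart by (simp add: chart_current_def bilipschitz_chart_def)
  then have "closedin (mtopology_of (Rn_metric m)) K"
    unfolding mtopology_of_def
    by (rule compactin_imp_closedin[OF Metric_space.Hausdorff_space_mtopology[OF Metric_space_mspace_mdist]])
  then have "openin (mtopology_of (Rn_metric m)) (mspace (Rn_metric m) - K)" by (simp add: closedin_def)
  then have "space (Rn_lebesgue m) - K \<in> sets (Rn_lebesgue m)" using open_Rn_lebesgue by simp
  then have "space (Rn_lebesgue m) - (space (Rn_lebesgue m) - K) \<in> sets (Rn_lebesgue m)" by (rule sets.compl_sets)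
  then show ?thesis using K_sub by (simp add: double_diff)
qed

lemma space_R: "space R = K"
  using K_sub by (auto simp: space_restrict_space)

lemma \<phi>_Y: "x \<in> K \<Longrightarrow> \<phi> x \<in> mspace Y"
  using chart unfolding chart_current_def bilipschitz_chart_def by blast

lemma \<phi>_bilipschitz:
  obtains L where "L > 0" "\<And>x y. x \<in> K \<Longrightarrow> y \<in> K \<Longrightarrow> dR x y / L \<le> mdist Y (\<phi> x) (\<phi> y)"
    "\<And>x y. x \<in> K \<Longrightarrow> y \<in> K \<Longrightarrow> mdist Y (\<phi> x) (\<phi> y) \<le> L * dR x y"
proof -
  have "\<exists>L>0. \<forall>x\<in>K. \<forall>y\<in>K. dR x y / L \<le> mdist Y (\<phi> x) (\<phi> y) \<and> mdist Y (\<phi> x) (\<phi> y) \<le> L * dR x y"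
    using chart unfolding chart_current_def bilipschitz_chart_def by (elim conjE)
  then obtain L where "L > 0" and L: "\<forall>x\<in>K. \<forall>y\<in>K. dR x y / L \<le> mdist Y (\<phi> x) (\<phi> y) \<and> mdist Y (\<phi> x) (\<phi> y) \<le> L * dR x y"
    by (elim exE conjE)
  show thesis
  proof (rule that[OF \<open>L > 0\<close>])
    fix x y assume "x \<in> K" "y \<in> K"
    then show "dR x y / L \<le> mdist Y (\<phi> x) (\<phi> y)" "mdist Y (\<phi> x) (\<phi> y) \<le> L * dR x y"
      using bspec[OF bspec[OF L]] by simp_all
  qed
qed

lemma \<phi>_measurable: "\<phi> \<in> measurable R (metric_borel Y)"
proof (rule measurable_metric_borelI)
  show "\<phi> \<in> space R \<rightarrow> mspace Y" unfolding space_R using \<phi>_Y by simp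
  fix U assume U: "openin (mtopology_of Y) U"
  obtain L where L: "L > 0" "\<And>x y. x \<in> K \<Longrightarrow> y \<in> K \<Longrightarrow> mdist Y (\<phi> x) (\<phi> y) \<le> L * dR x y"
    by (rule \<phi>_bilipschitz) (rule that)
  \<comment> \<open>An open set of the ambient space that cuts out the preimage of \<open>U\<close>.\<close>
  define V where "V = (\<Union>{mball_of (Rn_metric m) x s | x s. x \<in> K \<and> (\<forall>y\<in>K. dR x y < s \<longrightarrow> \<phi> y \<in> U)})"
  have "openin (mtopology_of (Rn_metric m)) V"
    unfolding V_def by (rule openin_Union) (auto simp: openin_mball_of simp del: mdist_Rn_metric)
  then have Vs: "V \<in> sets (Rn_lebesgue m)" by (rule open_Rn_lebesgue)
  have "\<phi> -` U \<inter> K = K \<inter> V"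
  proof (intro equalityI subsetI)
    fix x assume "x \<in> \<phi> -` U \<inter> K"
    then have x: "x \<in> K" "\<phi> x \<in> U" by auto
    obtain r where r: "r > 0" "mball_of Y (\<phi> x) r \<subseteq> U"
      using U x(2) Metric_space.openin_mtopology[OF Metric_space_mspace_mdist] unfolding mtopology_of_def mball_of_def by metis
    have "\<phi> y \<in> U" if y: "y \<in> K" "dR x y < r / L" for y
    proof -
      have "mdist Y (\<phi> x) (\<phi> y) \<le> L * dR x y" by (rule L(2)[OF x(1) y(1)])
      also have "\<dots> < r" using y(2) L(1) by (simp add: pos_less_divide_eq mult.commute del: mdist_Rn_metric)
      finally have "\<phi> y \<in> mball_of Y (\<phi> x) r" using \<phi>_Y x(1) y(1) by simp
      then show ?thesis by (rule subsetD[OF r(2)])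
    qed
    then have "mball_of (Rn_metric m) x (r / L) \<subseteq> V" unfolding V_def using x(1) by blast
    moreover have "x \<in> mball_of (Rn_metric m) x (r / L)" using subsetD[OF K_sub x(1)] r(1) L(1) mdist_self[of x "Rn_metric m"]
      by (simp del: mdist_Rn_metric)
    ultimately show "x \<in> K \<inter> V" using x(1) by blast
  next
    fix y assume y: "y \<in> K \<inter> V"
    then obtain x s where xs: "\<forall>y\<in>K. dR x y < s \<longrightarrow> \<phi> y \<in> U" "y \<in> mball_of (Rn_metric m) x s" unfolding V_def by blast
    then have "dR x y < s" by simp
    then show "y \<in> \<phi> -` U \<inter> K" using xs(1) y by blast
  qed
  then show "\<phi> -` U \<inter> space R \<in> sets R" unfolding space_R sets_restrict_space using Vs by auto
qed

lemma \<theta>_measurable: "(\<lambda>x. real_of_int (\<theta> x)) \<in> borel_measurable (Rn_lebesgue m)"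
  using chart by (simp add: chart_current_def borel_measurable_integrable)

lemma \<theta>_integrable: "integrable R (\<lambda>x. real_of_int (\<theta> x))"
proof -
  have i: "integrable (Rn_lebesgue m) (\<lambda>x. real_of_int (\<theta> x))" using chart by (simp add: chart_current_def)
  have "K \<inter> space (Rn_lebesgue m) \<in> sets (Rn_lebesgue m)" by (rule sets.Int[OF K_sets sets.top])
  then show ?thesis using integrable_mult_indicator[OF K_sets i] by (simp add: integrable_restrict_space)
qed

lemma \<theta>_measurable_R: "(\<lambda>x. real_of_int (\<theta> x)) \<in> borel_measurable R"
  by (rule measurable_restrict_space1[OF \<theta>_measurable])

abbreviation "\<rho> \<equiv> chart_mass m Y K \<theta> \<phi>"

lemma sets_\<rho>: "sets \<rho> = sets (metric_borel Y)"
  by (simp add: chart_mass_def)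

lemma \<phi>_measurable_density: "\<phi> \<in> measurable (density R g) (metric_borel Y)"
  using \<phi>_measurable by simp

lemma emeasure_\<rho>:
  assumes B: "B \<in> sets (metric_borel Y)"
  shows "emeasure \<rho> B = (\<integral>\<^sup>+x. ennreal \<bar>real_of_int (\<theta> x)\<bar> * indicator (\<phi> -` B) x \<partial>R)"
proof -
  have P: "\<phi> -` B \<inter> space R \<in> sets R" by (rule measurable_sets[OF \<phi>_measurable B])
  have "emeasure \<rho> B = emeasure (density R (\<lambda>x. ennreal \<bar>real_of_int (\<theta> x)\<bar>)) (\<phi> -` B \<inter> space R)"
    unfolding chart_mass_def using B by (subst emeasure_distr[OF \<phi>_measurable_density]) simp_all
  also have "\<dots> = (\<integral>\<^sup>+x. ennreal \<bar>real_of_int (\<theta> x)\<bar> * indicator (\<phi> -` B \<inter> space R) x \<partial>R)"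
    using P \<theta>_measurable_R by (intro emeasure_density) auto
  also have "\<dots> = (\<integral>\<^sup>+x. ennreal \<bar>real_of_int (\<theta> x)\<bar> * indicator (\<phi> -` B) x \<partial>R)"
    by (intro nn_integral_cong) (simp add: indicator_def)
  finally show ?thesis .
qed

lemma fbm_\<rho>: "finite_borel_measure Y \<rho>"
proof -
  have "emeasure \<rho> (mspace Y) \<le> (\<integral>\<^sup>+x. ennreal \<bar>real_of_int (\<theta> x)\<bar> \<partial>R)"
    unfolding emeasure_\<rho>[OF mspace_metric_borel] by (intro nn_integral_mono) (simp add: indicator_def)
  also have "\<dots> < \<infinity>" using \<theta>_integrable by (simp add: integrable_iff_bounded)
  finally have "finite_measure \<rho>"
    by (intro finite_measureI) (simp add: chart_mass_def)
  then show ?thesis by (simp add: finite_borel_measure_def sets_\<rho>)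
qed

lemma integral_\<rho>:
  fixes f :: "'a \<Rightarrow> real"
  assumes f: "f \<in> borel_measurable (metric_borel Y)"
  shows "(LINT y|\<rho>. f y) = (LINT x|R. \<bar>real_of_int (\<theta> x)\<bar> * f (\<phi> x))"
proof -
  have "(LINT y|\<rho>. f y) = (LINT x|density R (\<lambda>x. ennreal \<bar>real_of_int (\<theta> x)\<bar>). f (\<phi> x))"
    unfolding chart_mass_def by (rule integral_distr[OF \<phi>_measurable_density f])
  also have "\<dots> = (LINT x|R. \<bar>real_of_int (\<theta> x)\<bar> *\<^sub>R f (\<phi> x))"
    using \<theta>_measurable_R measurable_compose[OF \<phi>_measurable f] by (intro integral_density) auto
  finally show ?thesis by simp
qed

lemma S_formula:
  assumes f: "bounded_lipschitz Y f" and ps: "unit_tuple m Y ps"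
    and h: "\<And>i. i < m \<Longrightarrow> lipschitz_fun (Rn_metric m) (h i)" "\<And>i x. i < m \<Longrightarrow> x \<in> K \<Longrightarrow> h i x = (ps ! i) (\<phi> x)"
  shows "S f ps = (LINT x|R. real_of_int (\<theta> x) * f (\<phi> x) * jacobian_det m h x)"
proof -
  have "\<forall>f ps h. form m Y f ps \<longrightarrow>
        (\<forall>i<m. lipschitz_fun (Rn_metric m) (h i) \<and> (\<forall>x\<in>K. h i x = (ps ! i) (\<phi> x))) \<longrightarrow>
        S f ps = (LINT x:K|Rn_lebesgue m. real_of_int (\<theta> x) * f (\<phi> x) * jacobian_det m h x)"
    using chart unfolding chart_current_def by (elim conjE)
  then have "S f ps = (LINT x:K|Rn_lebesgue m. real_of_int (\<theta> x) * f (\<phi> x) * jacobian_det m h x)"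
    using unit_tuple_form[OF ps f] h by simp
  also have "\<dots> = (LINT x|R. real_of_int (\<theta> x) * f (\<phi> x) * jacobian_det m h x)"
    unfolding set_lebesgue_integral_def by (rule integral_restrict_space[OF sets.Int[OF K_sets sets.top], symmetric])
  finally show ?thesis .
qed

text \<open>
  The constant bounds the Jacobians of all tuples of 1-Lipschitz functions composed with the
  chart.
\<close>

lemma mass_le_\<rho>:
  obtains C where "0 \<le> C" "\<And>B. B \<in> sets (metric_borel Y) \<Longrightarrow> emeasure (mass_measure m Y S) B \<le> ennreal C * emeasure \<rho> B"
proof -
  obtain L where L: "L > 0" "\<And>x y. x \<in> K \<Longrightarrow> y \<in> K \<Longrightarrow> mdist Y (\<phi> x) (\<phi> y) \<le> L * dR x y"
    by (rule \<phi>_bilipschitz) (rule that)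
  define C where "C = real (card {\<sigma>. \<sigma> permutes {..<m}}) * (max L \<bar>SOME D::real. False\<bar>) ^ m"
  have C0: "0 \<le> C" using L(1) by (simp add: C_def)
  define \<nu> where "\<nu> = density \<rho> (\<lambda>_. ennreal C)"
  have e\<nu>: "emeasure \<nu> B = ennreal C * emeasure \<rho> B" if "B \<in> sets (metric_borel Y)" for B
    unfolding \<nu>_def using that sets_\<rho> by (subst emeasure_density) (simp_all add: nn_integral_cmult_indicator)
  note s = finite_borel_measureD[OF fbm_\<rho>]
  have "emeasure \<nu> (mspace Y) < \<infinity>"
    unfolding e\<nu>[OF mspace_metric_borel] using finite_measure.emeasure_finite[OF s(1), of "mspace Y"]
    by (simp add: ennreal_mult_eq_top_iff less_top[symmetric])
  then have "finite_measure \<nu>" using s(3) by (intro finite_measureI) (simp add: \<nu>_def)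
  then have \<nu>f: "finite_borel_measure Y \<nu>" by (simp add: finite_borel_measure_def \<nu>_def sets_\<rho>)
  have "controls m Y S \<nu>"
    unfolding controls_iff
  proof (intro conjI allI impI \<nu>f)
    fix f ps assume f: "bounded_lipschitz Y f" and ps: "unit_tuple m Y ps"
    \<comment> \<open>The McShane extensions keep the constant \<open>L\<close> of the chart.\<close>
    define h where "h i = mcshane (Rn_metric m) K L (\<lambda>x. (ps ! i) (\<phi> x))" for i
    have KR: "K \<subseteq> mspace (Rn_metric m)" using K_sub by simp
    have pl: "\<bar>(ps ! i) (\<phi> x) - (ps ! i) (\<phi> y)\<bar> \<le> L * dR x y" if "i < m" "x \<in> K" "y \<in> K" for i x y
    proof -
      have "lipschitz_bound Y 1 (ps ! i)" using ps that(1) by (simp add: unit_tuple_def)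
      then have "\<bar>(ps ! i) (\<phi> x) - (ps ! i) (\<phi> y)\<bar> \<le> 1 * mdist Y (\<phi> x) (\<phi> y)"
        using \<phi>_Y[OF that(2)] \<phi>_Y[OF that(3)] unfolding lipschitz_bound_def by (elim conjE) (drule (1) bspec, drule (1) bspec)
      then show ?thesis using L(2)[OF that(2,3)] by linarith
    qed
    have hl: "lipschitz_bound (Rn_metric m) L (h i)" if "i < m" for i
      unfolding h_def by (rule mcshane_lipschitz[OF KR less_imp_le[OF L(1)] pl[OF that]])
    have he: "h i x = (ps ! i) (\<phi> x)" if "i < m" "x \<in> K" for i x
      unfolding h_def by (rule mcshane_extends[OF KR less_imp_le[OF L(1)] pl[OF that(1)] that(2)])
    have fm: "(\<lambda>y. \<bar>f y\<bar>) \<in> borel_measurable (metric_borel Y)"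
      using lipschitz_measurable[OF bounded_lipschitz_imp_lipschitz[OF f]] by measurable
    have fi: "integrable R (\<lambda>x. \<bar>real_of_int (\<theta> x)\<bar> * \<bar>f (\<phi> x)\<bar>)"
    proof -
      obtain M where M: "0 < M" "\<And>x. x \<in> mspace Y \<Longrightarrow> \<bar>f x\<bar> \<le> M" using bounded_lipschitz_bound[OF f] by blast
      show ?thesis
      proof (rule Bochner_Integration.integrable_bound)
        show "integrable R (\<lambda>x. M * \<bar>real_of_int (\<theta> x)\<bar>)" using \<theta>_integrable by simp
        show "(\<lambda>x. \<bar>real_of_int (\<theta> x)\<bar> * \<bar>f (\<phi> x)\<bar>) \<in> borel_measurable R"
          using \<theta>_measurable_R measurable_compose[OF \<phi>_measurable fm] by measurable
        show "AE x in R. norm (\<bar>real_of_int (\<theta> x)\<bar> * \<bar>f (\<phi> x)\<bar>) \<le> norm (M * \<bar>real_of_int (\<theta> x)\<bar>)"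
        proof (rule AE_I2)
          fix x assume "x \<in> space R"
          then have "\<bar>f (\<phi> x)\<bar> \<le> M" unfolding space_R by (intro M(2) \<phi>_Y)
          then have "\<bar>f (\<phi> x)\<bar> * \<bar>real_of_int (\<theta> x)\<bar> \<le> M * \<bar>real_of_int (\<theta> x)\<bar>"
            by (rule mult_right_mono) simp
          then show "norm (\<bar>real_of_int (\<theta> x)\<bar> * \<bar>f (\<phi> x)\<bar>) \<le> norm (M * \<bar>real_of_int (\<theta> x)\<bar>)"
            using M(1) by (simp add: abs_mult mult.commute)
        qed
      qed
    qed
    have "S f ps = (LINT x|R. real_of_int (\<theta> x) * f (\<phi> x) * jacobian_det m h x)"
      by (rule S_formula[OF f ps lipschitz_funI[OF hl] he])
    also have "\<bar>\<dots>\<bar> \<le> (LINT x|R. C * (\<bar>real_of_int (\<theta> x)\<bar> * \<bar>f (\<phi> x)\<bar>))"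
    proof (rule abs_integral_le)
      show "integrable R (\<lambda>x. C * (\<bar>real_of_int (\<theta> x)\<bar> * \<bar>f (\<phi> x)\<bar>))" using fi by simp
      fix x assume "x \<in> space R"
      then have xs: "x \<in> {..<m} \<rightarrow>\<^sub>E UNIV" unfolding space_R by (rule subsetD[OF K_sub])
      have "\<bar>jacobian_det m h x\<bar> \<le> C" unfolding C_def by (rule jacobian_det_bound[OF hl xs])
      then have "\<bar>jacobian_det m h x\<bar> * (\<bar>real_of_int (\<theta> x)\<bar> * \<bar>f (\<phi> x)\<bar>) \<le> C * (\<bar>real_of_int (\<theta> x)\<bar> * \<bar>f (\<phi> x)\<bar>)"
        by (rule mult_right_mono) simp
      then show "\<bar>real_of_int (\<theta> x) * f (\<phi> x) * jacobian_det m h x\<bar> \<le> C * (\<bar>real_of_int (\<theta> x)\<bar> * \<bar>f (\<phi> x)\<bar>)"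
        by (simp add: abs_mult mult.commute)
    qed
    also have "\<dots> = C * (LINT y|\<rho>. \<bar>f y\<bar>)" by (simp add: integral_\<rho>[OF fm])
    also have "\<dots> = (LINT y|\<nu>. \<bar>f y\<bar>)"
      unfolding \<nu>_def using fm C0 sets_\<rho> by (subst integral_density) (auto cong: measurable_cong_sets)
    finally show "\<bar>S f ps\<bar> \<le> (LINT y|\<nu>. \<bar>f y\<bar>)" .
  qed
  then have "emeasure (mass_measure m Y S) B \<le> ennreal C * emeasure \<rho> B" if "B \<in> sets (metric_borel Y)" for B
    using minimal_controlD(3)[OF metric_currentD(3)[OF S_current] _ that] e\<nu>[OF that] by metis
  then show thesis by (rule that[OF C0])
qed

lemma nn_integral_\<rho>:
  assumes f: "f \<in> borel_measurable (metric_borel Y)"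
  shows "(\<integral>\<^sup>+y. f y \<partial>\<rho>) = (\<integral>\<^sup>+x. ennreal \<bar>real_of_int (\<theta> x)\<bar> * f (\<phi> x) \<partial>R)"
proof -
  have "(\<integral>\<^sup>+y. f y \<partial>\<rho>) = (\<integral>\<^sup>+x. f (\<phi> x) \<partial>density R (\<lambda>x. ennreal \<bar>real_of_int (\<theta> x)\<bar>))"
    unfolding chart_mass_def using f by (intro nn_integral_distr[OF \<phi>_measurable_density]) simp
  also have "\<dots> = (\<integral>\<^sup>+x. ennreal \<bar>real_of_int (\<theta> x)\<bar> * f (\<phi> x) \<partial>R)"
    using \<theta>_measurable_R measurable_compose[OF \<phi>_measurable f] by (intro nn_integral_density) auto
  finally show ?thesis .
qed

lemma coordinate_le: 
  assumes "i < m" shows "\<bar>x i - y i\<bar> \<le> dR x y"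
proof -
  have "x i - y i \<le> L2_set (\<lambda>i. x i - y i) {..<m}" using assms by (intro member_le_L2_set) auto
  moreover have "y i - x i \<le> L2_set (\<lambda>i. y i - x i) {..<m}" using assms by (intro member_le_L2_set) auto
  moreover have "L2_set (\<lambda>i. y i - x i) {..<m} = L2_set (\<lambda>i. x i - y i) {..<m}"
    by (simp add: L2_set_def power2_commute)
  ultimately show ?thesis by (simp add: abs_le_iff)
qed

text \<open>
  The coordinates of the inverse of the chart, scaled to be 1-Lipschitz and extended to the whole
  space.
\<close>

lemma ex_coordinates:
  obtains L \<pi> where "L > 0" "\<And>i. i < m \<Longrightarrow> lipschitz_bound Y 1 (\<pi> i)"
    "\<And>i x. i < m \<Longrightarrow> x \<in> K \<Longrightarrow> \<pi> i (\<phi> x) = x i / L"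
proof -
  obtain L where L: "L > 0" "\<And>x y. x \<in> K \<Longrightarrow> y \<in> K \<Longrightarrow> dR x y / L \<le> mdist Y (\<phi> x) (\<phi> y)"
    by (rule \<phi>_bilipschitz) (rule that)
  have inj: "inj_on \<phi> K"
  proof (rule inj_onI)
    fix x y assume xy: "x \<in> K" "y \<in> K" "\<phi> x = \<phi> y"
    have "dR x y / L \<le> 0" using L(2)[OF xy(1,2)] xy(3) \<phi>_Y[OF xy(2)] by (simp del: mdist_Rn_metric)
    then have "dR x y \<le> 0" using L(1) by (simp add: divide_le_0_iff del: mdist_Rn_metric)
    then have "dR x y = 0" using mdist_nonneg[of "Rn_metric m" x y] by linarith
    then show "x = y" using subsetD[OF K_sub xy(1)] subsetD[OF K_sub xy(2)] mdist_zero[of x "Rn_metric m" y] by simp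
  qed
  define v where "v i y = inv_into K \<phi> y i / L" for i y
  define \<pi> where "\<pi> i = mcshane Y (\<phi> ` K) 1 (v i)" for i
  have S: "\<phi> ` K \<subseteq> mspace Y" by (rule image_subsetI) (rule \<phi>_Y)
  have v\<phi>: "v i (\<phi> x) = x i / L" if "x \<in> K" for i x unfolding v_def using inj that by simp
  have v: "\<bar>v i p - v i q\<bar> \<le> 1 * mdist Y p q" if i: "i < m" and pq: "p \<in> \<phi> ` K" "q \<in> \<phi> ` K" for i p q
  proof -
    obtain x y where xy: "x \<in> K" "p = \<phi> x" "y \<in> K" "q = \<phi> y" using pq by blast
    have "\<bar>v i p - v i q\<bar> = \<bar>x i - y i\<bar> / L" using v\<phi> xy L(1) by (simp add: diff_divide_distrib[symmetric])
    also have "\<dots> \<le> dR x y / L" using coordinate_le[OF i] L(1) by (intro divide_right_mono) auto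
    also have "\<dots> \<le> mdist Y p q" unfolding xy by (rule L(2)[OF xy(1,3)])
    finally show ?thesis by simp
  qed
  show thesis
  proof (rule that[OF L(1), of \<pi>])
    fix i assume i: "i < m"
    show "lipschitz_bound Y 1 (\<pi> i)" unfolding \<pi>_def by (rule mcshane_lipschitz[OF S _ v[OF i]]) simp
    fix x assume x: "x \<in> K"
    have "\<pi> i (\<phi> x) = v i (\<phi> x)" unfolding \<pi>_def by (rule mcshane_extends[OF S _ v[OF i] imageI[OF x]]) simp
    then show "\<pi> i (\<phi> x) = x i / L" using v\<phi>[OF x] by simp
  qed
qed

text \<open>
  With the scaled coordinates as tuple, the Jacobian is constant and the current becomes
  integration of \<open>\<theta>\<close>. The same coordinates recover the point of
  \<open>K\<close>, so the sign of \<open>\<theta>\<close> is a Borel function \<open>hs\<close>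
  on the space, and testing with it turns \<open>\<theta>\<close> into $|\theta|$.
\<close>

lemma \<rho>_le_mass:
  obtains C where "0 < C" "\<And>B. B \<in> sets (metric_borel Y) \<Longrightarrow> emeasure \<rho> B \<le> ennreal C * emeasure (mass_measure m Y S) B"
proof -
  obtain L \<pi> where L: "L > 0" and \<pi>: "\<And>i. i < m \<Longrightarrow> lipschitz_bound Y 1 (\<pi> i)"
    "\<And>i x. i < m \<Longrightarrow> x \<in> K \<Longrightarrow> \<pi> i (\<phi> x) = x i / L"
    using ex_coordinates by blast
  define ps where "ps = map \<pi> [0..<m]"
  have ps: "unit_tuple m Y ps" using \<pi>(1) by (auto simp: ps_def unit_tuple_def)
  have hl: "lipschitz_fun (Rn_metric m) (\<lambda>x. (1 / L) * x i)" if "i < m" for i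
  proof (rule lipschitz_funI)
    have "lipschitz_bound (Rn_metric m) 1 (\<lambda>x. x i)"
      using coordinate_le[OF that] by (simp add: lipschitz_bound_def)
    then show "lipschitz_bound (Rn_metric m) (\<bar>1 / L\<bar> * 1) (\<lambda>x. (1 / L) * x i)" by (rule lipschitz_bound_scale)
  qed
  have S: "L ^ m * S f ps = (LINT x|R. real_of_int (\<theta> x) * f (\<phi> x))" if f: "bounded_lipschitz Y f" for f
  proof -
    have "S f ps = (LINT x|R. real_of_int (\<theta> x) * f (\<phi> x) * jacobian_det m (\<lambda>i x. (1 / L) * x i) x)"
      by (rule S_formula[OF f ps hl]) (simp_all add: ps_def \<pi>(2))
    also have "\<dots> = (LINT x|R. real_of_int (\<theta> x) * f (\<phi> x)) * (1 / L) ^ m"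
      unfolding jacobian_det_scaled_coordinates by simp
    finally show ?thesis using L by (simp add: power_divide)
  qed
  \<comment> \<open>On the image of \<open>K\<close> the argument of \<open>\<theta>\<close> is the inverse of the chart.\<close>
  define hs where "hs y = sgn (real_of_int (\<theta> (\<lambda>i\<in>{..<m}. L * \<pi> i y)))" for y
  have hsm: "hs \<in> borel_measurable (metric_borel Y)"
  proof -
    have "(\<lambda>y. \<lambda>i\<in>{..<m}. L * \<pi> i y) \<in> measurable (metric_borel Y) (Rn_lebesgue m)"
      unfolding Rn_lebesgue_def
    proof (rule measurable_restrict)
      fix i assume "i \<in> {..<m}"
      then have "\<pi> i \<in> borel_measurable (metric_borel Y)" using \<pi>(1) by (intro lipschitz_measurable lipschitz_funI) auto
      then show "(\<lambda>y. L * \<pi> i y) \<in> measurable (metric_borel Y) lborel" by simp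
    qed
    from measurable_compose[OF this \<theta>_measurable]
    have "(\<lambda>y. real_of_int (\<theta> (\<lambda>i\<in>{..<m}. L * \<pi> i y))) \<in> borel_measurable (metric_borel Y)" .
    then show ?thesis unfolding hs_def[abs_def] by measurable
  qed
  have hs1: "\<bar>hs y\<bar> \<le> 1" for y by (simp add: hs_def abs_sgn_eq)
  have hs\<phi>: "hs (\<phi> x) = sgn (real_of_int (\<theta> x))" if x: "x \<in> K" for x
  proof -
    have "(\<lambda>i\<in>{..<m}. L * \<pi> i (\<phi> x)) = x"
    proof (rule ext)
      fix i show "(\<lambda>i\<in>{..<m}. L * \<pi> i (\<phi> x)) i = x i"
      proof (cases "i < m")
        case True then show ?thesis using \<pi>(2)[OF True x] L by simp
      next
        case False then show ?thesis using PiE_arb[OF subsetD[OF K_sub x], of i] by simp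
      qed
    qed
    then show ?thesis by (simp add: hs_def)
  qed
  define \<mu> where "\<mu> = mass_measure m Y S"
  have \<mu>: "minimal_control m Y S \<mu>" "finite_borel_measure Y \<mu>" unfolding \<mu>_def using metric_currentD[OF S_current] by simp_all
  note s\<mu> = finite_borel_measureD[OF \<mu>(2)]
  define \<nu> where "\<nu> = density \<mu> (\<lambda>_. ennreal (L ^ m))"
  have e\<nu>: "emeasure \<nu> B = ennreal (L ^ m) * emeasure \<mu> B" if "B \<in> sets (metric_borel Y)" for B
    unfolding \<nu>_def using that s\<mu> by (subst emeasure_density) (simp_all add: nn_integral_cmult_indicator)
  have "emeasure \<nu> (mspace Y) < \<infinity>"
    unfolding e\<nu>[OF mspace_metric_borel] using finite_measure.emeasure_finite[OF s\<mu>(1), of "mspace Y"]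
    by (simp add: ennreal_mult_eq_top_iff less_top[symmetric])
  then have "finite_measure \<nu>" using s\<mu>(3) by (intro finite_measureI) (simp add: \<nu>_def)
  then have \<nu>f: "finite_borel_measure Y \<nu>" by (simp add: finite_borel_measure_def \<nu>_def s\<mu>)
  have hs\<rho>: "hs \<in> borel_measurable \<rho>" using hsm sets_\<rho> by (simp cong: measurable_cong_sets)
  have main: "emeasure \<rho> B \<le> ennreal (L ^ m) * emeasure \<mu> B" if B: "B \<in> sets (metric_borel Y)" for B
  proof -
    have "emeasure (density \<rho> (\<lambda>y. ennreal \<bar>hs y\<bar>)) B \<le> emeasure \<nu> B"
    proof (rule density_le_control[OF fbm_\<rho> \<nu>f hs\<rho> hs1])
      show "B \<in> sets \<rho>" using B sets_\<rho> by simp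
      fix f assume f: "bounded_lipschitz Y f"
      have fm: "f \<in> borel_measurable (metric_borel Y)" by (rule lipschitz_measurable[OF bounded_lipschitz_imp_lipschitz[OF f]])
      have "(LINT y|\<rho>. f y * hs y) = (LINT x|R. \<bar>real_of_int (\<theta> x)\<bar> * (f (\<phi> x) * hs (\<phi> x)))"
        using fm hsm by (intro integral_\<rho>) measurable
      also have "\<dots> = (LINT x|R. real_of_int (\<theta> x) * f (\<phi> x))"
      proof (rule Bochner_Integration.integral_cong[OF refl])
        fix x assume "x \<in> space R"
        then have "hs (\<phi> x) = sgn (real_of_int (\<theta> x))" unfolding space_R by (rule hs\<phi>)
        then show "\<bar>real_of_int (\<theta> x)\<bar> * (f (\<phi> x) * hs (\<phi> x)) = real_of_int (\<theta> x) * f (\<phi> x)"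
          by (simp add: abs_mult_sgn mult.commute mult.left_commute)
      qed
      finally have "\<bar>LINT y|\<rho>. f y * hs y\<bar> = L ^ m * \<bar>S f ps\<bar>" using S[OF f, symmetric] L by (simp add: abs_mult)
      also have "\<dots> \<le> L ^ m * (LINT y|\<mu>. \<bar>f y\<bar>)"
      proof (rule mult_left_mono)
        show "\<bar>S f ps\<bar> \<le> (LINT y|\<mu>. \<bar>f y\<bar>)" using minimal_controlD(1)[OF \<mu>(1)] f ps unfolding controls_iff by simp
      qed (use L in simp)
      also have "\<dots> = (LINT y|\<nu>. \<bar>f y\<bar>)"
        unfolding \<nu>_def using lipschitz_borel_measurable[OF \<mu>(2) bounded_lipschitz_imp_lipschitz[OF f]] L
        by (subst integral_density) auto
      finally show "\<bar>LINT y|\<rho>. f y * hs y\<bar> \<le> (LINT y|\<nu>. \<bar>f y\<bar>)" .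
    qed
    moreover have "emeasure (density \<rho> (\<lambda>y. ennreal \<bar>hs y\<bar>)) B = emeasure \<rho> B"
    proof -
      have "emeasure (density \<rho> (\<lambda>y. ennreal \<bar>hs y\<bar>)) B = (\<integral>\<^sup>+y. ennreal \<bar>hs y\<bar> * indicator B y \<partial>\<rho>)"
        using hs\<rho> B sets_\<rho> by (intro emeasure_density) auto
      also have "\<dots> = (\<integral>\<^sup>+x. ennreal \<bar>real_of_int (\<theta> x)\<bar> * (ennreal \<bar>hs (\<phi> x)\<bar> * indicator B (\<phi> x)) \<partial>R)"
        by (intro nn_integral_\<rho> borel_measurable_times_ennreal borel_measurable_indicator B)
           (use hsm in measurable)
      also have "\<dots> = (\<integral>\<^sup>+x. ennreal \<bar>real_of_int (\<theta> x)\<bar> * indicator (\<phi> -` B) x \<partial>R)"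
      proof (rule nn_integral_cong)
        fix x assume "x \<in> space R"
        then have "hs (\<phi> x) = sgn (real_of_int (\<theta> x))" unfolding space_R by (rule hs\<phi>)
        then show "ennreal \<bar>real_of_int (\<theta> x)\<bar> * (ennreal \<bar>hs (\<phi> x)\<bar> * indicator B (\<phi> x))
            = ennreal \<bar>real_of_int (\<theta> x)\<bar> * indicator (\<phi> -` B) x"
          by (cases "\<theta> x = 0") (simp_all add: abs_sgn_eq indicator_def)
      qed
      also have "\<dots> = emeasure \<rho> B" by (rule emeasure_\<rho>[OF B, symmetric])
      finally show ?thesis .
    qed
    ultimately show ?thesis using e\<nu>[OF B] by simp
  qed
  show thesis
  proof (rule that)
    show "0 < L ^ m" using L by simp
    show "\<And>B. B \<in> sets (metric_borel Y) \<Longrightarrow> emeasure \<rho> B \<le> ennreal (L ^ m) * emeasure (mass_measure m Y S) B"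
      using main unfolding \<mu>_def .
  qed
qed

text \<open>
  The chart maps the ball of radius \<open>r / L\<close> into the ball of radius \<open>r\<close>,
  and $|\theta| \ge 1$ where \<open>\<theta>\<close> does not vanish because it has integer
  values.
\<close>

lemma lower_density_S:
  obtains N where "N \<in> null_sets (Rn_lebesgue m)"
    "\<And>x. x \<in> K - N \<Longrightarrow> \<theta> x \<noteq> 0 \<Longrightarrow> \<exists>c>0. \<exists>r0>0. \<forall>r. 0 < r \<longrightarrow> r \<le> r0 \<longrightarrow>
       c * r ^ m \<le> measure (mass_measure m Y S) (mball_of Y (\<phi> x) r)"
proof -
  define E where "E = {x \<in> K. \<theta> x \<noteq> 0}"
  have Es: "E \<in> sets (Rn_lebesgue m)"
  proof -
    have "{x \<in> space (Rn_lebesgue m). real_of_int (\<theta> x) \<noteq> 0} \<in> sets (Rn_lebesgue m)"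
      using \<theta>_measurable by measurable
    from sets.Int[OF K_sets this] have "K \<inter> {x \<in> space (Rn_lebesgue m). real_of_int (\<theta> x) \<noteq> 0} \<in> sets (Rn_lebesgue m)" .
    moreover have "K \<inter> {x \<in> space (Rn_lebesgue m). real_of_int (\<theta> x) \<noteq> 0} = E" using K_sub unfolding E_def by auto
    ultimately show ?thesis by simp
  qed
  obtain N where N: "N \<in> null_sets (Rn_lebesgue m)"
    "\<And>x. x \<in> E - N \<Longrightarrow> \<exists>c>0. \<forall>r. 0 < r \<longrightarrow> r \<le> 1 \<longrightarrow>
       ennreal (c * r ^ m) \<le> emeasure (Rn_lebesgue m) (E \<inter> mball_of (Rn_metric m) x r)"
    using lower_density_positive[OF Es] by blast
  obtain L where L: "L > 0" "\<And>x y. x \<in> K \<Longrightarrow> y \<in> K \<Longrightarrow> mdist Y (\<phi> x) (\<phi> y) \<le> L * dR x y"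
    by (rule \<phi>_bilipschitz) (rule that)
  obtain C where C: "0 < C" "\<And>B. B \<in> sets (metric_borel Y) \<Longrightarrow> emeasure \<rho> B \<le> ennreal C * emeasure (mass_measure m Y S) B"
    using \<rho>_le_mass by blast
  define \<mu> where "\<mu> = mass_measure m Y S"
  have \<mu>: "finite_borel_measure Y \<mu>" unfolding \<mu>_def using metric_currentD[OF S_current] by simp
  interpret finite_measure \<mu> by (rule finite_borel_measureD(1)[OF \<mu>])
  show thesis
  proof (rule that[OF N(1)])
    fix x assume x: "x \<in> K - N" and \<theta>x: "\<theta> x \<noteq> 0"
    then have "x \<in> E - N" by (simp add: E_def)
    then obtain c where c: "c > 0" and c': "\<forall>r. 0 < r \<longrightarrow> r \<le> 1 \<longrightarrow>
       ennreal (c * r ^ m) \<le> emeasure (Rn_lebesgue m) (E \<inter> mball_of (Rn_metric m) x r)" using N(2) by blast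
    have "c / (L ^ m * C) * r ^ m \<le> measure \<mu> (mball_of Y (\<phi> x) r)" if r: "0 < r" "r \<le> L" for r
    proof -
      let ?B = "mball_of Y (\<phi> x) r" and ?D = "E \<inter> mball_of (Rn_metric m) x (r / L)"
      have Bs: "?B \<in> sets (metric_borel Y)" by (rule open_metric_borel[OF openin_mball_of])
      have Ds: "?D \<in> sets (Rn_lebesgue m)" by (rule sets.Int[OF Es open_Rn_lebesgue[OF openin_mball_of]])
      have DK: "?D \<subseteq> K" by (auto simp: E_def)
      have "ennreal (c * (r / L) ^ m) \<le> emeasure (Rn_lebesgue m) ?D"
        using c'[rule_format, of "r / L"] r L(1) by simp
      also have "\<dots> = emeasure R ?D" by (rule emeasure_restrict_space[OF sets.Int[OF K_sets sets.top] DK, symmetric])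
      also have "\<dots> = (\<integral>\<^sup>+y. indicator ?D y \<partial>R)"
      proof (rule nn_integral_indicator[symmetric])
        have "?D = K \<inter> ?D" using DK by blast
        then show "?D \<in> sets R" unfolding sets_restrict_space using Ds by blast
      qed
      also have "\<dots> \<le> (\<integral>\<^sup>+y. ennreal \<bar>real_of_int (\<theta> y)\<bar> * indicator (\<phi> -` ?B) y \<partial>R)"
      proof (rule nn_integral_mono)
        fix y
        show "indicator ?D y \<le> ennreal \<bar>real_of_int (\<theta> y)\<bar> * (indicator (\<phi> -` ?B) y :: ennreal)"
        proof (cases "y \<in> ?D")
          case True
          then have y: "y \<in> K" "\<theta> y \<noteq> 0" "dR x y < r / L" by (simp_all add: E_def)
          have "mdist Y (\<phi> x) (\<phi> y) \<le> L * dR x y" using x y(1) by (intro L(2)) auto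
          also have "\<dots> < r" using y(3) L(1) by (simp add: pos_less_divide_eq mult.commute del: mdist_Rn_metric)
          finally have "\<phi> y \<in> ?B" using \<phi>_Y[OF y(1)] \<phi>_Y[of x] x by simp
          moreover have "1 \<le> \<bar>\<theta> y\<bar>" using y(2) by linarith
          then have "1 \<le> \<bar>real_of_int (\<theta> y)\<bar>" by linarith
          then have "ennreal 1 \<le> ennreal \<bar>real_of_int (\<theta> y)\<bar>" by (rule ennreal_leI)
          ultimately show ?thesis using True by simp
        qed simp
      qed
      also have "\<dots> = emeasure \<rho> ?B" by (rule emeasure_\<rho>[OF Bs, symmetric])
      also have "\<dots> \<le> ennreal C * emeasure \<mu> ?B" unfolding \<mu>_def by (rule C(2)[OF Bs])
      also have "\<dots> = ennreal (C * measure \<mu> ?B)" using C(1) by (simp add: emeasure_eq_measure ennreal_mult)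
      finally have "c * (r / L) ^ m \<le> C * measure \<mu> ?B" using C(1) by (subst (asm) ennreal_le_iff) simp_all
      then show ?thesis using C(1) L(1) by (simp add: power_divide field_simps)
    qed
    moreover have "c / (L ^ m * C) > 0" using c C L by simp
    ultimately show "\<exists>c>0. \<exists>r0>0. \<forall>r. 0 < r \<longrightarrow> r \<le> r0 \<longrightarrow>
       c * r ^ m \<le> measure (mass_measure m Y S) (mball_of Y (\<phi> x) r)"
      unfolding \<mu>_def[symmetric] using L(1) by blast
  qed
qed

end

section \<open>Concentration on the set of a current\<close>

lemma measure_ball_lsc:
  assumes \<mu>: "finite_borel_measure Y \<mu>"
  shows "openin (mtopology_of Y) {p\<in>mspace Y. a < measure \<mu> (mball_of Y p q)}"
proof -
  interpret finite_measure \<mu> by (rule finite_borel_measureD(1)[OF \<mu>])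
  note s = finite_borel_measureD[OF \<mu>]
  have bs: "mball_of Y p r \<in> sets \<mu>" for p r using open_metric_borel[OF openin_mball_of] s by simp
  have "\<exists>\<epsilon>>0. mball_of Y p \<epsilon> \<subseteq> {p\<in>mspace Y. a < measure \<mu> (mball_of Y p q)}"
    if p: "p \<in> mspace Y" "a < measure \<mu> (mball_of Y p q)" for p
  proof -
    have "(\<lambda>n. measure \<mu> (mball_of Y p (q - inverse (real (Suc n))))) \<longlonglongrightarrow> measure \<mu> (\<Union>n. mball_of Y p (q - inverse (real (Suc n))))"
    proof (rule finite_Lim_measure_incseq)
      show "range (\<lambda>n. mball_of Y p (q - inverse (real (Suc n)))) \<subseteq> sets \<mu>" using bs by auto
      show "incseq (\<lambda>n. mball_of Y p (q - inverse (real (Suc n))))"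
      proof (rule incseq_SucI, rule subsetI)
        fix n y assume y: "y \<in> mball_of Y p (q - inverse (real (Suc n)))"
        have "inverse (real (Suc (Suc n))) \<le> inverse (real (Suc n))" by (intro le_imp_inverse_le) auto
        then have "mdist Y p y < q - inverse (real (Suc (Suc n)))" using y unfolding in_mball_of by linarith
        then show "y \<in> mball_of Y p (q - inverse (real (Suc (Suc n))))" using y by (simp del: of_nat_Suc)
      qed
    qed
    moreover have "(\<Union>n. mball_of Y p (q - inverse (real (Suc n)))) = mball_of Y p q"
    proof (intro equalityI subsetI)
      fix y assume "y \<in> (\<Union>n. mball_of Y p (q - inverse (real (Suc n))))"
      then obtain n where "y \<in> mball_of Y p (q - inverse (real (Suc n)))" by blast
      moreover have "0 < inverse (real (Suc n))" by simp
      ultimately show "y \<in> mball_of Y p q" unfolding in_mball_of by linarith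
    next
      fix y assume y: "y \<in> mball_of Y p q"
      then have "0 < q - mdist Y p y" by simp
      then obtain n where "inverse (real (Suc n)) < q - mdist Y p y" using reals_Archimedean by blast
      then have "y \<in> mball_of Y p (q - inverse (real (Suc n)))" using y by (simp del: of_nat_Suc)
      then show "y \<in> (\<Union>n. mball_of Y p (q - inverse (real (Suc n))))" by blast
    qed
    ultimately have "(\<lambda>n. measure \<mu> (mball_of Y p (q - inverse (real (Suc n))))) \<longlonglongrightarrow> measure \<mu> (mball_of Y p q)" by simp
    from order_tendstoD(1)[OF this p(2)] obtain n where n: "a < measure \<mu> (mball_of Y p (q - inverse (real (Suc n))))"
      by (auto simp: eventually_sequentially simp del: of_nat_Suc)
    show ?thesis
    proof (intro exI conjI subsetI)
      show "0 < inverse (real (Suc n))" by simp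
      fix p' assume p': "p' \<in> mball_of Y p (inverse (real (Suc n)))"
      have "mball_of Y p (q - inverse (real (Suc n))) \<subseteq> mball_of Y p' q"
      proof (rule subsetI)
        fix y assume y: "y \<in> mball_of Y p (q - inverse (real (Suc n)))"
        have "mdist Y p' y \<le> mdist Y p' p + mdist Y p y" using p' y p by (intro mdist_triangle) auto
        then show "y \<in> mball_of Y p' q" using p' y mdist_commute[of Y p p'] by (simp del: of_nat_Suc)
      qed
      then have "measure \<mu> (mball_of Y p (q - inverse (real (Suc n)))) \<le> measure \<mu> (mball_of Y p' q)"
        by (rule finite_measure_mono[OF _ bs])
      then show "p' \<in> {p\<in>mspace Y. a < measure \<mu> (mball_of Y p q)}" using n p' by simp
    qed
  qed
  then show ?thesis
    unfolding mtopology_of_def mball_of_def Metric_space.openin_mtopology[OF Metric_space_mspace_mdist] by auto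
qed

text \<open>
  The measure of a ball is left continuous in the radius, so the lower limit is decided by
  rational radii, and for a fixed radius it is lower semicontinuous in the centre.
\<close>

lemma current_set_sets:
  assumes \<mu>: "finite_borel_measure Y (mass_measure m Y T)"
  shows "current_set m Y T \<in> sets (metric_borel Y)"
proof -
  define \<mu>' where "\<mu>' = mass_measure m Y T"
  interpret finite_measure \<mu>' unfolding \<mu>'_def by (rule finite_borel_measureD(1)[OF \<mu>])
  have bs: "mball_of Y p r \<in> sets \<mu>'" for p r
    using open_metric_borel[OF openin_mball_of] finite_borel_measureD(2)[OF \<mu>] by (simp add: \<mu>'_def)
  define b where "b p r = measure \<mu>' (mball_of Y p r)" for p r
  define A where "A n q = {p\<in>mspace Y. inverse (real (Suc n)) * q ^ m < b p q}" for n q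
  define Q where "Q n = {q\<in>\<rat>. 0 < q \<and> q < inverse (real (Suc n))}" for n :: nat
  have Am: "A n q \<in> sets (metric_borel Y)" for n q
    unfolding A_def b_def \<mu>'_def by (rule open_metric_borel[OF measure_ball_lsc[OF \<mu>]])
  have Qne: "Q n \<noteq> {}" for n
  proof -
    have "0 < inverse (real (Suc n))" by simp
    from Rats_dense_in_real[OF this] show ?thesis unfolding Q_def by blast
  qed
  have "current_set m Y T = (\<Union>n. \<Inter>q\<in>Q n. A n q)"
  proof (intro equalityI subsetI)
    fix p assume "p \<in> current_set m Y T"
    then have p: "p \<in> mspace Y" and Lim: "0 < Liminf (at_right 0) (\<lambda>r. ereal (b p r / r ^ m))"
      by (simp_all add: current_set_def b_def \<mu>'_def)
    obtain y where y: "0 < ereal y" "ereal y < Liminf (at_right 0) (\<lambda>r. ereal (b p r / r ^ m))"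
      using ereal_dense2[OF Lim] by blast
    have "\<forall>\<^sub>F r in at_right 0. ereal y < ereal (b p r / r ^ m)" by (rule less_LiminfD[OF y(2)])
    then obtain d where d: "d > 0" "\<And>r. 0 < r \<Longrightarrow> r < d \<Longrightarrow> y < b p r / r ^ m"
      unfolding eventually_at_right_field by auto
    have "0 < min y d" using y(1) d(1) by simp
    then obtain n where n: "inverse (real (Suc n)) < min y d" using reals_Archimedean by blast
    have "p \<in> A n q" if "q \<in> Q n" for q
    proof -
      have q: "0 < q" "q < inverse (real (Suc n))" using that by (simp_all add: Q_def)
      then have "y < b p q / q ^ m" using n by (intro d(2)) (simp_all del: of_nat_Suc)
      then have "y * q ^ m < b p q" using q(1) by (simp add: pos_less_divide_eq)
      moreover have "inverse (real (Suc n)) * q ^ m \<le> y * q ^ m" using n q by (intro mult_right_mono) (simp_all del: of_nat_Suc)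
      ultimately show ?thesis using p by (simp add: A_def del: of_nat_Suc)
    qed
    then show "p \<in> (\<Union>n. \<Inter>q\<in>Q n. A n q)" by blast
  next
    fix p assume "p \<in> (\<Union>n. \<Inter>q\<in>Q n. A n q)"
    then obtain n where n: "\<And>q. q \<in> Q n \<Longrightarrow> p \<in> A n q" by blast
    have p: "p \<in> mspace Y" using Qne[of n] n by (auto simp: A_def)
    let ?i = "inverse (real (Suc n))"
    have "?i \<le> b p r / r ^ m" if r: "0 < r" "r < ?i" for r
    proof (rule ccontr)
      assume "\<not> ?i \<le> b p r / r ^ m"
      then have lt: "b p r < ?i * r ^ m" using r(1) by (simp add: not_le pos_divide_less_eq del: of_nat_Suc)
      have "((\<lambda>q. ?i * q ^ m) \<longlongrightarrow> ?i * r ^ m) (at_left r)" by (intro tendsto_intros)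
      from order_tendstoD(1)[OF this lt] obtain d where d: "d < r" "\<And>q. d < q \<Longrightarrow> q < r \<Longrightarrow> b p r < ?i * q ^ m"
        unfolding eventually_at_left_field by blast
      have "max 0 d < r" using d(1) r(1) by simp
      then obtain q where q: "q \<in> \<rat>" "max 0 d < q" "q < r" using Rats_dense_in_real by blast
      then have "q \<in> Q n" using r by (simp add: Q_def del: of_nat_Suc)
      then have 1: "?i * q ^ m < b p q" using n by (simp add: A_def del: of_nat_Suc)
      have 2: "b p q \<le> b p r" unfolding b_def
      proof (rule finite_measure_mono[OF _ bs])
        show "mball_of Y p q \<subseteq> mball_of Y p r" using q(3) by auto
      qed
      have "b p r < ?i * q ^ m" using q by (intro d(2)) simp_all
      then show False using 1 2 by linarith
    qed
    then have "\<forall>\<^sub>F r in at_right 0. ereal ?i \<le> ereal (b p r / r ^ m)"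
      unfolding eventually_at_right_field by (intro exI[of _ ?i]) (simp del: of_nat_Suc)
    then have "ereal ?i \<le> Liminf (at_right 0) (\<lambda>r. ereal (b p r / r ^ m))" by (rule Liminf_bounded)
    moreover have "0 < ereal ?i" by simp
    ultimately have "0 < Liminf (at_right 0) (\<lambda>r. ereal (b p r / r ^ m))" by (rule less_le_trans[rotated])
    then show "p \<in> current_set m Y T" using p by (simp add: current_set_def b_def \<mu>'_def)
  qed
  moreover have "(\<Union>n. \<Inter>q\<in>Q n. A n q) \<in> sets (metric_borel Y)"
  proof (rule sets.countable_UN, rule image_subsetI)
    fix n
    have "countable (Q n)" unfolding Q_def by (rule countable_subset[OF _ countable_rat]) blast
    then show "(\<Inter>q\<in>Q n. A n q) \<in> sets (metric_borel Y)" using Am Qne by (intro sets.countable_INT') auto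
  qed
  ultimately show ?thesis by simp
qed

text \<open>
  A point of the chart with positive lower density for the mass of \<open>S\<close> has positive
  lower density for the larger mass of \<open>T\<close>; almost all points are of this kind.
\<close>

lemma chart_concentrated:
  assumes ch: "chart_current m Y K \<theta> \<phi> S" and T: "finite_borel_measure Y (mass_measure m Y T)"
    and le: "\<And>B. B \<in> sets (metric_borel Y) \<Longrightarrow> emeasure (mass_measure m Y S) B \<le> emeasure (mass_measure m Y T) B"
  shows "emeasure (mass_measure m Y S) (mspace Y - current_set m Y T) = 0"
proof -
  interpret chart m Y K \<theta> \<phi> S by standard (rule ch)
  define D where "D = mspace Y - current_set m Y T"
  have Ds: "D \<in> sets (metric_borel Y)" unfolding D_def by (rule sets.Diff[OF mspace_metric_borel current_set_sets[OF T]])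
  obtain N where N: "N \<in> null_sets (Rn_lebesgue m)"
    "\<And>x. x \<in> K - N \<Longrightarrow> \<theta> x \<noteq> 0 \<Longrightarrow> \<exists>c>0. \<exists>r0>0. \<forall>r. 0 < r \<longrightarrow> r \<le> r0 \<longrightarrow>
       c * r ^ m \<le> measure (mass_measure m Y S) (mball_of Y (\<phi> x) r)" using lower_density_S by blast
  have in_set: "\<phi> x \<in> current_set m Y T" if x: "x \<in> K - N" "\<theta> x \<noteq> 0" for x
  proof -
    obtain c r0 where c: "c > 0" "r0 > 0" "\<And>r. 0 < r \<Longrightarrow> r \<le> r0 \<Longrightarrow>
       c * r ^ m \<le> measure (mass_measure m Y S) (mball_of Y (\<phi> x) r)" using N(2)[OF x] by blast
    have "c \<le> measure (mass_measure m Y T) (mball_of Y (\<phi> x) r) / r ^ m" if r: "0 < r" "r < r0" for r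
    proof -
      have "measure (mass_measure m Y S) (mball_of Y (\<phi> x) r) \<le> measure (mass_measure m Y T) (mball_of Y (\<phi> x) r)"
        using le[OF open_metric_borel[OF openin_mball_of]] finite_measure.emeasure_finite[OF finite_borel_measureD(1)[OF T]]
        unfolding measure_def by (intro enn2real_mono) (auto simp: less_top[symmetric])
      then have "c * r ^ m \<le> measure (mass_measure m Y T) (mball_of Y (\<phi> x) r)" using c(3)[of r] r by linarith
      then show ?thesis using r(1) by (simp add: pos_le_divide_eq)
    qed
    then have "\<forall>\<^sub>F r in at_right 0. ereal c \<le> ereal (measure (mass_measure m Y T) (mball_of Y (\<phi> x) r) / r ^ m)"
      unfolding eventually_at_right_field using c(2) by (intro exI[of _ r0]) simp
    then have "ereal c \<le> Liminf (at_right 0) (\<lambda>r. ereal (measure (mass_measure m Y T) (mball_of Y (\<phi> x) r) / r ^ m))"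
      by (rule Liminf_bounded)
    moreover have "0 < ereal c" using c(1) by simp
    ultimately show ?thesis using \<phi>_Y[of x] x by (simp add: current_set_def less_le_trans[rotated])
  qed
  have "AE x in R. x \<notin> N"
    using AE_not_in[OF N(1)] by (subst AE_restrict_space_iff[OF sets.Int[OF K_sets sets.top]]) (auto elim: eventually_mono)
  then have "AE x in R. ennreal \<bar>real_of_int (\<theta> x)\<bar> * indicator (\<phi> -` D) x = 0"
  proof (rule AE_mp, intro AE_I2 impI)
    fix x assume "x \<in> space R" "x \<notin> N"
    then have x: "x \<in> K - N" by (simp add: space_R)
    show "ennreal \<bar>real_of_int (\<theta> x)\<bar> * indicator (\<phi> -` D) x = 0"
    proof (cases "\<theta> x = 0")
      case False
      then have "x \<notin> \<phi> -` D" using in_set[OF x] by (simp add: D_def)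
      then show ?thesis by simp
    qed simp
  qed
  then have "(\<integral>\<^sup>+x. ennreal \<bar>real_of_int (\<theta> x)\<bar> * indicator (\<phi> -` D) x \<partial>R) = (\<integral>\<^sup>+x. 0 \<partial>R)"
    by (rule nn_integral_cong_AE)
  then have "emeasure \<rho> D = 0" unfolding emeasure_\<rho>[OF Ds] by simp
  moreover obtain C where "0 \<le> C" "\<And>B. B \<in> sets (metric_borel Y) \<Longrightarrow> emeasure (mass_measure m Y S) B \<le> ennreal C * emeasure \<rho> B"
    using mass_le_\<rho> by blast
  ultimately have "emeasure (mass_measure m Y S) D \<le> 0" using Ds by (metis mult_zero_right)
  then show ?thesis by (simp add: D_def)
qed

lemma finite_measures_eq_of_le:
  assumes \<kappa>: "finite_borel_measure Y \<kappa>" and \<mu>: "finite_borel_measure Y \<mu>"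
    and le: "\<And>B. B \<in> sets (metric_borel Y) \<Longrightarrow> emeasure \<kappa> B \<le> emeasure \<mu> B"
    and total: "emeasure \<mu> (mspace Y) \<le> emeasure \<kappa> (mspace Y)" and B: "B \<in> sets (metric_borel Y)"
  shows "emeasure \<kappa> B = emeasure \<mu> B"
proof -
  note s\<kappa> = finite_borel_measureD[OF \<kappa>] and s\<mu> = finite_borel_measureD[OF \<mu>]
  interpret k: finite_measure \<kappa> by (rule s\<kappa>)
  interpret m: finite_measure \<mu> by (rule s\<mu>)
  have le': "measure \<kappa> A \<le> measure \<mu> A" if "A \<in> sets (metric_borel Y)" for A
    using le[OF that] by (simp add: k.emeasure_eq_measure m.emeasure_eq_measure)
  have "measure \<kappa> (mspace Y - B) = measure \<kappa> (mspace Y) - measure \<kappa> B"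
    using k.finite_measure_compl[of B] B s\<kappa> by simp
  moreover have "measure \<mu> (mspace Y - B) = measure \<mu> (mspace Y) - measure \<mu> B"
    using m.finite_measure_compl[of B] B s\<mu> by simp
  moreover have "measure \<mu> (mspace Y) \<le> measure \<kappa> (mspace Y)"
    using total by (simp add: k.emeasure_eq_measure m.emeasure_eq_measure)
  moreover have "measure \<kappa> (mspace Y - B) \<le> measure \<mu> (mspace Y - B)"
    by (rule le'[OF sets.Diff[OF mspace_metric_borel B]])
  ultimately have "measure \<mu> B \<le> measure \<kappa> B" by linarith
  then have "measure \<mu> B = measure \<kappa> B" using le'[OF B] by linarith
  then show ?thesis by (simp add: k.emeasure_eq_measure m.emeasure_eq_measure)
qed

lemma emeasure_mass_measure:
  assumes "metric_current m Y T" shows "emeasure (mass_measure m Y T) (mspace Y) = ennreal (mass m Y T)"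
  using finite_measure.emeasure_eq_measure[OF finite_borel_measureD(1)[OF metric_currentD(4)[OF assms]]]
  by (simp add: mass_def)

text \<open>
  The sum of the mass measures of the charts controls \<open>T\<close>, so it is at least the mass
  measure of \<open>T\<close>. Both have the same total mass, hence they agree, and the claim
  reduces to the single charts.
\<close>

lemma rectifiable_concentrated:
  assumes rect: "integer_rectifiable m Y T"
  shows "emeasure (mass_measure m Y T) (mspace Y - current_set m Y T) = 0"
proof -
  have T: "metric_current m Y T" using rect by (simp add: integer_rectifiable_def)
  have "\<exists>S :: nat \<Rightarrow> 'a functional. (\<forall>i. \<exists>K \<theta> \<phi>. chart_current m Y K \<theta> \<phi> (S i)) \<and>
        (\<forall>f ps. form m Y f ps \<longrightarrow> (\<lambda>i. S i f ps) sums T f ps) \<and>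
        (\<lambda>i. mass m Y (S i)) sums mass m Y T"
    using rect unfolding integer_rectifiable_def by (rule conjunct2)
  then obtain S :: "nat \<Rightarrow> 'a functional" where S: "\<forall>i. \<exists>K \<theta> \<phi>. chart_current m Y K \<theta> \<phi> (S i)"
    "\<forall>f ps. form m Y f ps \<longrightarrow> (\<lambda>i. S i f ps) sums T f ps" "(\<lambda>i. mass m Y (S i)) sums mass m Y T"
    by (elim exE conjE)
  have Sc: "metric_current m Y (S i)" for i
  proof -
    obtain K \<theta> \<phi> where "chart_current m Y K \<theta> \<phi> (S i)" using S(1) by blast
    then show ?thesis by (simp add: chart_current_def)
  qed
  define M where "M i = mass_measure m Y (S i)" for i
  have M: "finite_borel_measure Y (M i)" "minimal_control m Y (S i) (M i)" for i
    using metric_currentD[OF Sc] by (simp_all add: M_def)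
  have Ms: "sets (M i) = sets (M 0)" for i using finite_borel_measureD(2)[OF M(1)] by metis
  have M0: "sets (M 0) = sets (metric_borel Y)" by (rule finite_borel_measureD(2)[OF M(1)])
  define \<mu> where "\<mu> = sum_measure M"
  have \<mu>s: "sets \<mu> = sets (metric_borel Y)" using M0 by (simp add: \<mu>_def)
  have \<mu>e: "emeasure \<mu> B = (\<Sum>i. emeasure (M i) B)" if "B \<in> sets (metric_borel Y)" for B
    unfolding \<mu>_def using that M0 by (intro emeasure_sum_measure Ms) simp
  have \<mu>Y: "emeasure \<mu> (mspace Y) = ennreal (mass m Y T)"
  proof -
    have "emeasure \<mu> (mspace Y) = (\<Sum>i. ennreal (mass m Y (S i)))"
      unfolding \<mu>e[OF mspace_metric_borel] M_def by (simp only: emeasure_mass_measure[OF Sc])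
    also have "\<dots> = ennreal (mass m Y T)" by (rule suminf_ennreal_eq[OF _ S(3)]) (simp add: mass_def)
    finally show ?thesis .
  qed
  have sp: "space \<mu> = mspace Y" using sets_eq_imp_space_eq[OF \<mu>s] by simp
  have "finite_measure \<mu>" by (rule finite_measureI) (simp add: sp \<mu>Y)
  then have \<mu>f: "finite_borel_measure Y \<mu>" by (simp add: finite_borel_measure_def \<mu>s)
  have "controls m Y T \<mu>"
    unfolding controls_iff
  proof (intro conjI allI impI \<mu>f)
    fix f ps assume f: "bounded_lipschitz Y f" and ps: "unit_tuple m Y ps"
    define a where "a i = (LINT x|M i. \<bar>f x\<bar>)" for i
    have a0: "0 \<le> a i" for i unfolding a_def by (intro integral_nonneg_AE AE_I2) simp
    have Sa: "\<bar>S i f ps\<bar> \<le> a i" for i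
      unfolding a_def using minimal_controlD(1)[OF M(2)] f ps unfolding controls_iff by blast
    have fm: "(\<lambda>x. ennreal \<bar>f x\<bar>) \<in> borel_measurable (M 0)"
      using lipschitz_borel_measurable[OF M(1) bounded_lipschitz_imp_lipschitz[OF f]] by measurable
    have "ennreal (LINT x|\<mu>. \<bar>f x\<bar>) = (\<integral>\<^sup>+x. ennreal \<bar>f x\<bar> \<partial>\<mu>)"
      by (rule integral_eq_nn_integral_abs[OF integrable_bounded_lipschitz[OF \<mu>f f]])
    also have "\<dots> = (\<Sum>i. \<integral>\<^sup>+x. ennreal \<bar>f x\<bar> \<partial>M i)" unfolding \<mu>_def by (rule nn_integral_sum_measure[where M=M, OF Ms fm])
    also have "\<dots> = (\<Sum>i. ennreal (a i))"
      unfolding a_def by (simp only: integral_eq_nn_integral_abs[OF integrable_bounded_lipschitz[OF M(1) f]])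
    finally have sum: "ennreal (LINT x|\<mu>. \<bar>f x\<bar>) = (\<Sum>i. ennreal (a i))" .
    have suma: "summable a" by (rule summable_suminf_not_top[OF a0]) (simp add: sum[symmetric])
    have "ennreal (LINT x|\<mu>. \<bar>f x\<bar>) = ennreal (suminf a)" unfolding sum by (rule suminf_ennreal2[OF a0 suma])
    then have eq: "(LINT x|\<mu>. \<bar>f x\<bar>) = suminf a"
      using suminf_nonneg[OF suma a0] by (subst (asm) ennreal_inj) (auto intro!: integral_nonneg_AE AE_I2)
    have sS: "summable (\<lambda>i. \<bar>S i f ps\<bar>)" using Sa by (intro summable_comparison_test'[OF suma, of 0]) simp
    have "T f ps = (\<Sum>i. S i f ps)" using S(2) unit_tuple_form[OF ps f] by (simp add: sums_iff)
    then have "\<bar>T f ps\<bar> \<le> (\<Sum>i. \<bar>S i f ps\<bar>)" using summable_rabs[OF sS] by simp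
    also have "\<dots> \<le> suminf a" by (rule suminf_le[OF Sa sS suma])
    finally show "\<bar>T f ps\<bar> \<le> (LINT x|\<mu>. \<bar>f x\<bar>)" using eq by simp
  qed
  note T\<mu> = minimal_controlD(3)[OF metric_currentD(3)[OF T] this]
  have eq: "emeasure (mass_measure m Y T) B = emeasure \<mu> B" if "B \<in> sets (metric_borel Y)" for B
    by (rule finite_measures_eq_of_le[OF metric_currentD(4)[OF T] \<mu>f T\<mu> _ that])
       (simp_all add: \<mu>Y emeasure_mass_measure[OF T])
  have le: "emeasure (M i) B \<le> emeasure (mass_measure m Y T) B" if B: "B \<in> sets (metric_borel Y)" for i B
    unfolding eq[OF B] \<mu>e[OF B] using sum_le_suminf[OF summableI, of "{i}" "\<lambda>i. emeasure (M i) B"] by simp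
  have D: "mspace Y - current_set m Y T \<in> sets (metric_borel Y)"
    by (rule sets.Diff[OF mspace_metric_borel current_set_sets[OF metric_currentD(4)[OF T]]])
  have "emeasure (M i) (mspace Y - current_set m Y T) = 0" for i
  proof -
    obtain K \<theta> \<phi> where ch: "chart_current m Y K \<theta> \<phi> (S i)" using S(1) by blast
    show ?thesis unfolding M_def
      by (rule chart_concentrated[OF ch metric_currentD(4)[OF T] le[unfolded M_def]])
  qed
  then show ?thesis unfolding eq[OF D] \<mu>e[OF D] by simp
qed

section \<open>Convergence of the masses\<close>

text \<open>
  The infimum that defines \<^const>\<open>Lip\<close> is attained.
\<close>

lemma lipschitz_bound_Lip:
  assumes "lipschitz_fun X u" shows "lipschitz_bound X (Lip X u) u"
proof -
  obtain L0 where L0: "lipschitz_bound X L0 u" using assms by (rule lipschitz_funE)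
  show ?thesis unfolding lipschitz_bound_def
  proof (intro conjI ballI)
    show "0 \<le> Lip X u" unfolding Lip_def
      by (rule cInf_greatest) (use L0 in \<open>auto simp: lipschitz_bound_def\<close>)
    fix x y assume xy: "x \<in> mspace X" "y \<in> mspace X"
    show "\<bar>u x - u y\<bar> \<le> Lip X u * mdist X x y"
    proof (cases "mdist X x y = 0")
      case True
      then show ?thesis using lipschitz_boundD[OF L0 xy] by simp
    next
      case False
      then have pos: "0 < mdist X x y" using mdist_nonneg[of X x y] by linarith
      have "\<bar>u x - u y\<bar> / mdist X x y \<le> Lip X u" unfolding Lip_def
      proof (rule cInf_greatest)
        show "{L. lipschitz_bound X L u} \<noteq> {}" using L0 by blast
        fix L assume "L \<in> {L. lipschitz_bound X L u}"
        then have "\<bar>u x - u y\<bar> \<le> L * mdist X x y" using lipschitz_boundD[OF _ xy] by simp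
        then show "\<bar>u x - u y\<bar> / mdist X x y \<le> L" using pos by (simp add: divide_le_eq)
      qed
      then show ?thesis using pos by (simp add: divide_le_eq)
    qed
  qed
qed

lemma lipschitz_extension:
  assumes \<phi>: "isometric_embedding X Z \<phi>" and u: "lipschitz_fun X u"
  shows "lipschitz_fun Z (lipschitz_extension X Z \<phi> u)"
    and "\<And>x. x \<in> mspace X \<Longrightarrow> lipschitz_extension X Z \<phi> u (\<phi> x) = u x"
proof -
  let ?v = "\<lambda>y. u (inv_into (mspace X) \<phi> y)" and ?L = "Lip X u"
  have E: "lipschitz_extension X Z \<phi> u = mcshane Z (\<phi> ` mspace X) ?L ?v"
    by (simp add: fun_eq_iff lipschitz_extension_def mcshane_def)
  note Lb = lipschitz_bound_Lip[OF u]
  have L0: "0 \<le> ?L" using Lb by (simp add: lipschitz_bound_def)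
  have S: "\<phi> ` mspace X \<subseteq> mspace Z" using \<phi> by (auto simp: isometric_embedding_def)
  have inv: "inv_into (mspace X) \<phi> (\<phi> x) = x" if "x \<in> mspace X" for x
    by (rule inv_into_f_f[OF isometric_embedding_inj[OF \<phi>] that])
  have v: "\<bar>?v p - ?v q\<bar> \<le> ?L * mdist Z p q" if pq: "p \<in> \<phi> ` mspace X" "q \<in> \<phi> ` mspace X" for p q
  proof -
    obtain x y where xy: "x \<in> mspace X" "p = \<phi> x" "y \<in> mspace X" "q = \<phi> y" using pq by blast
    have "mdist Z p q = mdist X x y" using \<phi> xy by (simp add: isometric_embedding_def)
    then show ?thesis using lipschitz_boundD[OF Lb xy(1,3)] xy inv by simp
  qed
  show "lipschitz_fun Z (lipschitz_extension X Z \<phi> u)"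
    unfolding E by (rule lipschitz_funI[OF mcshane_lipschitz[OF S L0 v]])
  fix x assume x: "x \<in> mspace X"
  have "mcshane Z (\<phi> ` mspace X) ?L ?v (\<phi> x) = ?v (\<phi> x)"
    by (rule mcshane_extends[OF S L0 v imageI[OF x]])
  then show "lipschitz_extension X Z \<phi> u (\<phi> x) = u x" unfolding E using inv[OF x] by simp
qed

definition pushed_mass :: "nat \<Rightarrow> 'a current_space \<Rightarrow> 'b metric \<Rightarrow> ('a \<Rightarrow> 'b) \<Rightarrow> 'b measure" where
  "pushed_mass m N Z \<phi> = distr (mass_measure m (completion N) (current N)) (metric_borel Z)
     (extend_to_completion (base N) (completion N) Z \<phi>)"

text \<open>
  The mass measure of a current space, transported to \<open>Z\<close>. On preimages of Borel sets
  under a function on \<open>Z\<close> it computes the masses of the restrictions of the current,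
  because the completion exceeds the space only by a null set.
\<close>

lemma pushed_mass:
  assumes N: "integral_current_space m N" and Z: "mcomplete_of Z" and \<phi>: "isometric_embedding (base N) Z \<phi>"
  shows "linear_on_forms m Z (push_current N Z \<phi>)"
    and "minimal_control m Z (push_current N Z \<phi>) (pushed_mass m N Z \<phi>)"
    and "measure (pushed_mass m N Z \<phi>) (mspace Z) = space_mass m N"
    and "\<And>V C. lipschitz_fun Z V \<Longrightarrow> C \<in> sets borel \<Longrightarrow>
        mass_on m N {x\<in>mspace (base N). V (\<phi> x) \<in> C} = measure (pushed_mass m N Z \<phi>) {z\<in>mspace Z. V z \<in> C}"
proof -
  let ?X = "base N" and ?Xc = "completion N" and ?T = "current N"
  define \<psi> where "\<psi> = extend_to_completion ?X ?Xc Z \<phi>"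
  define \<kappa> where "\<kappa> = mass_measure m ?Xc ?T"
  have comp: "is_completion ?X ?Xc" and int: "integral_current m ?Xc ?T" and set: "current_set m ?Xc ?T = mspace ?X"
    using N by (simp_all add: integral_current_space_def)
  have Xc: "mcomplete_of ?Xc" "mspace ?X \<subseteq> mspace ?Xc" using comp by (simp_all add: is_completion_def)
  have \<psi>: "isometric_embedding ?Xc Z \<psi>" and \<psi>\<phi>: "\<And>x. x \<in> mspace ?X \<Longrightarrow> \<psi> x = \<phi> x"
    unfolding \<psi>_def by (rule extend_to_completion[OF comp Z \<phi>])+
  have T: "metric_current m ?Xc ?T" by (rule integral_current_metric[OF int])
  have rect: "integer_rectifiable m ?Xc ?T" using int by (simp add: integral_current_def)
  note \<kappa>f = metric_currentD(4)[OF T, folded \<kappa>_def]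
  note s\<kappa> = finite_borel_measureD[OF \<kappa>f]
  interpret k: finite_measure \<kappa> by (rule s\<kappa>)
  have push: "push_current N Z \<phi> = pushforward \<psi> ?T" by (simp add: push_current_def \<psi>_def)
  have pm: "pushed_mass m N Z \<phi> = distr \<kappa> (metric_borel Z) \<psi>" by (simp add: pushed_mass_def \<kappa>_def \<psi>_def)
  show "linear_on_forms m Z (push_current N Z \<phi>)"
    unfolding push by (rule linear_on_forms_pushforward[OF \<psi> metric_currentD(1)[OF T]])
  show "minimal_control m Z (push_current N Z \<phi>) (pushed_mass m N Z \<phi>)"
    unfolding push pm \<kappa>_def by (rule minimal_control_pushforward[OF T Xc(1) \<psi>])
  have \<psi>m: "\<psi> \<in> measurable \<kappa> (metric_borel Z)" using isometric_measurable[OF \<psi>] s\<kappa> by (simp cong: measurable_cong_sets)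
  have \<psi>Z: "\<psi> x \<in> mspace Z" if "x \<in> mspace ?Xc" for x using \<psi> that by (auto simp: isometric_embedding_def)
  have md: "measure (pushed_mass m N Z \<phi>) B = measure \<kappa> {x\<in>mspace ?Xc. \<psi> x \<in> B}" if "B \<in> sets (metric_borel Z)" for B
  proof -
    have "\<psi> -` B \<inter> space \<kappa> = {x\<in>mspace ?Xc. \<psi> x \<in> B}" using s\<kappa> by auto
    then show ?thesis unfolding pm by (simp add: measure_distr[OF \<psi>m that])
  qed
  have "{x\<in>mspace ?Xc. \<psi> x \<in> mspace Z} = mspace ?Xc" using \<psi>Z by auto
  then show "measure (pushed_mass m N Z \<phi>) (mspace Z) = space_mass m N"
    by (simp add: md[OF mspace_metric_borel] space_mass_def mass_def \<kappa>_def)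
  fix V C assume V: "lipschitz_fun Z V" and C: "C \<in> sets (borel :: real measure)"
  define P where "P = {x\<in>mspace ?Xc. V (\<psi> x) \<in> C}"
  have VC: "{z\<in>mspace Z. V z \<in> C} \<in> sets (metric_borel Z)"
  proof -
    have "V -` C \<inter> space (metric_borel Z) \<in> sets (metric_borel Z)" by (rule measurable_sets[OF lipschitz_measurable[OF V] C])
    moreover have "V -` C \<inter> space (metric_borel Z) = {z\<in>mspace Z. V z \<in> C}" by auto
    ultimately show ?thesis by simp
  qed
  have P: "P = \<psi> -` {z\<in>mspace Z. V z \<in> C} \<inter> space \<kappa>" using \<psi>Z s\<kappa> by (auto simp: P_def)
  have Ps: "P \<in> sets \<kappa>" unfolding P by (rule measurable_sets[OF \<psi>m VC])
  have X: "mspace ?X \<in> sets (metric_borel ?Xc)"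
    using current_set_sets[OF metric_currentD(4)[OF T]] unfolding set .
  have null: "emeasure \<kappa> (mspace ?Xc - mspace ?X) = 0"
    using rectifiable_concentrated[OF rect] unfolding set \<kappa>_def .
  define A where "A = {x\<in>mspace ?X. V (\<phi> x) \<in> C}"
  have A: "A = P \<inter> mspace ?X" unfolding A_def P_def using \<psi>\<phi> Xc(2) by auto
  have As: "A \<in> sets (metric_borel ?Xc)" unfolding A using X Ps s\<kappa> by simp
  have "mass_on m N A = measure \<kappa> A"
    unfolding mass_on_def \<kappa>_def by (rule mass_restrict[OF metric_currentD(1,2)[OF T] As])
  also have "\<dots> = measure \<kappa> P"
  proof -
    have N0: "mspace ?Xc - mspace ?X \<in> null_sets \<kappa>"
      using null X sets.compl_sets[of "mspace ?X" \<kappa>] s\<kappa> by (auto intro!: null_setsI)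
    have "A = P - (mspace ?Xc - mspace ?X)" unfolding A using Ps sets.sets_into_space[OF Ps] s\<kappa> by auto
    then show ?thesis using measure_Diff_null_set[OF Ps N0] by simp
  qed
  also have "\<dots> = measure (pushed_mass m N Z \<phi>) {z\<in>mspace Z. V z \<in> C}"
  proof -
    have "P = {x\<in>mspace ?Xc. \<psi> x \<in> {z\<in>mspace Z. V z \<in> C}}" using \<psi>Z by (auto simp: P_def)
    then show ?thesis by (simp add: md[OF VC])
  qed
  finally show "mass_on m N {x\<in>mspace ?X. V (\<phi> x) \<in> C} = measure (pushed_mass m N Z \<phi>) {z\<in>mspace Z. V z \<in> C}"
    unfolding A_def .
qed

text \<open>
  The open set inside \<open>C\<close> bounds the limit from below; the complement of
  \<open>C\<close>, together with the convergence of the total masses, bounds it from above.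
\<close>

lemma measure_tendsto_closed:
  assumes \<nu>: "finite_borel_measure Z \<nu>" "\<And>j. finite_borel_measure Z (\<nu>j j)"
    and dom: "open_dominated Z \<nu> \<nu>j"
    and total: "(\<lambda>j. measure (\<nu>j j) (mspace Z)) \<longlonglongrightarrow> measure \<nu> (mspace Z)"
    and W: "openin (mtopology_of Z) W" "W \<subseteq> C" and C: "openin (mtopology_of Z) (mspace Z - C)" "C \<subseteq> mspace Z"
    and eq: "measure \<nu> C \<le> measure \<nu> W"
  shows "(\<lambda>j. measure (\<nu>j j) C) \<longlonglongrightarrow> measure \<nu> C"
proof (rule metric_LIMSEQ_I)
  fix e :: real assume e: "e > 0"
  then have e3: "e/3 > 0" by simp
  have Cs: "C \<in> sets (metric_borel Z)"
  proof -
    have "mspace Z - (mspace Z - C) \<in> sets (metric_borel Z)" by (rule sets.Diff[OF mspace_metric_borel open_metric_borel[OF C(1)]])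
    then show ?thesis using C(2) by (simp add: double_diff)
  qed
  have compl: "measure \<mu> (mspace Z - C) = measure \<mu> (mspace Z) - measure \<mu> C" if "finite_borel_measure Z \<mu>" for \<mu>
    using finite_measure.finite_measure_compl[OF finite_borel_measureD(1)[OF that], of C] Cs finite_borel_measureD[OF that] by simp
  have "\<forall>\<^sub>F j in sequentially. measure \<nu> W \<le> measure (\<nu>j j) W + e/3"
    using dom W(1) e3 unfolding open_dominated_def by blast
  moreover have "\<forall>\<^sub>F j in sequentially. measure \<nu> (mspace Z - C) \<le> measure (\<nu>j j) (mspace Z - C) + e/3"
    using dom C(1) e3 unfolding open_dominated_def by blast
  moreover have "\<forall>\<^sub>F j in sequentially. dist (measure (\<nu>j j) (mspace Z)) (measure \<nu> (mspace Z)) < e/3"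
    using total e3 by (rule tendstoD)
  ultimately have "\<forall>\<^sub>F j in sequentially. dist (measure (\<nu>j j) C) (measure \<nu> C) < e"
  proof eventually_elim
    case (elim j)
    have "measure (\<nu>j j) W \<le> measure (\<nu>j j) C"
      using Cs finite_borel_measureD[OF \<nu>(2)[of j]] by (intro finite_measure.finite_measure_mono W(2)) simp_all
    then show ?case using elim eq compl[OF \<nu>(1)] compl[OF \<nu>(2)[of j]] e unfolding dist_real_def by linarith
  qed
  then show "\<exists>N. \<forall>n\<ge>N. dist (measure (\<nu>j n) C) (measure \<nu> C) < e" by (simp add: eventually_sequentially)
qed

theorem lemma28:
  fixes m :: nat
    and Nj :: "nat \<Rightarrow> 'a current_space" and N :: "'b current_space"
    and Z :: "'z metric" and \<phi>j :: "nat \<Rightarrow> 'a \<Rightarrow> 'z" and \<phi> :: "'b \<Rightarrow> 'z"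
    and u :: "'b \<Rightarrow> real" and U :: "'z \<Rightarrow> real" and uj :: "nat \<Rightarrow> 'a \<Rightarrow> real"
  assumes "\<And>j. integral_current_space m (Nj j)"
    and "\<And>j. precompact_metric (base (Nj j))"
    and "integral_current_space m N"
    and "precompact_metric (base N)"
    and "VF_converges TYPE('w) m Nj N"
    and "mcomplete_of Z"
    and "\<And>j. isometric_embedding (base (Nj j)) Z (\<phi>j j)"
    and "isometric_embedding (base N) Z \<phi>"
    and "(\<lambda>j. flat_dist m Z (push_current (Nj j) Z (\<phi>j j)) (push_current N Z \<phi>)) \<longlonglongrightarrow> 0"
    and "lipschitz_fun (base N) u"
    and "U = lipschitz_extension (base N) Z \<phi> u"
    and "\<And>j. uj j = U \<circ> \<phi>j j"
  shows "\<exists>s :: nat \<Rightarrow> nat. strict_mono s \<and>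
    (AE \<delta> in lborel.
       (\<lambda>k. mass_on m (Nj (s k)) (sublevel (base (Nj (s k))) (uj (s k)) \<delta>))
         \<longlonglongrightarrow> mass_on m N (sublevel (base N) u \<delta>)) \<and>
    (AE \<delta>\<delta> in (lborel :: (real \<times> real) measure). case \<delta>\<delta> of (\<delta>1, \<delta>2) \<Rightarrow> \<delta>1 < \<delta>2 \<longrightarrow>
       (\<lambda>k. mass_on m (Nj (s k)) (annulus (base (Nj (s k))) (uj (s k)) \<delta>1 \<delta>2))
         \<longlonglongrightarrow> mass_on m N (annulus (base N) u \<delta>1 \<delta>2))"
proof -
  note Nj = assms(1) and N = assms(3) and Z = assms(6) and \<phi>j = assms(7) and \<phi> = assms(8)
  define \<nu> where "\<nu> = pushed_mass m N Z \<phi>"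
  define \<nu>j where "\<nu>j j = pushed_mass m (Nj j) Z (\<phi>j j)" for j
  note p = pushed_mass[OF N Z \<phi>, folded \<nu>_def]
  note pj = pushed_mass[OF Nj Z \<phi>j, folded \<nu>j_def]
  have \<nu>f: "finite_borel_measure Z \<nu>" by (rule minimal_controlD(2)[OF p(2)])
  have \<nu>jf: "finite_borel_measure Z (\<nu>j j)" for j by (rule minimal_controlD(2)[OF pj(2)])
  have dom: "open_dominated Z \<nu> \<nu>j"
  proof (rule mass_measure_lsc[OF p(1,2) \<nu>jf])
    fix f ps and e :: real assume f: "bounded_lipschitz Z f" and ps: "unit_tuple m Z ps" and e: "e > 0"
    have "\<forall>\<^sub>F j in sequentially. dist (push_current (Nj j) Z (\<phi>j j) f ps) (push_current N Z \<phi> f ps) < e"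
      by (rule tendstoD[OF flat_limit_on_forms[OF assms(9) f ps] e])
    then show "\<forall>\<^sub>F j in sequentially. \<bar>push_current N Z \<phi> f ps\<bar> \<le> (LINT x|\<nu>j j. \<bar>f x\<bar>) + e"
    proof eventually_elim
      case (elim j)
      have "\<bar>push_current (Nj j) Z (\<phi>j j) f ps\<bar> \<le> (LINT x|\<nu>j j. \<bar>f x\<bar>)"
        using minimal_controlD(1)[OF pj(2)] f ps unfolding controls_iff by blast
      then show ?case using elim unfolding dist_real_def by linarith
    qed
  qed
  have total: "(\<lambda>j. measure (\<nu>j j) (mspace Z)) \<longlonglongrightarrow> measure \<nu> (mspace Z)"
  proof -
    have "(\<lambda>j. intrinsic_flat_dist TYPE('w) m (Nj j) N + ennreal \<bar>space_mass m (Nj j) - space_mass m N\<bar>) \<longlonglongrightarrow> 0"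
      using assms(5) by (simp add: VF_converges_def)
    then have "(\<lambda>j. ennreal \<bar>space_mass m (Nj j) - space_mass m N\<bar>) \<longlonglongrightarrow> 0"
      by (rule tendsto_sandwich[OF _ _ tendsto_const, rotated 2]) (simp_all add: add_increasing)
    then have "(\<lambda>j. \<bar>space_mass m (Nj j) - space_mass m N\<bar>) \<longlonglongrightarrow> 0" by (subst (asm) ennreal_tendsto_0_iff) simp_all
    then have "(\<lambda>j. space_mass m (Nj j) - space_mass m N) \<longlonglongrightarrow> 0" by (rule tendsto_rabs_zero_cancel)
    then show ?thesis unfolding p(3) pj(3) by (simp add: LIM_zero_iff)
  qed
  have U: "lipschitz_fun Z U" and Uu: "\<And>x. x \<in> mspace (base N) \<Longrightarrow> U (\<phi> x) = u x"
    using lipschitz_extension[OF \<phi> assms(10)] assms(11) by simp_all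
  \<comment> \<open>The set \<open>C - W\<close> consists of the end points of the interval \<open>C\<close>.\<close>
  have conv: "(\<lambda>j. measure (\<nu>j j) {z\<in>mspace Z. U z \<in> C}) \<longlonglongrightarrow> measure \<nu> {z\<in>mspace Z. U z \<in> C}"
    if C: "closed C" and W: "open W" "W \<subseteq> C" and F: "finite (C - W)"
      "\<And>\<delta>. \<delta> \<in> C - W \<Longrightarrow> measure \<nu> {z\<in>mspace Z. U z = \<delta>} = 0" for C W
  proof (rule measure_tendsto_closed[OF \<nu>f \<nu>jf dom total])
    interpret n: finite_measure \<nu> by (rule finite_borel_measureD(1)[OF \<nu>f])
    show Wo: "openin (mtopology_of Z) {z\<in>mspace Z. U z \<in> W}" by (rule openin_lipschitz_preimage[OF U W(1)])
    show "{z\<in>mspace Z. U z \<in> W} \<subseteq> {z\<in>mspace Z. U z \<in> C}" using W(2) by blast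
    have "mspace Z - {z\<in>mspace Z. U z \<in> C} = {z\<in>mspace Z. U z \<in> - C}" by blast
    then show "openin (mtopology_of Z) (mspace Z - {z\<in>mspace Z. U z \<in> C})"
      using openin_lipschitz_preimage[OF U open_Compl[OF C]] by simp
    show "{z\<in>mspace Z. U z \<in> C} \<subseteq> mspace Z" by blast
    have pre: "{z\<in>mspace Z. U z \<in> B} \<in> sets \<nu>" if "B \<in> sets borel" for B
    proof -
      have "U -` B \<inter> space \<nu> \<in> sets \<nu>" by (rule measurable_sets[OF lipschitz_borel_measurable[OF \<nu>f U] that])
      moreover have "U -` B \<inter> space \<nu> = {z\<in>mspace Z. U z \<in> B}" using finite_borel_measureD(3)[OF \<nu>f] by auto
      ultimately show ?thesis by simp
    qed
    have lev: "{z\<in>mspace Z. U z = \<delta>} \<in> sets \<nu>" for \<delta> using pre[of "{\<delta>}"] by simp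
    have "measure \<nu> {z\<in>mspace Z. U z \<in> C} \<le> measure \<nu> ({z\<in>mspace Z. U z \<in> W} \<union> (\<Union>\<delta>\<in>C - W. {z\<in>mspace Z. U z = \<delta>}))"
      using pre[of W] W(1) lev F(1) by (intro n.finite_measure_mono) (auto intro!: sets.finite_UN)
    also have "\<dots> \<le> measure \<nu> {z\<in>mspace Z. U z \<in> W} + measure \<nu> (\<Union>\<delta>\<in>C - W. {z\<in>mspace Z. U z = \<delta>})"
      using pre[of W] W(1) lev F(1) by (intro measure_Un_le) (auto intro!: sets.finite_UN)
    also have "measure \<nu> (\<Union>\<delta>\<in>C - W. {z\<in>mspace Z. U z = \<delta>}) \<le> (\<Sum>\<delta>\<in>C - W. measure \<nu> {z\<in>mspace Z. U z = \<delta>})"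
      using lev by (intro n.finite_measure_subadditive_finite[OF F(1)]) auto
    also have "\<dots> = 0" using F(2) by simp
    finally show "measure \<nu> {z\<in>mspace Z. U z \<in> C} \<le> measure \<nu> {z\<in>mspace Z. U z \<in> W}" by simp
  qed
  \<comment> \<open>The atoms of the image of \<open>\<nu>\<close> under \<open>U\<close>.\<close>
  define At where "At = {\<delta>. measure \<nu> {z\<in>mspace Z. U z = \<delta>} \<noteq> 0}"
  have "countable At"
  proof -
    have Um: "U \<in> measurable \<nu> borel" by (rule lipschitz_borel_measurable[OF \<nu>f U])
    have "measure (distr \<nu> borel U) {\<delta>} = measure \<nu> {z\<in>mspace Z. U z = \<delta>}" for \<delta>
    proof -
      have "U -` {\<delta>} \<inter> space \<nu> = {z\<in>mspace Z. U z = \<delta>}" using finite_borel_measureD(3)[OF \<nu>f] by auto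
      then show ?thesis by (simp add: measure_distr[OF Um])
    qed
    moreover have "finite_measure (distr \<nu> borel U)"
      by (rule finite_measure.finite_measure_distr[OF finite_borel_measureD(1)[OF \<nu>f] Um])
    ultimately show ?thesis using finite_measure.countable_support[of "distr \<nu> borel U"] by (simp add: At_def)
  qed
  then have At: "At \<in> null_sets lborel" by (rule countable_imp_null_set_lborel)
  have mN: "mass_on m N {x\<in>mspace (base N). u x \<in> C} = measure \<nu> {z\<in>mspace Z. U z \<in> C}" if "closed C" for C
  proof -
    have "{x\<in>mspace (base N). u x \<in> C} = {x\<in>mspace (base N). U (\<phi> x) \<in> C}" using Uu by auto
    then show ?thesis using p(4)[OF U, of C] that by simp
  qed
  have mNj: "mass_on m (Nj j) {x\<in>mspace (base (Nj j)). uj j x \<in> C} = measure (\<nu>j j) {z\<in>mspace Z. U z \<in> C}" if "closed C" for C j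
    using pj(4)[OF U, of C] that by (simp add: assms(12))
  have sub: "sublevel X v \<delta> = {x\<in>mspace X. v x \<in> {..\<delta>}}" for X v \<delta> by (simp add: sublevel_def)
  have ann: "annulus X v \<delta>1 \<delta>2 = {x\<in>mspace X. v x \<in> {\<delta>1..\<delta>2}}" for X v \<delta>1 \<delta>2 by (simp add: annulus_def)
  have a: "AE \<delta> in lborel. (\<lambda>k. mass_on m (Nj k) (sublevel (base (Nj k)) (uj k) \<delta>)) \<longlonglongrightarrow> mass_on m N (sublevel (base N) u \<delta>)"
    using AE_not_in[OF At]
  proof eventually_elim
    case (elim \<delta>)
    have d: "{..\<delta>} - {..<\<delta>} = {\<delta>}" by auto
    show ?case unfolding sub mN[OF closed_atMost] mNj[OF closed_atMost]
      by (rule conv[of "{..\<delta>}" "{..<\<delta>}"]) (use elim in \<open>auto simp: d At_def\<close>)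
  qed
  have b: "AE \<delta>\<delta> in (lborel :: (real \<times> real) measure). case \<delta>\<delta> of (\<delta>1, \<delta>2) \<Rightarrow> \<delta>1 < \<delta>2 \<longrightarrow>
       (\<lambda>k. mass_on m (Nj k) (annulus (base (Nj k)) (uj k) \<delta>1 \<delta>2)) \<longlonglongrightarrow> mass_on m N (annulus (base N) u \<delta>1 \<delta>2)"
  proof -
    have "At \<times> UNIV \<in> null_sets (lborel \<Otimes>\<^sub>M lborel)" "UNIV \<times> At \<in> null_sets (lborel \<Otimes>\<^sub>M lborel)"
      using At by (auto intro!: null_setsI simp: lborel.emeasure_pair_measure_Times null_sets_def)
    then have "AE \<delta>\<delta> in (lborel :: (real \<times> real) measure). \<delta>\<delta> \<notin> At \<times> UNIV"
      "AE \<delta>\<delta> in (lborel :: (real \<times> real) measure). \<delta>\<delta> \<notin> UNIV \<times> At"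
      unfolding lborel_prod by (auto dest: AE_not_in)
    then show ?thesis
    proof eventually_elim
      case (elim \<delta>\<delta>)
      obtain \<delta>1 \<delta>2 where eq: "\<delta>\<delta> = (\<delta>1, \<delta>2)" by (cases \<delta>\<delta>)
      have "(\<lambda>k. mass_on m (Nj k) (annulus (base (Nj k)) (uj k) \<delta>1 \<delta>2)) \<longlonglongrightarrow> mass_on m N (annulus (base N) u \<delta>1 \<delta>2)"
        if lt: "\<delta>1 < \<delta>2"
      proof -
        have d: "{\<delta>1..\<delta>2} - {\<delta>1<..<\<delta>2} = {\<delta>1, \<delta>2}" using lt by auto
        show ?thesis unfolding ann mN[OF closed_atLeastAtMost] mNj[OF closed_atLeastAtMost]
          by (rule conv[of "{\<delta>1..\<delta>2}" "{\<delta>1<..<\<delta>2}"]) (use elim eq in \<open>auto simp: d At_def\<close>)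
      qed
      then show ?case by (simp add: eq)
    qed
  qed
  show ?thesis
    using a b by (intro exI[of _ "\<lambda>k. k"]) (simp add: strict_mono_def)
qed

end
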